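(* Let $p>q\ge 0$ be coprime integers with $(p,q)\neq(1,0)$, and let $M=Y^{p,q}$ be the corresponding toric Sasaki-Einstein $5$-manifold. Then the transverse Levi-Civita connection on $\wedge^-H^*$ is irreducible.
   Context: $Y^{p,q}$ denotes the Sasaki-Einstein manifold of Gauntlett-Martelli-Sparks-Waldram, diffeomorphic to $S^2\times S^3$. Explicitly, for coprime $p>q\ge1$ it carries the metric $$g=\tfrac{1-y}{6}(d\theta^2+\sin^2\theta\,d\phi^2)+\tfrac{dy^2}{w(y)v(y)}+\tfrac{v(y)}{9}(d\psi-\cos\theta\,d\phi)^2+w(y)\bigl[d\alpha+f(y)(d\psi-\cos\theta\,d\phi)\bigr]^2,$$ $w=\frac{2(a-y^2)}{1-y}$, $v=\frac{a-3y^2+2y^3}{a-y^2}$, $f=\frac{a-2y+y^2}{6(a-y^2)}$, $a=\frac12-\frac{p^2-3q^2}{4p^3}\sqrt{4p^2-3q^2}\in(0,1)$, with $0\le\theta\le\pi$, $\phi,\psi$ of period $2\pi$, $y_1\le y\le y_2$ where $y_1<0<y_2$ are the negative root and the smallest positive root of $a-3y^2+2y^3$, and $\alpha$ of period $2\pi\ell$, $\ell=\frac{q}{3q^2-2p^2+p\sqrt{4p^2-3q^2}}$ (extended smoothly over the coordinate degenerations). The Reeb vector field is $\xi=3\partial_\psi-\frac12\partial_\alpha$, $\eta=g(\xi,\cdot)$ and $\Phi X=-\nabla_X\xi$, $\nabla$ the Levi-Civita connection of $g$; $(\xi,\eta,\Phi,g)$ is a Sasakian structure and $g$ is Einstein.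 $H=\ker\eta$, $\omega(X,Y)=g(X,\Phi Y)$, and $H$ is oriented by $\omega^2$; $\wedge^2H^*=\wedge^+H^*\oplus\wedge^-H^*$ is the splitting into self-dual and anti-self-dual transverse $2$-forms. The metric on $H$ is locally pulled back from the space of leaves of the foliation by $\xi$; the transverse Levi-Civita connection $\overline{\nabla}$ on $H$ is the connection locally pulled back from the Levi-Civita connection of this quotient metric, and it induces a connection with structure group $SO(3)$ on $\wedge^-H^*$. A connection on a principal $G$-bundle is irreducible if its group of covariantly constant gauge transformations equals the centre of $G$ (here $G=SO(3)$, with trivial centre). *)

theory Defs
  imports "HOL-Analysis.Analysis"
begin

section \<open>Smooth 5-manifolds and tensor fields\<close>

text \<open>Both predicates are meant for open sets.\<close>

primrec Ck_on :: "nat \<Rightarrow> 'a::real_normed_vector set \<Rightarrow> ('a \<Rightarrow> 'b::real_normed_vector) \<Rightarrow> bool" where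
  "Ck_on 0 S f \<longleftrightarrow> continuous_on S f"
| "Ck_on (Suc k) S f \<longleftrightarrow>
     (\<forall>x\<in>S. f differentiable (at x)) \<and> (\<forall>v. Ck_on k S (\<lambda>x. frechet_derivative f (at x) v))"

definition smooth_on :: "'a::real_normed_vector set \<Rightarrow> ('a \<Rightarrow> 'b::real_normed_vector) \<Rightarrow> bool" where
  "smooth_on S f \<longleftrightarrow> (\<forall>k. Ck_on k S f)"

definition local_diffeo_on :: "'a::real_normed_vector set \<Rightarrow> ('a \<Rightarrow> 'b::real_normed_vector) \<Rightarrow> bool" where
  "local_diffeo_on S f \<longleftrightarrow> smooth_on S f \<and> (\<forall>x\<in>S. bij (frechet_derivative f (at x)))"

text \<open>
  The model space is split as \<open>\<real>\<^sup>4 \<times> \<real>\<close> because the fifth coordinate will be used as the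
  coordinate along the leaves of a foliation.  A parametrisation \<open>(V, X)\<close> of a manifold with
  point set of type \<open>'m\<close> is an open set \<open>V\<close> and a local diffeomorphism \<open>X\<close> from \<open>V\<close>
  to the manifold, that is, locally an inverse chart.  It need not be globally injective, so an
  angular coordinate may range over an interval longer than its period.  The smooth structure
  given by a set of parametrisations is the set of all parametrisations that factor locally
  through the given ones.
\<close>

type_synonym E5 = "(real^4) \<times> real"
type_synonym 'm param = "E5 set \<times> (E5 \<Rightarrow> 'm)"
type_synonym 'm metric = "'m param \<Rightarrow> E5 \<Rightarrow> E5 \<Rightarrow> E5 \<Rightarrow> real"
type_synonym 'm vfield = "'m param \<Rightarrow> E5 \<Rightarrow> E5"

definition smooth_structure :: "'m param set \<Rightarrow> 'm param set" where
  "smooth_structure A0 =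
     {(V, X). open V \<and>
        (\<forall>w\<in>V. \<exists>W D Z G. open W \<and> w \<in> W \<and> W \<subseteq> V \<and> (D, Z) \<in> A0 \<and> local_diffeo_on W G \<and>
           G ` W \<subseteq> D \<and> (\<forall>w'\<in>W. X w' = Z (G w')))}"

definition transition :: "'m param \<Rightarrow> 'm param \<Rightarrow> E5 set \<Rightarrow> (E5 \<Rightarrow> E5) \<Rightarrow> bool" where
  "transition \<kappa> \<kappa>' W \<tau> \<longleftrightarrow>
     open W \<and> W \<subseteq> fst \<kappa> \<and> local_diffeo_on W \<tau> \<and> \<tau> ` W \<subseteq> fst \<kappa>' \<and> (\<forall>w\<in>W. snd \<kappa> w = snd \<kappa>' (\<tau> w))"

text \<open>
  A tensor field is given by its components in every parametrisation, subject to the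
  transformation law under all transition maps.
\<close>

definition riemannian_metric :: "'m param set \<Rightarrow> 'm metric \<Rightarrow> bool" where
  "riemannian_metric A g \<longleftrightarrow>
     (\<forall>\<kappa>\<in>A. \<forall>w\<in>fst \<kappa>. bilinear (g \<kappa> w) \<and> (\<forall>a b. g \<kappa> w a b = g \<kappa> w b a) \<and> (\<forall>a. a \<noteq> 0 \<longrightarrow> 0 < g \<kappa> w a a)) \<and>
     (\<forall>\<kappa>\<in>A. \<forall>a b. smooth_on (fst \<kappa>) (\<lambda>w. g \<kappa> w a b)) \<and>
     (\<forall>\<kappa>\<in>A. \<forall>\<kappa>'\<in>A. \<forall>W \<tau>. transition \<kappa> \<kappa>' W \<tau> \<longrightarrow>
        (\<forall>w\<in>W. \<forall>a b. g \<kappa> w a b =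
           g \<kappa>' (\<tau> w) (frechet_derivative \<tau> (at w) a) (frechet_derivative \<tau> (at w) b)))"

definition vector_field :: "'m param set \<Rightarrow> 'm vfield \<Rightarrow> bool" where
  "vector_field A \<xi> \<longleftrightarrow>
     (\<forall>\<kappa>\<in>A. smooth_on (fst \<kappa>) (\<xi> \<kappa>)) \<and>
     (\<forall>\<kappa>\<in>A. \<forall>\<kappa>'\<in>A. \<forall>W \<tau>. transition \<kappa> \<kappa>' W \<tau> \<longrightarrow>
        (\<forall>w\<in>W. frechet_derivative \<tau> (at w) (\<xi> \<kappa> w) = \<xi> \<kappa>' (\<tau> w)))"

text \<open>
  The Levi-Civita connection of a metric \<open>h\<close> on an open subset of a Euclidean space, by the
  Koszul formula for constant fields:  \<open>\<nabla>\<^sub>a Y = DY(a) + christoffel h x a Y\<close>.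
\<close>

definition christoffel ::
    "('e::euclidean_space \<Rightarrow> 'e \<Rightarrow> 'e \<Rightarrow> real) \<Rightarrow> 'e \<Rightarrow> 'e \<Rightarrow> 'e \<Rightarrow> 'e" where
  "christoffel h x a b =
     (THE v. \<forall>c. 2 * h x v c =
          frechet_derivative (\<lambda>z. h z b c) (at x) a
        + frechet_derivative (\<lambda>z. h z a c) (at x) b
        - frechet_derivative (\<lambda>z. h z a b) (at x) c)"


section \<open>The transverse geometry of a Riemannian 5-manifold with Reeb field\<close>

definition eta :: "'m metric \<Rightarrow> 'm vfield \<Rightarrow> 'm param \<Rightarrow> E5 \<Rightarrow> E5 \<Rightarrow> real" where
  "eta g \<xi> \<kappa> w a = g \<kappa> w (\<xi> \<kappa> w) a"

definition Phi :: "'m metric \<Rightarrow> 'm vfield \<Rightarrow> 'm param \<Rightarrow> E5 \<Rightarrow> E5 \<Rightarrow> E5" where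
  "Phi g \<xi> \<kappa> w a = - (frechet_derivative (\<xi> \<kappa>) (at w) a + christoffel (g \<kappa>) w a (\<xi> \<kappa> w))"

definition omega :: "'m metric \<Rightarrow> 'm vfield \<Rightarrow> 'm param \<Rightarrow> E5 \<Rightarrow> E5 \<Rightarrow> E5 \<Rightarrow> real" where
  "omega g \<xi> \<kappa> w a b = g \<kappa> w a (Phi g \<xi> \<kappa> w b)"

text \<open>
  In a foliated parametrisation the leaves are the lines \<open>{x} \<times> T\<close>, the space of leaves is
  \<open>S\<close> with projection \<open>fst\<close>, and the differential \<open>fst\<close> of the projection identifies the fibre
  of \<open>H = ker \<eta>\<close> at \<open>(x, t)\<close> with \<open>\<real>\<^sup>4\<close>, the tangent space of \<open>S\<close> at \<open>x\<close>.  Elements of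
  \<open>\<Lambda>\<^sup>2 H\<^sup>*\<close> are written as bilinear forms on \<open>\<real>\<^sup>4\<close> by means of this identification.
\<close>

definition foliated :: "'m param set \<Rightarrow> 'm vfield \<Rightarrow> 'm param \<Rightarrow> bool" where
  "foliated A \<xi> \<kappa> \<longleftrightarrow> \<kappa> \<in> A \<and>
     (\<exists>S T. fst \<kappa> = S \<times> T \<and> open S \<and> open T \<and> connected T) \<and> (\<forall>w\<in>fst \<kappa>. \<xi> \<kappa> w = (0, 1))"

definition horizontal_lift :: "'m metric \<Rightarrow> 'm vfield \<Rightarrow> 'm param \<Rightarrow> E5 \<Rightarrow> real^4 \<Rightarrow> E5" where
  "horizontal_lift g \<xi> \<kappa> w a = (THE v. eta g \<xi> \<kappa> w v = 0 \<and> fst v = a)"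

text \<open>The value below does not depend on \<open>t\<close> when \<open>\<xi>\<close> is a unit Killing field.\<close>

definition quotient_metric ::
    "'m metric \<Rightarrow> 'm vfield \<Rightarrow> 'm param \<Rightarrow> real^4 \<Rightarrow> real^4 \<Rightarrow> real^4 \<Rightarrow> real" where
  "quotient_metric g \<xi> \<kappa> x a b =
     (THE r. \<forall>t. (x, t) \<in> fst \<kappa> \<longrightarrow>
        r = g \<kappa> (x, t) (horizontal_lift g \<xi> \<kappa> (x, t) a) (horizontal_lift g \<xi> \<kappa> (x, t) b))"

type_synonym form2 = "real^4 \<Rightarrow> real^4 \<Rightarrow> real"

definition omega_H :: "'m metric \<Rightarrow> 'm vfield \<Rightarrow> 'm param \<Rightarrow> E5 \<Rightarrow> form2" where
  "omega_H g \<xi> \<kappa> w a b =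
     omega g \<xi> \<kappa> w (horizontal_lift g \<xi> \<kappa> w a) (horizontal_lift g \<xi> \<kappa> w b)"

text \<open>Orthonormal frames of \<open>H\<close> on which \<open>\<omega> \<and> \<omega>\<close> is positive.\<close>

definition oriented_onb :: "'m metric \<Rightarrow> 'm vfield \<Rightarrow> 'm param \<Rightarrow> E5 \<Rightarrow> (4 \<Rightarrow> real^4) \<Rightarrow> bool" where
  "oriented_onb g \<xi> \<kappa> w e \<longleftrightarrow>
     (\<forall>i j. quotient_metric g \<xi> \<kappa> (fst w) (e i) (e j) = (if i = j then 1 else 0)) \<and>
     (let om = (\<lambda>i j. omega_H g \<xi> \<kappa> w (e i) (e j))
      in 2 * (om 1 2 * om 3 4 - om 1 3 * om 2 4 + om 1 4 * om 2 3) > 0)"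

definition two_form :: "form2 \<Rightarrow> bool" where
  "two_form \<beta> \<longleftrightarrow> bilinear \<beta> \<and> (\<forall>a. \<beta> a a = 0)"

text \<open>
  The Hodge star on 2-forms is given by \<open>(*\<beta>)(e\<^sub>1, e\<^sub>2) = \<beta>(e\<^sub>3, e\<^sub>4)\<close> for all oriented
  orthonormal frames (the other components follow by even permutations of the frame); the fibre of
  \<open>\<Lambda>\<^sup>- H\<^sup>*\<close> consists of the 2-forms with \<open>*\<beta> = -\<beta>\<close>.
\<close>

definition hodge_star_of :: "'m metric \<Rightarrow> 'm vfield \<Rightarrow> 'm param \<Rightarrow> E5 \<Rightarrow> form2 \<Rightarrow> form2 \<Rightarrow> bool" where
  "hodge_star_of g \<xi> \<kappa> w \<beta> \<gamma> \<longleftrightarrow> two_form \<gamma> \<and> (\<forall>e. oriented_onb g \<xi> \<kappa> w e \<longrightarrow> \<gamma> (e 1) (e 2) = \<beta> (e 3) (e 4))"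

definition asd :: "'m metric \<Rightarrow> 'm vfield \<Rightarrow> 'm param \<Rightarrow> E5 \<Rightarrow> form2 set" where
  "asd g \<xi> \<kappa> w = {\<beta>. two_form \<beta> \<and> hodge_star_of g \<xi> \<kappa> w \<beta> (\<lambda>a b. - \<beta> a b)}"

definition asd_section :: "'m metric \<Rightarrow> 'm vfield \<Rightarrow> 'm param \<Rightarrow> E5 set \<Rightarrow> (E5 \<Rightarrow> form2) \<Rightarrow> bool" where
  "asd_section g \<xi> \<kappa> W \<beta> \<longleftrightarrow>
     (\<forall>w\<in>W. \<beta> w \<in> asd g \<xi> \<kappa> w) \<and> (\<forall>a b. smooth_on W (\<lambda>w. \<beta> w a b))"

text \<open>
  The transverse Levi-Civita connection on forms: the pullback, along the projection \<open>fst\<close> to the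
  space of leaves, of the connection induced by the Levi-Civita connection of the quotient metric.
\<close>

definition transverse_nabla ::
    "'m metric \<Rightarrow> 'm vfield \<Rightarrow> 'm param \<Rightarrow> (E5 \<Rightarrow> form2) \<Rightarrow> E5 \<Rightarrow> E5 \<Rightarrow> form2" where
  "transverse_nabla g \<xi> \<kappa> \<beta> w v a b =
     (let \<Gamma> = christoffel (quotient_metric g \<xi> \<kappa>) (fst w) (fst v)
      in frechet_derivative (\<lambda>z. \<beta> z a b) (at w) v - \<beta> w (\<Gamma> a) b - \<beta> w a (\<Gamma> b))"


section \<open>Gauge transformations and irreducibility\<close>

definition form_inner :: "(4 \<Rightarrow> real^4) \<Rightarrow> form2 \<Rightarrow> form2 \<Rightarrow> real" where
  "form_inner e \<beta> \<gamma> = (\<Sum>i\<in>UNIV. \<Sum>j\<in>UNIV. \<beta> (e i) (e j) * \<gamma> (e i) (e j)) / 2"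

definition asd_frame :: "'m metric \<Rightarrow> 'm vfield \<Rightarrow> 'm param \<Rightarrow> E5 \<Rightarrow> (3 \<Rightarrow> form2) \<Rightarrow> bool" where
  "asd_frame g \<xi> \<kappa> w b \<longleftrightarrow> (\<forall>i. b i \<in> asd g \<xi> \<kappa> w) \<and>
     (\<forall>e. oriented_onb g \<xi> \<kappa> w e \<longrightarrow> (\<forall>i j. form_inner e (b i) (b j) = (if i = j then 1 else 0)))"

definition combine :: "(3 \<Rightarrow> form2) \<Rightarrow> real^3 \<Rightarrow> form2" where
  "combine b v = (\<lambda>x y. \<Sum>i\<in>UNIV. v $ i * b i x y)"

definition pullback_form :: "(real^4 \<Rightarrow> real^4) \<Rightarrow> form2 \<Rightarrow> form2" where
  "pullback_form L \<beta> = (\<lambda>a b. \<beta> (L a) (L b))"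

text \<open>
  A gauge transformation of the \<open>SO(3)\<close>-bundle underlying \<open>\<Lambda>\<^sup>- H\<^sup>*\<close>, written as a smooth bundle
  automorphism \<open>u \<kappa> w\<close> of \<open>\<Lambda>\<^sup>- H\<^sup>*\<close> that lies fibrewise in the special orthogonal group.  As
  \<open>SO(3)\<close> is normal in \<open>O(3)\<close>, the matrices may be taken in orthonormal frames of either
  orientation.  The third clause is the transformation law under transition maps \<open>\<tau>\<close>; the map
  \<open>\<lambda>a. fst (D\<tau> (a, 0))\<close> is the differential of the induced map of leaf spaces.
\<close>

definition gauge_transformation ::
    "'m param set \<Rightarrow> 'm metric \<Rightarrow> 'm vfield \<Rightarrow> ('m param \<Rightarrow> E5 \<Rightarrow> form2 \<Rightarrow> form2) \<Rightarrow> bool" where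
  "gauge_transformation A g \<xi> u \<longleftrightarrow>
     (\<forall>\<kappa>. foliated A \<xi> \<kappa> \<longrightarrow> (\<forall>w\<in>fst \<kappa>. \<forall>b. asd_frame g \<xi> \<kappa> w b \<longrightarrow>
        (\<exists>Q::real^3^3. rotation_matrix Q \<and> (\<forall>v. u \<kappa> w (combine b v) = combine b (Q *v v))))) \<and>
     (\<forall>\<kappa> W \<beta>. foliated A \<xi> \<kappa> \<and> open W \<and> W \<subseteq> fst \<kappa> \<and> asd_section g \<xi> \<kappa> W \<beta> \<longrightarrow>
        asd_section g \<xi> \<kappa> W (\<lambda>w. u \<kappa> w (\<beta> w))) \<and>
     (\<forall>\<kappa> \<kappa>' W \<tau>. foliated A \<xi> \<kappa> \<and> foliated A \<xi> \<kappa>' \<and> transition \<kappa> \<kappa>' W \<tau> \<longrightarrow>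
        (\<forall>w\<in>W. \<forall>\<beta>\<in>asd g \<xi> \<kappa>' (\<tau> w).
           let L = (\<lambda>a. fst (frechet_derivative \<tau> (at w) (a, 0)))
           in u \<kappa> w (pullback_form L \<beta>) = pullback_form L (u \<kappa>' (\<tau> w) \<beta>)))"

definition covariantly_constant ::
    "'m param set \<Rightarrow> 'm metric \<Rightarrow> 'm vfield \<Rightarrow> ('m param \<Rightarrow> E5 \<Rightarrow> form2 \<Rightarrow> form2) \<Rightarrow> bool" where
  "covariantly_constant A g \<xi> u \<longleftrightarrow>
     (\<forall>\<kappa> W \<beta>. foliated A \<xi> \<kappa> \<and> open W \<and> W \<subseteq> fst \<kappa> \<and> asd_section g \<xi> \<kappa> W \<beta> \<longrightarrow>
        (\<forall>w\<in>W. \<forall>v. transverse_nabla g \<xi> \<kappa> (\<lambda>z. u \<kappa> z (\<beta> z)) w v =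
                   u \<kappa> w (transverse_nabla g \<xi> \<kappa> \<beta> w v)))"

definition SO3_centre :: "(real^3^3) set" where
  "SO3_centre = {Z. rotation_matrix Z \<and> (\<forall>Q. rotation_matrix Q \<longrightarrow> Z ** Q = Q ** Z)}"

text \<open>
  An element of the centre acts as a gauge transformation by its matrix with respect to every
  orthonormal frame.
\<close>

definition acts_as ::
    "'m param set \<Rightarrow> 'm metric \<Rightarrow> 'm vfield \<Rightarrow> ('m param \<Rightarrow> E5 \<Rightarrow> form2 \<Rightarrow> form2) \<Rightarrow> real^3^3 \<Rightarrow> bool" where
  "acts_as A g \<xi> u Z \<longleftrightarrow>
     (\<forall>\<kappa>. foliated A \<xi> \<kappa> \<longrightarrow> (\<forall>w\<in>fst \<kappa>. \<forall>b. asd_frame g \<xi> \<kappa> w b \<longrightarrow>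
        (\<forall>v. u \<kappa> w (combine b v) = combine b (Z *v v))))"

definition transverse_LC_irreducible :: "'m param set \<Rightarrow> 'm metric \<Rightarrow> 'm vfield \<Rightarrow> bool" where
  "transverse_LC_irreducible A g \<xi> \<longleftrightarrow>
     (\<forall>u. gauge_transformation A g \<xi> u \<longrightarrow>
        (covariantly_constant A g \<xi> u \<longleftrightarrow> (\<exists>Z\<in>SO3_centre. acts_as A g \<xi> u Z)))"


section \<open>The manifolds \<open>Y\<^sup>p\<^sup>,\<^sup>q\<close>\<close>

definition Y_a :: "nat \<Rightarrow> nat \<Rightarrow> real" where
  "Y_a p q = 1 / 2 - ((real p)^2 - 3 * (real q)^2) / (4 * (real p)^3) * sqrt (4 * (real p)^2 - 3 * (real q)^2)"

definition Y_l :: "nat \<Rightarrow> nat \<Rightarrow> real" where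
  "Y_l p q = real q / (3 * (real q)^2 - 2 * (real p)^2 + real p * sqrt (4 * (real p)^2 - 3 * (real q)^2))"

definition Y_w :: "nat \<Rightarrow> nat \<Rightarrow> real \<Rightarrow> real" where
  "Y_w p q y = 2 * (Y_a p q - y^2) / (1 - y)"

definition Y_v :: "nat \<Rightarrow> nat \<Rightarrow> real \<Rightarrow> real" where
  "Y_v p q y = (Y_a p q - 3 * y^2 + 2 * y^3) / (Y_a p q - y^2)"

definition Y_f :: "nat \<Rightarrow> nat \<Rightarrow> real \<Rightarrow> real" where
  "Y_f p q y = (Y_a p q - 2 * y + y^2) / (6 * (Y_a p q - y^2))"

definition Y_y1 :: "nat \<Rightarrow> nat \<Rightarrow> real" where
  "Y_y1 p q = (THE y. y < 0 \<and> Y_a p q - 3 * y^2 + 2 * y^3 = 0)"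

definition Y_y2 :: "nat \<Rightarrow> nat \<Rightarrow> real" where
  "Y_y2 p q = (LEAST y. 0 < y \<and> Y_a p q - 3 * y^2 + 2 * y^3 = 0)"

text \<open>The coordinates \<open>(\<theta>, \<phi>, y, \<psi>, \<alpha>)\<close> are ordered as \<open>((\<theta>, \<phi>, y, \<psi>), \<alpha>)\<close>.\<close>

definition mk :: "real \<Rightarrow> real \<Rightarrow> real \<Rightarrow> real \<Rightarrow> real \<Rightarrow> E5" where
  "mk \<theta> \<phi> y \<psi> \<alpha> = (vector [\<theta>, \<phi>, y, \<psi>], \<alpha>)"

definition Y_form :: "nat \<Rightarrow> nat \<Rightarrow> E5 \<Rightarrow> E5 \<Rightarrow> E5 \<Rightarrow> real" where
  "Y_form p q c a b =
     (let \<theta> = fst c $ 1; y = fst c $ 3;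
          sig = (\<lambda>d::E5. fst d $ 4 - cos \<theta> * fst d $ 2);
          fib = (\<lambda>d::E5. snd d + Y_f p q y * sig d)
      in (1 - y) / 6 * (fst a $ 1 * fst b $ 1 + (sin \<theta>)^2 * (fst a $ 2 * fst b $ 2))
         + fst a $ 3 * fst b $ 3 / (Y_w p q y * Y_v p q y)
         + Y_v p q y / 9 * (sig a * sig b)
         + Y_w p q y * (fib a * fib b))"

text \<open>
  Angular directions are triples \<open>(\<phi>, \<psi>, \<alpha>)\<close>.  The Killing fields that collapse at
  \<open>\<theta> = 0\<close>, \<open>\<theta> = \<pi>\<close> and \<open>y = y\<^sub>i\<close> are
  \<open>\<partial>\<^sub>\<phi> + \<partial>\<^sub>\<psi>\<close>, \<open>\<partial>\<^sub>\<phi> - \<partial>\<^sub>\<psi>\<close> and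
  \<open>\<partial>\<^sub>\<psi> - f(y\<^sub>i) \<partial>\<^sub>\<alpha>\<close>; smoothness of the metric forces each of them to have
  period \<open>2\<pi>\<close>.  The period lattice generated by them and by \<open>2\<pi>\<ell>\<partial>\<^sub>\<alpha>\<close> projects onto the
  lattice of periods \<open>2\<pi>\<close> of \<open>(\<phi>, \<psi>)\<close> on the base of the circle bundle with fibre
  coordinate \<open>\<alpha>\<close>, with kernel generated by \<open>2\<pi>\<ell>\<partial>\<^sub>\<alpha>\<close>, because
  \<open>f(y\<^sub>1) = \<ell>(p + q)/2\<close> and \<open>f(y\<^sub>2) = -\<ell>(p - q)/2\<close>.  When \<open>p + q\<close> is odd, going once around
  \<open>\<phi>\<close> or \<open>\<psi>\<close> on the base shifts \<open>\<alpha>\<close> by half of its period.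
\<close>

definition pole_dir :: "real \<Rightarrow> real \<times> real \<times> real" where
  "pole_dir s = (1, s, 0)"

definition end_dir :: "nat \<Rightarrow> nat \<Rightarrow> real \<Rightarrow> real \<times> real \<times> real" where
  "end_dir p q y = (0, 1, - Y_f p q y)"

definition Y_lattice :: "nat \<Rightarrow> nat \<Rightarrow> (real \<times> real \<times> real) set" where
  "Y_lattice p q =
     {(2 * pi) *\<^sub>R (of_int n1 *\<^sub>R pole_dir 1 + of_int n2 *\<^sub>R pole_dir (-1)
        + of_int n3 *\<^sub>R end_dir p q (Y_y1 p q) + of_int n4 *\<^sub>R end_dir p q (Y_y2 p q)
        + of_int n5 *\<^sub>R (0, 0, Y_l p q)) | n1 n2 n3 n4 n5 :: int. True}"

definition Y_collapse :: "nat \<Rightarrow> nat \<Rightarrow> real \<Rightarrow> real \<Rightarrow> (real \<times> real \<times> real) set" where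
  "Y_collapse p q \<theta> y =
     {s1 *\<^sub>R pole_dir 1 + s2 *\<^sub>R pole_dir (-1)
        + s3 *\<^sub>R end_dir p q (Y_y1 p q) + s4 *\<^sub>R end_dir p q (Y_y2 p q) | s1 s2 s3 s4 :: real.
        (s1 = 0 \<or> \<theta> = 0) \<and> (s2 = 0 \<or> \<theta> = pi) \<and> (s3 = 0 \<or> y = Y_y1 p q) \<and> (s4 = 0 \<or> y = Y_y2 p q)}"

definition Y_angles :: "E5 \<Rightarrow> real \<times> real \<times> real" where
  "Y_angles c = (fst c $ 2, fst c $ 4, snd c)"

definition Y_box :: "nat \<Rightarrow> nat \<Rightarrow> E5 set" where
  "Y_box p q = {c. 0 \<le> fst c $ 1 \<and> fst c $ 1 \<le> pi \<and> Y_y1 p q \<le> fst c $ 3 \<and> fst c $ 3 \<le> Y_y2 p q}"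

text \<open>
  The points of \<open>Y\<^sup>p\<^sup>,\<^sup>q\<close> are the equivalence classes \<open>Y_point p q c\<close> of \<open>c \<in> Y_box p q\<close>.
\<close>

definition Y_point :: "nat \<Rightarrow> nat \<Rightarrow> E5 \<Rightarrow> E5 set" where
  "Y_point p q c =
     {c' \<in> Y_box p q. fst c' $ 1 = fst c $ 1 \<and> fst c' $ 3 = fst c $ 3 \<and>
        (\<exists>l\<in>Y_lattice p q. \<exists>s\<in>Y_collapse p q (fst c $ 1) (fst c $ 3). Y_angles c' = Y_angles c + l + s)}"

definition Y_coords :: "nat \<Rightarrow> nat \<Rightarrow> E5 set param" where
  "Y_coords p q =
     ({c. 0 < fst c $ 1 \<and> fst c $ 1 < pi \<and> Y_y1 p q < fst c $ 3 \<and> fst c $ 3 < Y_y2 p q}, Y_point p q)"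

text \<open>
  Parametrisation of a neighbourhood of the locus \<open>cos \<theta> = s\<close>, \<open>y = ya\<close>, where \<open>s = 1\<close> or
  \<open>s = -1\<close> and \<open>ya\<close> is one end of the range of \<open>y\<close> and \<open>yb\<close> the other end.  The first two
  and the next two model coordinates are Cartesian coordinates in the planes rotated by
  \<open>pole_dir s\<close> and \<open>end_dir p q ya\<close>; in polar form the radii \<open>r\<close>, \<open>\<rho>\<close> satisfy
  \<open>r\<^sup>2 = (1 - s cos \<theta>) / (1 + s cos \<theta>)\<close> and \<open>\<rho>\<^sup>2 = (y - ya) / (yb - y)\<close>.
\<close>

definition Y_corner :: "nat \<Rightarrow> nat \<Rightarrow> real \<Rightarrow> real \<Rightarrow> real \<Rightarrow> E5 set param" where
  "Y_corner p q s ya yb =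
     (UNIV, \<lambda>z.
        let r2 = (fst z $ 1)^2 + (fst z $ 2)^2; \<rho>2 = (fst z $ 3)^2 + (fst z $ 4)^2;
            A = Arg (Complex (fst z $ 1) (fst z $ 2)); B = Arg (Complex (fst z $ 3) (fst z $ 4))
        in Y_point p q (mk (arccos (s * (1 - r2) / (1 + r2))) A ((ya + \<rho>2 * yb) / (1 + \<rho>2))
                           (s * A + B) (- Y_f p q ya * B + Y_l p q * snd z)))"

definition Y_structure :: "nat \<Rightarrow> nat \<Rightarrow> E5 set param set" where
  "Y_structure p q = smooth_structure
     {Y_coords p q,
      Y_corner p q 1 (Y_y1 p q) (Y_y2 p q), Y_corner p q 1 (Y_y2 p q) (Y_y1 p q),
      Y_corner p q (-1) (Y_y1 p q) (Y_y2 p q), Y_corner p q (-1) (Y_y2 p q) (Y_y1 p q)}"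

text \<open>
  The smooth extensions of the coordinate metric and of \<open>\<xi> = 3 \<partial>\<^sub>\<psi> - \<partial>\<^sub>\<alpha> / 2\<close> to all
  of \<open>Y\<^sup>p\<^sup>,\<^sup>q\<close>.  As the image of \<open>Y_coords\<close> is dense, there is at most one extension up to values
  outside the domains of the parametrisations.
\<close>

definition Y_metric :: "nat \<Rightarrow> nat \<Rightarrow> E5 set metric \<Rightarrow> bool" where
  "Y_metric p q g \<longleftrightarrow> riemannian_metric (Y_structure p q) g \<and>
     (\<forall>c\<in>fst (Y_coords p q). \<forall>a b. g (Y_coords p q) c a b = Y_form p q c a b)"

definition Y_reeb :: "nat \<Rightarrow> nat \<Rightarrow> E5 set vfield \<Rightarrow> bool" where
  "Y_reeb p q \<xi> \<longleftrightarrow> vector_field (Y_structure p q) \<xi> \<and>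
     (\<forall>c\<in>fst (Y_coords p q). \<xi> (Y_coords p q) c = mk 0 0 0 3 (- 1 / 2))"

end

theory Submission
  imports Defs
begin

text \<open>
  Write the transverse metric in the coordinates \<open>(\<theta>, \<phi>, y, \<beta>)\<close>, \<open>\<beta> = - 6 \<alpha> - \<psi>\<close>, as
  \<open>e\<^sub>1\<^sup>2 + e\<^sub>2\<^sup>2 + e\<^sub>3\<^sup>2 + e\<^sub>4\<^sup>2\<close> with \<open>e\<^sub>3\<close> proportional to \<open>dy\<close> and \<open>d\<eta> = 2 (e\<^sub>1\<^sub>2 + e\<^sub>3\<^sub>4)\<close>.
  The connection form on the induced frame \<open>e\<^sub>1\<^sub>2 - e\<^sub>3\<^sub>4\<close>, \<open>e\<^sub>1\<^sub>3 + e\<^sub>2\<^sub>4\<close>, \<open>e\<^sub>1\<^sub>4 - e\<^sub>2\<^sub>3\<close> of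
  the anti-self-dual forms has no \<open>dy\<close>-component, so the matrix of a parallel gauge transformation
  is independent of \<open>y\<close>.  Its \<open>d\<theta>\<close>- and \<open>d\<beta>\<close>-components are multiples of two different
  generators of \<open>so(3)\<close> by non-constant functions of \<open>y\<close>; comparing the parallel transport equation
  at two values of \<open>y\<close> shows that the matrix commutes with both generators, hence is the identity.
  This holds on the whole domain of the coordinates, which is dense, and it extends by continuity.
\<close>

section \<open>Smooth maps\<close>

text \<open>Irreducibility quantifies over all foliated parametrisations, and for these neither the
  Killing property of \<xi> nor a nonzero square of \<omega> is given. Without the latter there
  would be no oriented frames and anti-self-duality would be a vacuous condition. Both are therefore
  put as closed conditions, a vanishing derivative and a square equal to 4, which pass from the
  dense chart to its closure by continuity. In that chart the matrix R of a parallel gauge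
  transformation satisfies dR = [R, M] with M the connection matrix. As R and dR do not depend on y,
  subtracting two values of y gives [R, M(0) - M(y)] = 0, without curvature and without integration
  in the other directions. The coefficients of the two generators are - sqrt (Q / P) / 6 for
  d\<theta> and ((a - 1) / (1 - y)^2 + 1 - y) / 3 for d\<beta>; the bounds 0 < a < 1, which come
  from 0 < q < p, make both differ between y = 0 and a suitable y < 0. The converse needs that the
  transverse connection preserves anti-self-dual forms, because a gauge transformation is
  constrained on these only.\<close>

lemma Ck_on_cong:
  assumes "open S" "\<And>x. x \<in> S \<Longrightarrow> f x = g x" "Ck_on k S f"
  shows "Ck_on k S g"
  using assms
proof (induction k arbitrary: f g)
  case 0
  then show ?case by (simp cong: continuous_on_cong)
next
  case (Suc k)
  have d: "f differentiable (at x)" if "x \<in> S" for x using Suc.prems that by simp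
  have e: "frechet_derivative f (at x) = frechet_derivative g (at x)" if "x \<in> S" for x
    by (rule frechet_derivative_transform_within_open[OF d Suc.prems(1)]) (use that Suc.prems in auto)
  have "g differentiable (at x)" if "x \<in> S" for x
    using d[OF that] that Suc.prems has_derivative_transform_within_open unfolding differentiable_def by blast
  moreover have "Ck_on k S (\<lambda>x. frechet_derivative g (at x) v)" for v
    by (rule Suc.IH[of "\<lambda>x. frechet_derivative f (at x) v"]) (use Suc.prems e in auto)
  ultimately show ?case by simp
qed

lemma Ck_on_subset: "Ck_on k S f \<Longrightarrow> T \<subseteq> S \<Longrightarrow> Ck_on k T f"
  by (induction k arbitrary: f) (auto intro: continuous_on_subset)

lemma Ck_on_SucI:
  assumes "open S" "\<And>x. x \<in> S \<Longrightarrow> (f has_derivative f' x) (at x)" "\<And>v. Ck_on k S (\<lambda>x. f' x v)"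
  shows "Ck_on (Suc k) S f"
proof -
  have "frechet_derivative f (at x) = f' x" if "x \<in> S" for x
    using frechet_derivative_at[OF assms(2)[OF that]] by simp
  then have "Ck_on k S (\<lambda>x. frechet_derivative f (at x) v)" for v
    using Ck_on_cong[OF assms(1) _ assms(3)[of v]] by simp
  moreover have "f differentiable (at x)" if "x \<in> S" for x
    using assms(2)[OF that] differentiable_def by blast
  ultimately show ?thesis by simp
qed

lemma Ck_on_SucD: "Ck_on (Suc k) S f \<Longrightarrow> Ck_on k S f"
proof (induction k arbitrary: f)
  case 0
  then show ?case
    by (auto intro!: differentiable_imp_continuous_on differentiable_at_imp_differentiable_on)
next
  case (Suc k)
  then show ?case by auto
qed

lemma Ck_on_const: "open S \<Longrightarrow> Ck_on k S (\<lambda>x. c)"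
  by (induction k arbitrary: c) (auto intro!: Ck_on_SucI[where f'="\<lambda>x v. 0"] simp del: Ck_on.simps(2))

lemma Ck_on_bounded_linear:
  assumes "bounded_linear f" "open S"
  shows "Ck_on k S f"
proof (cases k)
  case 0
  then show ?thesis using assms by (auto intro: linear_continuous_on)
next
  case (Suc j)
  have "Ck_on (Suc j) S f"
    by (rule Ck_on_SucI[where f'="\<lambda>x. f"])
      (use assms bounded_linear_imp_has_derivative in \<open>auto intro: Ck_on_const\<close>)
  then show ?thesis using Suc by simp
qed

lemma Ck_on_deriv:
  assumes "Ck_on (Suc k) S f" "x \<in> S"
  shows "(f has_derivative frechet_derivative f (at x)) (at x)"
  using assms frechet_derivative_works by auto

lemma Ck_on_linear_comp:
  assumes "bounded_linear L" "open S" "Ck_on k S f"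
  shows "Ck_on k S (\<lambda>x. L (f x))"
  using assms(3)
proof (induction k arbitrary: f)
  case 0
  then show ?case
    using bounded_linear.continuous_on[OF assms(1)] by auto
next
  case (Suc k)
  show ?case
  proof (rule Ck_on_SucI[where f'="\<lambda>x v. L (frechet_derivative f (at x) v)", OF assms(2)])
    show "((\<lambda>x. L (f x)) has_derivative (\<lambda>v. L (frechet_derivative f (at x) v))) (at x)" if "x \<in> S" for x
      using bounded_linear.has_derivative[OF assms(1) Ck_on_deriv[OF Suc.prems that]] .
    show "Ck_on k S (\<lambda>x. L (frechet_derivative f (at x) v))" for v
      by (rule Suc.IH) (use Suc.prems in simp)
  qed
qed

lemma Ck_on_add:
  assumes "open S" "Ck_on k S f" "Ck_on k S g"
  shows "Ck_on k S (\<lambda>x. f x + g x)"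
  using assms(2,3)
proof (induction k arbitrary: f g)
  case 0
  then show ?case by (auto intro: continuous_on_add)
next
  case (Suc k)
  show ?case
  proof (rule Ck_on_SucI[where f'="\<lambda>x v. frechet_derivative f (at x) v + frechet_derivative g (at x) v", OF assms(1)])
    show "((\<lambda>x. f x + g x) has_derivative (\<lambda>v. frechet_derivative f (at x) v + frechet_derivative g (at x) v)) (at x)" if "x \<in> S" for x
      by (intro has_derivative_add Ck_on_deriv[OF _ that]) (use Suc.prems in auto)
    show "Ck_on k S (\<lambda>x. frechet_derivative f (at x) v + frechet_derivative g (at x) v)" for v
      by (rule Suc.IH) (use Suc.prems in simp_all)
  qed
qed

lemma Ck_on_bilinear:
  assumes "bounded_bilinear B" "open S" "Ck_on k S f" "Ck_on k S g"
  shows "Ck_on k S (\<lambda>x. B (f x) (g x))"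
  using assms(3,4)
proof (induction k arbitrary: f g)
  case 0
  then show ?case using bounded_bilinear.continuous_on[OF assms(1)] by auto
next
  case (Suc k)
  show ?case
  proof (rule Ck_on_SucI[where f'="\<lambda>x v. B (f x) (frechet_derivative g (at x) v) + B (frechet_derivative f (at x) v) (g x)", OF assms(2)])
    show "((\<lambda>x. B (f x) (g x)) has_derivative (\<lambda>v. B (f x) (frechet_derivative g (at x) v) + B (frechet_derivative f (at x) v) (g x))) (at x)" if "x \<in> S" for x
      using bounded_bilinear.FDERIV[OF assms(1) Ck_on_deriv[OF Suc.prems(1) that] Ck_on_deriv[OF Suc.prems(2) that]] .
    show "Ck_on k S (\<lambda>x. B (f x) (frechet_derivative g (at x) v) + B (frechet_derivative f (at x) v) (g x))" for v
      by (intro Ck_on_add[OF assms(2)] Suc.IH) (use Suc.prems Ck_on_SucD in auto)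
  qed
qed

lemma Ck_on_sum:
  assumes "open S" "\<And>i. i \<in> I \<Longrightarrow> Ck_on k S (f i)"
  shows "Ck_on k S (\<lambda>x. \<Sum>i\<in>I. f i x)"
  using assms(2)
  by (induction I rule: infinite_finite_induct) (auto intro: Ck_on_const Ck_on_add assms(1))

text \<open>\<open>Ck_on\<close> controls derivatives in fixed directions only, whereas the chain
  rule applies the derivative of \<phi> in a direction that moves with x. Expanding that direction
  over \<open>Basis\<close> leaves a finite sum of products with fixed directions, to which the
  induction applies; hence the Euclidean space in the middle.\<close>

lemma Ck_on_compose:
  fixes f :: "'a::real_normed_vector \<Rightarrow> 'b::euclidean_space" and \<phi> :: "'b \<Rightarrow> 'c::real_normed_vector"
  assumes "open S" "open T" "f ` S \<subseteq> T" "Ck_on k S f" "Ck_on k T \<phi>"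
  shows "Ck_on k S (\<lambda>x. \<phi> (f x))"
  using assms(4,5)
proof (induction k arbitrary: \<phi>)
  case 0
  then show ?case using assms(3) continuous_on_compose2 by auto
next
  case (Suc k)
  let ?D = "\<lambda>x v. \<Sum>e\<in>Basis. (frechet_derivative f (at x) v \<bullet> e) *\<^sub>R frechet_derivative \<phi> (at (f x)) e"
  show ?case
  proof (rule Ck_on_SucI[where f'="?D", OF assms(1)])
    show "((\<lambda>x. \<phi> (f x)) has_derivative ?D x) (at x)" if "x \<in> S" for x
    proof -
      have "f x \<in> T" using that assms(3) by auto
      then have 1: "(\<phi> has_derivative frechet_derivative \<phi> (at (f x))) (at (f x))"
        using Ck_on_deriv Suc.prems(2) by blast
      then have l: "linear (frechet_derivative \<phi> (at (f x)))"
        using has_derivative_linear by blast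
      have "?D x v = frechet_derivative \<phi> (at (f x)) (frechet_derivative f (at x) v)" for v
      proof -
        have "frechet_derivative \<phi> (at (f x)) (frechet_derivative f (at x) v) =
          frechet_derivative \<phi> (at (f x)) (\<Sum>e\<in>Basis. (frechet_derivative f (at x) v \<bullet> e) *\<^sub>R e)"
          by (simp add: euclidean_representation)
        then show ?thesis using l by (simp add: linear_sum linear_cmul)
      qed
      then show ?thesis
        using has_derivative_compose[OF Ck_on_deriv[OF Suc.prems(1) that] 1] by (simp add: o_def)
    qed
    show "Ck_on k S (\<lambda>x. ?D x v)" for v
    proof (intro Ck_on_sum[OF assms(1)] Ck_on_bilinear[OF bounded_bilinear_scaleR assms(1)])
      fix e :: 'b
      show "Ck_on k S (\<lambda>x. frechet_derivative f (at x) v \<bullet> e)"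
        by (rule Ck_on_linear_comp[OF bounded_linear_inner_left assms(1)]) (use Suc.prems in simp)
      show "Ck_on k S (\<lambda>x. frechet_derivative \<phi> (at (f x)) e)"
        by (rule Suc.IH) (use Suc.prems Ck_on_SucD in auto)
    qed
  qed
qed

named_theorems smooth_intros

lemma smooth_on_cong: "smooth_on S f \<Longrightarrow> open S \<Longrightarrow> (\<And>x. x \<in> S \<Longrightarrow> f x = g x) \<Longrightarrow> smooth_on S g"
  unfolding smooth_on_def using Ck_on_cong by blast

lemma smooth_on_subset: "smooth_on S f \<Longrightarrow> T \<subseteq> S \<Longrightarrow> smooth_on T f"
  unfolding smooth_on_def using Ck_on_subset by blast

lemma smooth_on_const [smooth_intros]: "open S \<Longrightarrow> smooth_on S (\<lambda>x. c)"
  unfolding smooth_on_def by (simp add: Ck_on_const)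

lemma smooth_on_bounded_linear: "bounded_linear f \<Longrightarrow> open S \<Longrightarrow> smooth_on S f"
  unfolding smooth_on_def by (simp add: Ck_on_bounded_linear)

lemma smooth_on_linear_comp: "bounded_linear L \<Longrightarrow> open S \<Longrightarrow> smooth_on S f \<Longrightarrow> smooth_on S (\<lambda>x. L (f x))"
  unfolding smooth_on_def by (simp add: Ck_on_linear_comp)

lemma smooth_on_add [smooth_intros]:
  "open S \<Longrightarrow> smooth_on S f \<Longrightarrow> smooth_on S g \<Longrightarrow> smooth_on S (\<lambda>x. f x + g x)"
  unfolding smooth_on_def by (simp add: Ck_on_add)

lemma smooth_on_minus [smooth_intros]: "open S \<Longrightarrow> smooth_on S f \<Longrightarrow> smooth_on S (\<lambda>x. - f x)"
  by (rule smooth_on_linear_comp[OF bounded_linear_minus[OF bounded_linear_ident]])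

lemma smooth_on_diff [smooth_intros]:
  "open S \<Longrightarrow> smooth_on S f \<Longrightarrow> smooth_on S g \<Longrightarrow> smooth_on S (\<lambda>x. f x - g x)"
  using smooth_on_add[of S f "\<lambda>x. - g x"] smooth_on_minus[of S g] by simp

lemma smooth_on_scaleR [smooth_intros]:
  "open S \<Longrightarrow> smooth_on S f \<Longrightarrow> smooth_on S g \<Longrightarrow> smooth_on S (\<lambda>x. f x *\<^sub>R g x)"
  unfolding smooth_on_def by (simp add: Ck_on_bilinear[OF bounded_bilinear_scaleR])

lemma smooth_on_mult [smooth_intros]:
  fixes f g :: "'a::real_normed_vector \<Rightarrow> real"
  shows "open S \<Longrightarrow> smooth_on S f \<Longrightarrow> smooth_on S g \<Longrightarrow> smooth_on S (\<lambda>x. f x * g x)"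
  using smooth_on_scaleR[of S f g] by simp

lemma smooth_on_power [smooth_intros]:
  fixes f :: "'a::real_normed_vector \<Rightarrow> real"
  shows "open S \<Longrightarrow> smooth_on S f \<Longrightarrow> smooth_on S (\<lambda>x. f x ^ n)"
  by (induction n) (simp_all add: smooth_on_const smooth_on_mult)

lemma smooth_on_sum [smooth_intros]:
  "open S \<Longrightarrow> (\<And>i. i \<in> I \<Longrightarrow> smooth_on S (f i)) \<Longrightarrow> smooth_on S (\<lambda>x. \<Sum>i\<in>I. f i x)"
  unfolding smooth_on_def by (simp add: Ck_on_sum)

lemma smooth_on_compose:
  fixes f :: "'a::real_normed_vector \<Rightarrow> 'b::euclidean_space" and \<phi> :: "'b \<Rightarrow> 'c::real_normed_vector"
  shows "open S \<Longrightarrow> open T \<Longrightarrow> f ` S \<subseteq> T \<Longrightarrow> smooth_on S f \<Longrightarrow> smooth_on T \<phi> \<Longrightarrow> smooth_on S (\<lambda>x. \<phi> (f x))"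
  unfolding smooth_on_def by (intro allI) (rule Ck_on_compose, auto)

lemma smooth_on_deriv: "smooth_on S f \<Longrightarrow> x \<in> S \<Longrightarrow> (f has_derivative frechet_derivative f (at x)) (at x)"
  unfolding smooth_on_def using Ck_on_deriv by blast

lemma smooth_on_differentiable: "smooth_on S f \<Longrightarrow> x \<in> S \<Longrightarrow> f differentiable (at x)"
  using smooth_on_deriv differentiable_def by blast

lemma smooth_on_frechet_derivative: "smooth_on S f \<Longrightarrow> smooth_on S (\<lambda>x. frechet_derivative f (at x) v)"
  unfolding smooth_on_def by (metis Ck_on.simps(2))

lemma smooth_on_continuous: "smooth_on S f \<Longrightarrow> continuous_on S f"
  unfolding smooth_on_def by (metis Ck_on.simps(1))

section \<open>Smoothness of elementary real functions\<close>

lemma smooth_onI_real: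
  fixes \<phi> \<phi>' :: "real \<Rightarrow> real"
  assumes "open S" "\<And>x. x \<in> S \<Longrightarrow> (\<phi> has_real_derivative \<phi>' x) (at x)" "smooth_on S \<phi>'"
  shows "smooth_on S \<phi>"
  unfolding smooth_on_def
proof
  fix k
  have "Ck_on (Suc k) S \<phi>"
  proof (rule Ck_on_SucI[where f'="\<lambda>x v. \<phi>' x * v", OF assms(1)])
    show "(\<phi> has_derivative (*) (\<phi>' x)) (at x)" if "x \<in> S" for x
      using assms(2)[OF that] by (simp add: has_field_derivative_def)
    show "Ck_on k S (\<lambda>x. \<phi>' x * v)" for v
      using Ck_on_linear_comp[OF bounded_linear_mult_left assms(1), of k \<phi>' v] assms(3)
      unfolding smooth_on_def by blast
  qed
  then show "Ck_on k S \<phi>" by (rule Ck_on_SucD)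
qed

text \<open>For functions whose derivatives of all orders have a closed formula: the family is
  closed under differentiation, so one induction on the order, for all members at once,
  suffices.\<close>

lemma smooth_on_real_family:
  fixes D :: "nat \<Rightarrow> real \<Rightarrow> real"
  assumes "open S" "\<And>n x. x \<in> S \<Longrightarrow> (D n has_real_derivative D (Suc n) x) (at x)"
  shows "smooth_on S (D n)"
  unfolding smooth_on_def
proof
  fix k show "Ck_on k S (D n)"
  proof (induction k arbitrary: n)
    case 0
    show ?case using assms(2) by (auto intro: DERIV_continuous_on has_field_derivative_at_within)
  next
    case (Suc k)
    show ?case
    proof (rule Ck_on_SucI[where f'="\<lambda>x v. D (Suc n) x * v", OF assms(1)])
      show "(D n has_derivative (*) (D (Suc n) x)) (at x)" if "x \<in> S" for x
        using assms(2)[OF that] by (simp add: has_field_derivative_def)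
      show "Ck_on k S (\<lambda>x. D (Suc n) x * v)" for v
        using Ck_on_linear_comp[OF bounded_linear_mult_left assms(1) Suc] by blast
    qed
  qed
qed

lemma smooth_on_powr_real: "smooth_on {0<..} (\<lambda>x::real. x powr r)"
proof -
  define D where "D n x = (\<Prod>i<n. r - real i) * x powr (r - real n)" for n and x :: real
  have "smooth_on {0<..} (D 0)"
  proof (rule smooth_on_real_family)
    fix n and x :: real assume "x \<in> {0<..}"
    then show "(D n has_real_derivative D (Suc n) x) (at x)"
      unfolding D_def by (auto intro!: derivative_eq_intros simp: algebra_simps)
  qed auto
  then show ?thesis by (rule smooth_on_cong) (auto simp: D_def)
qed

lemma smooth_on_sin_real: "smooth_on UNIV (\<lambda>x::real. sin x)"
proof -
  \<comment> \<open>Differentiating sin amounts to a shift by pi / 2.\<close>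
  define D where "D n x = sin (x + real n * (pi / 2))" for n and x :: real
  have "smooth_on UNIV (D 0)"
  proof (rule smooth_on_real_family)
    fix n and x :: real
    show "(D n has_real_derivative D (Suc n) x) (at x)"
    proof -
      have "cos (x + real n * (pi / 2)) = D (Suc n) x"
        using sin_add[of "x + real n * (pi / 2)" "pi / 2"] by (simp add: D_def algebra_simps add_divide_distrib)
      then show ?thesis unfolding D_def by (auto intro!: derivative_eq_intros)
    qed
  qed auto
  then show ?thesis by (simp add: D_def[abs_def])
qed

lemma smooth_on_cos_real: "smooth_on UNIV (\<lambda>x::real. cos x)"
proof -
  have "smooth_on UNIV (\<lambda>x::real. x + pi / 2)"
    by (intro smooth_on_add smooth_on_const smooth_on_bounded_linear bounded_linear_ident open_UNIV)
  then have "smooth_on UNIV (\<lambda>x::real. sin (x + pi / 2))"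
    using smooth_on_compose[OF _ _ _ _ smooth_on_sin_real] by (metis open_UNIV subset_UNIV)
  then show ?thesis by (simp add: sin_add)
qed

lemma smooth_on_sin [smooth_intros]: "open S \<Longrightarrow> smooth_on S f \<Longrightarrow> smooth_on S (\<lambda>x. sin (f x :: real))"
  by (rule smooth_on_compose[OF _ _ _ _ smooth_on_sin_real]) auto

lemma smooth_on_cos [smooth_intros]: "open S \<Longrightarrow> smooth_on S f \<Longrightarrow> smooth_on S (\<lambda>x. cos (f x :: real))"
  by (rule smooth_on_compose[OF _ _ _ _ smooth_on_cos_real]) auto

lemma smooth_on_powr:
  "open S \<Longrightarrow> smooth_on S f \<Longrightarrow> (\<And>x. x \<in> S \<Longrightarrow> f x > 0) \<Longrightarrow> smooth_on S (\<lambda>x. (f x :: real) powr r)"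
  by (rule smooth_on_compose[OF _ _ _ _ smooth_on_powr_real]) auto

lemma smooth_on_sqrt [smooth_intros]:
  assumes "open S" "smooth_on S f" "\<And>x. x \<in> S \<Longrightarrow> f x > (0::real)"
  shows "smooth_on S (\<lambda>x. sqrt (f x))"
  by (rule smooth_on_cong[OF smooth_on_powr[OF assms, where r="1/2"] assms(1)]) 
    (auto simp: powr_half_sqrt assms(3) less_imp_le)

lemma smooth_on_inverse:
  assumes "open S" "smooth_on S f" "\<And>x. x \<in> S \<Longrightarrow> f x \<noteq> (0::real)"
  shows "smooth_on S (\<lambda>x. inverse (f x))"
proof -
  \<comment> \<open>\<open>powr\<close> is smooth for a positive base only and f may be negative;
    the square is positive, and 1 / f is f times the inverse of the square.\<close>
  have 1: "smooth_on S (\<lambda>x. (f x * f x) powr (-1))"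
    by (intro smooth_on_powr smooth_intros assms) (metis assms(3) not_real_square_gt_zero)
  have "smooth_on S (\<lambda>x. f x * (f x * f x) powr (-1))"
    by (intro smooth_intros assms 1)
  then show ?thesis
    by (rule smooth_on_cong[OF _ assms(1)]) (use assms(3) in \<open>auto simp: powr_minus field_simps\<close>)
qed

lemma smooth_on_divide [smooth_intros]:
  fixes f g :: "'a::real_normed_vector \<Rightarrow> real"
  shows "open S \<Longrightarrow> smooth_on S f \<Longrightarrow> smooth_on S g \<Longrightarrow> (\<And>x. x \<in> S \<Longrightarrow> g x \<noteq> 0) \<Longrightarrow> smooth_on S (\<lambda>x. f x / g x)"
  unfolding divide_inverse by (intro smooth_on_mult smooth_on_inverse)

lemma smooth_on_arctan [smooth_intros]:
  assumes "open S" "smooth_on S f"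
  shows "smooth_on S (\<lambda>x. arctan (f x))"
proof -
  have "smooth_on UNIV arctan"
  proof (rule smooth_onI_real)
    show "smooth_on UNIV (\<lambda>x::real. inverse (1 + x^2))"
      by (intro smooth_on_inverse smooth_intros smooth_on_bounded_linear bounded_linear_ident)
        (auto simp: add_nonneg_eq_0_iff)
  qed (auto intro: DERIV_arctan)
  then show ?thesis by (intro smooth_on_compose[OF assms(1) open_UNIV _ assms(2)]) auto
qed

lemma smooth_on_arccos [smooth_intros]:
  assumes "open S" "smooth_on S f" "\<And>x. x \<in> S \<Longrightarrow> -1 < f x \<and> f x < 1"
  shows "smooth_on S (\<lambda>x. arccos (f x))"
proof -
  have "smooth_on {-1<..<1} arccos"
  proof (rule smooth_onI_real)
    show "smooth_on {-1<..<1} (\<lambda>x::real. inverse (- sqrt (1 - x^2)))"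
      by (intro smooth_on_inverse smooth_intros smooth_on_bounded_linear bounded_linear_ident)
        (auto simp: abs_square_less_1 abs_square_eq_1)
  qed (use DERIV_arccos in auto)
  then show ?thesis by (intro smooth_on_compose[OF assms(1) _ _ assms(2)]) (use assms(3) in auto)
qed

lemma smooth_on_Pair [smooth_intros]:
  assumes "open S" "smooth_on S f" "smooth_on S g"
  shows "smooth_on S (\<lambda>x. (f x, g x))"
proof -
  have "smooth_on S (\<lambda>x. (f x, 0) + (0, g x))"
    by (intro smooth_on_add assms
        smooth_on_linear_comp[OF bounded_linear_Pair[OF bounded_linear_ident bounded_linear_zero]]
        smooth_on_linear_comp[OF bounded_linear_Pair[OF bounded_linear_zero bounded_linear_ident]])
  then show ?thesis by simp
qed

lemma smooth_on_vec:
  assumes "open S" "\<And>i. smooth_on S (\<lambda>x. f x $ i)"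
  shows "smooth_on S (f :: _ \<Rightarrow> real^'n)"
proof -
  have "smooth_on S (\<lambda>x. \<Sum>i\<in>UNIV. (f x $ i) *\<^sub>R axis i (1::real))"
    by (intro smooth_intros assms)
  then show ?thesis
    by (rule smooth_on_cong[OF _ assms(1)]) (simp add: basis_expansion flip: scalar_mult_eq_scaleR)
qed

lemma smooth_on_fst_nth [smooth_intros]: "open S \<Longrightarrow> smooth_on S (\<lambda>z::(real^'n) \<times> real. fst z $ i)"
  by (rule smooth_on_bounded_linear)
    (auto intro: bounded_linear_compose[OF bounded_linear_vec_nth bounded_linear_fst])

lemma smooth_on_snd [smooth_intros]: "open S \<Longrightarrow> smooth_on S (\<lambda>z. snd z)"
  by (rule smooth_on_bounded_linear) (auto intro: bounded_linear_snd)

section \<open>Symmetry of second derivatives\<close>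

lemma symmetric_second_derivative_aux:
  fixes f :: "'a::real_normed_vector \<Rightarrow> real"
  assumes "open S" "smooth_on S f" "\<And>s t. 0 \<le> s \<Longrightarrow> s \<le> h \<Longrightarrow> 0 \<le> t \<Longrightarrow> t \<le> h \<Longrightarrow> x + s *\<^sub>R a + t *\<^sub>R b \<in> S" "0 < h"
  shows "\<exists>s t. 0 \<le> s \<and> s \<le> h \<and> 0 \<le> t \<and> t \<le> h \<and>
    f (x + h *\<^sub>R a + h *\<^sub>R b) - f (x + h *\<^sub>R a) - f (x + h *\<^sub>R b) + f x
     = h * h * frechet_derivative (\<lambda>z. frechet_derivative f (at z) a) (at (x + s *\<^sub>R a + t *\<^sub>R b)) b"
proof -
  let ?F = "\<lambda>z. frechet_derivative f (at z)"
  \<comment> \<open>The second difference over the parallelogram is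
    \<open>\<phi> h - \<phi> 0\<close>. The mean value theorem is applied to \<phi>, and then in
    direction b to the difference of derivatives that results.\<close>
  define \<phi> where "\<phi> s = f (x + s *\<^sub>R a + h *\<^sub>R b) - f (x + s *\<^sub>R a)" for s
  have "(\<phi> has_real_derivative (?F (x + s *\<^sub>R a + h *\<^sub>R b) a - ?F (x + s *\<^sub>R a) a)) (at s)"
    if "0 \<le> s" "s \<le> h" for s
  proof -
    have S: "x + s *\<^sub>R a + h *\<^sub>R b \<in> S" "x + s *\<^sub>R a \<in> S"
      using assms(3)[of s h] assms(3)[of s 0] that assms(4) by auto
    have l: "linear (?F z)" if "z \<in> S" for z
      using smooth_on_deriv[OF assms(2) that] has_derivative_linear by blast
    have "((\<lambda>s. f (x + s *\<^sub>R a + h *\<^sub>R b)) has_derivative (\<lambda>r. ?F (x + s *\<^sub>R a + h *\<^sub>R b) (r *\<^sub>R a))) (at s)"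
      by (rule has_derivative_compose[where f="\<lambda>s. x + s *\<^sub>R a + h *\<^sub>R b" and g=f, OF _ smooth_on_deriv[OF assms(2) S(1)]])
        (auto intro!: derivative_eq_intros)
    moreover have "((\<lambda>s. f (x + s *\<^sub>R a)) has_derivative (\<lambda>r. ?F (x + s *\<^sub>R a) (r *\<^sub>R a))) (at s)"
      by (rule has_derivative_compose[where f="\<lambda>s. x + s *\<^sub>R a" and g=f, OF _ smooth_on_deriv[OF assms(2) S(2)]])
        (auto intro!: derivative_eq_intros)
    ultimately have "(\<phi> has_derivative (\<lambda>r. ?F (x + s *\<^sub>R a + h *\<^sub>R b) (r *\<^sub>R a) - ?F (x + s *\<^sub>R a) (r *\<^sub>R a))) (at s)"
      unfolding \<phi>_def by (rule has_derivative_diff)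
    then show ?thesis
      unfolding has_field_derivative_def
      by (rule has_derivative_eq_rhs) (simp add: fun_eq_iff linear_cmul[OF l[OF S(1)]] linear_cmul[OF l[OF S(2)]] right_diff_distrib mult.commute)
  qed
  from MVT2[OF assms(4), of \<phi> "\<lambda>s. ?F (x + s *\<^sub>R a + h *\<^sub>R b) a - ?F (x + s *\<^sub>R a) a", OF this]
  obtain s where s: "0 < s" "s < h"
    "\<phi> h - \<phi> 0 = (h - 0) * (?F (x + s *\<^sub>R a + h *\<^sub>R b) a - ?F (x + s *\<^sub>R a) a)" by blast
  let ?G = "\<lambda>z. frechet_derivative (\<lambda>z. ?F z a) (at z)"
  define \<psi> where "\<psi> t = ?F (x + s *\<^sub>R a + t *\<^sub>R b) a" for t
  have "(\<psi> has_real_derivative ?G (x + s *\<^sub>R a + t *\<^sub>R b) b) (at t)" if "0 \<le> t" "t \<le> h" for t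
  proof -
    have S: "x + s *\<^sub>R a + t *\<^sub>R b \<in> S" using assms(3)[of s t] that s by auto
    note d = smooth_on_deriv[OF smooth_on_frechet_derivative[OF assms(2)] S]
    have "(\<psi> has_derivative (\<lambda>r. ?G (x + s *\<^sub>R a + t *\<^sub>R b) (r *\<^sub>R b))) (at t)"
      unfolding \<psi>_def
      by (rule has_derivative_compose[where f="\<lambda>t. x + s *\<^sub>R a + t *\<^sub>R b" and g="\<lambda>z. ?F z a", OF _ d]) (auto intro!: derivative_eq_intros)
    then show ?thesis
      unfolding has_field_derivative_def
      by (rule has_derivative_eq_rhs) (auto simp: linear_cmul[OF has_derivative_linear[OF d]])
  qed
  from MVT2[OF assms(4), of \<psi> "\<lambda>t. ?G (x + s *\<^sub>R a + t *\<^sub>R b) b", OF this]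
  obtain t where t: "0 < t" "t < h"
    "\<psi> h - \<psi> 0 = (h - 0) * ?G (x + s *\<^sub>R a + t *\<^sub>R b) b" by blast
  show ?thesis
    by (rule exI[of _ s], rule exI[of _ t]) (use s t in \<open>simp add: \<phi>_def \<psi>_def\<close>)
qed

text \<open>The second difference over a small parallelogram is symmetric in a and b, and it is h^2
  times either mixed derivative at some point of the parallelogram. Both mixed derivatives are
  continuous at x, so they agree there.\<close>

lemma symmetric_second_derivative:
  fixes f :: "'a::real_normed_vector \<Rightarrow> real"
  assumes "open S" "smooth_on S f" "x \<in> S"
  shows "frechet_derivative (\<lambda>z. frechet_derivative f (at z) a) (at x) b =
         frechet_derivative (\<lambda>z. frechet_derivative f (at z) b) (at x) a"
proof -
  define G where "G a b z = frechet_derivative (\<lambda>z. frechet_derivative f (at z) a) (at z) b" for a b z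
  have "isCont (G a b) x" for a b
    using smooth_on_continuous[OF smooth_on_frechet_derivative[OF smooth_on_frechet_derivative[OF assms(2)]]]
      assms unfolding G_def by (metis continuous_on_eq_continuous_at)
  then have G: "\<exists>d>0. \<forall>z. dist z x < d \<longrightarrow> dist (G a b z) (G a b x) < e" if "e > 0" for a b e
    using that unfolding continuous_at_eps_delta by (auto simp: dist_norm)
  have "\<bar>G a b x - G b a x\<bar> \<le> e" if "e > 0" for e
  proof -
    obtain d1 where d1: "d1 > 0" "\<And>z. dist z x < d1 \<Longrightarrow> dist (G a b z) (G a b x) < e / 2"
      using G[of "e/2" a b] \<open>e > 0\<close> by auto
    obtain d2 where d2: "d2 > 0" "\<And>z. dist z x < d2 \<Longrightarrow> dist (G b a z) (G b a x) < e / 2"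
      using G[of "e/2" b a] \<open>e > 0\<close> by auto
    obtain d3 where d3: "d3 > 0" "\<And>z. dist z x < d3 \<Longrightarrow> z \<in> S"
      using assms(1,3) open_dist by blast
    define d where "d = min d1 (min d2 d3)"
    \<comment> \<open>Scaled so that the parallelogram with sides h a and h b stays within distance
      d of x; the summand 1 covers a = b = 0.\<close>
    define h where "h = d / (2 * (norm a + norm b + 1))"
    have dp: "d > 0" using d1 d2 d3 by (simp add: d_def)
    have hp: "h > 0" using dp unfolding h_def by (intro divide_pos_pos) (auto intro: add_nonneg_pos)
    have near: "dist (x + s *\<^sub>R a + t *\<^sub>R b) x < d" if "0 \<le> s" "s \<le> h" "0 \<le> t" "t \<le> h" for s t a' b'
    proof -
      have "dist (x + s *\<^sub>R a + t *\<^sub>R b) x \<le> s * norm a + t * norm b"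
        using that norm_triangle_ineq[of "s *\<^sub>R a" "t *\<^sub>R b"] by (simp add: dist_norm add.assoc)
      also have "\<dots> \<le> h * norm a + h * norm b"
        using that by (intro add_mono mult_right_mono) auto
      also have "\<dots> < h * (2 * (norm a + norm b + 1))"
        using hp by (simp add: algebra_simps) (smt (verit) mult_nonneg_nonneg norm_ge_zero)
      also have "\<dots> = d" unfolding h_def
        using norm_ge_zero[of a] norm_ge_zero[of b] by (simp add: add_nonneg_eq_0_iff)
      finally show ?thesis .
    qed
    then have near': "dist (x + s *\<^sub>R b + t *\<^sub>R a) x < d" if "0 \<le> s" "s \<le> h" "0 \<le> t" "t \<le> h" for s t
      using that by (metis add.assoc add.commute)
    obtain s t where 1: "0 \<le> s" "s \<le> h" "0 \<le> t" "t \<le> h"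
      "f (x + h *\<^sub>R a + h *\<^sub>R b) - f (x + h *\<^sub>R a) - f (x + h *\<^sub>R b) + f x = h * h * G a b (x + s *\<^sub>R a + t *\<^sub>R b)"
      using symmetric_second_derivative_aux[OF assms(1,2) _ hp, of x a b] near d3 unfolding G_def d_def
      by (metis min_less_iff_conj)
    obtain s' t' where 2: "0 \<le> s'" "s' \<le> h" "0 \<le> t'" "t' \<le> h"
      "f (x + h *\<^sub>R b + h *\<^sub>R a) - f (x + h *\<^sub>R b) - f (x + h *\<^sub>R a) + f x = h * h * G b a (x + s' *\<^sub>R b + t' *\<^sub>R a)"
      using symmetric_second_derivative_aux[OF assms(1,2) _ hp, of x b a] near' d3 unfolding G_def d_def
      by (metis min_less_iff_conj)
    have "f (x + h *\<^sub>R b + h *\<^sub>R a) = f (x + h *\<^sub>R a + h *\<^sub>R b)" by (simp add: add_ac)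
    with 1(5) 2(5) have "h * h * G a b (x + s *\<^sub>R a + t *\<^sub>R b) = h * h * G b a (x + s' *\<^sub>R b + t' *\<^sub>R a)" by linarith
    then have "G a b (x + s *\<^sub>R a + t *\<^sub>R b) = G b a (x + s' *\<^sub>R b + t' *\<^sub>R a)" using hp by simp
    moreover have "dist (G a b (x + s *\<^sub>R a + t *\<^sub>R b)) (G a b x) < e / 2"
      using d1(2) near[OF 1(1-4)] by (simp add: d_def)
    moreover have "dist (G b a (x + s' *\<^sub>R b + t' *\<^sub>R a)) (G b a x) < e / 2"
      using d2(2) near'[OF 2(1-4)] by (simp add: d_def)
    ultimately show ?thesis by (simp add: dist_real_def abs_if split: if_splits)
  qed
  then have "\<bar>G a b x - G b a x\<bar> \<le> 0" by (metis field_le_epsilon add_0)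
  then show ?thesis by (simp add: G_def)
qed

section \<open>Linear algebra of 2-forms in dimension four\<close>

definition inner_form :: "('a::real_vector \<Rightarrow> 'a \<Rightarrow> real) \<Rightarrow> bool" where
  "inner_form h \<longleftrightarrow> bilinear h \<and> (\<forall>a b. h a b = h b a) \<and> (\<forall>a. a \<noteq> 0 \<longrightarrow> 0 < h a a)"

definition orthonormal :: "('a \<Rightarrow> 'a \<Rightarrow> real) \<Rightarrow> ('i \<Rightarrow> 'a) \<Rightarrow> bool" where
  "orthonormal h e \<longleftrightarrow> (\<forall>i j. h (e i) (e j) = (if i = j then 1 else 0))"

text \<open>The value of the 4-form on e. On the diagonal it is the expression required to be
  positive in \<open>oriented_onb\<close>; the polarised version allows anti-self-duality to be
  tested against arbitrary \<gamma>.\<close>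

definition wedge :: "form2 \<Rightarrow> form2 \<Rightarrow> (4 \<Rightarrow> real^4) \<Rightarrow> real" where
  "wedge \<beta> \<gamma> e = \<beta> (e 1) (e 2) * \<gamma> (e 3) (e 4) - \<beta> (e 1) (e 3) * \<gamma> (e 2) (e 4)
     + \<beta> (e 1) (e 4) * \<gamma> (e 2) (e 3) + \<beta> (e 3) (e 4) * \<gamma> (e 1) (e 2)
     - \<beta> (e 2) (e 4) * \<gamma> (e 1) (e 3) + \<beta> (e 2) (e 3) * \<gamma> (e 1) (e 4)"

lemma bilinearD:
  assumes "bilinear h"
  shows "h (a + b) c = h a c + h b c" "h c (a + b) = h c a + h c b"
    "h (r *\<^sub>R a) c = r * h a c" "h c (r *\<^sub>R a) = r * h c a"
    "h 0 c = 0" "h c 0 = 0" "h (- a) c = - h a c" "h c (- a) = - h c a"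
    "h (a - b) c = h a c - h b c" "h c (a - b) = h c a - h c b"
  using assms by (simp_all add: bilinear_ladd bilinear_radd bilinear_lmul bilinear_rmul bilinear_lzero
      bilinear_rzero bilinear_lneg bilinear_rneg bilinear_lsub bilinear_rsub)

lemma bilinear_sums:
  assumes "bilinear h"
  shows "h (\<Sum>i\<in>I. f i) c = (\<Sum>i\<in>I. h (f i) c)" "h c (\<Sum>i\<in>I. f i) = (\<Sum>i\<in>I. h c (f i))"
  using assms linear_sum unfolding bilinear_def by blast+

lemma two_formD:
  assumes "two_form \<beta>"
  shows "bilinear \<beta>" "\<beta> a a = 0" "\<beta> a b = - \<beta> b a"
proof -
  show 1: "bilinear \<beta>" using assms by (simp add: two_form_def)
  have 2: "\<beta> c c = 0" for c using assms by (simp add: two_form_def)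
  show "\<beta> a a = 0" by (rule 2)
  have "\<beta> a b + \<beta> b a = 0"
  proof -
    have "\<beta> (a + b) (a + b) = \<beta> a a + \<beta> b a + (\<beta> a b + \<beta> b b)" by (simp add: bilinearD[OF 1])
    then show ?thesis unfolding 2 by simp
  qed
  then show "\<beta> a b = - \<beta> b a" by linarith
qed

lemma two_form_swap:
  fixes e :: "4 \<Rightarrow> real^4"
  assumes "two_form \<beta>"
  shows "\<beta> (e 2) (e 1) = - \<beta> (e 1) (e 2)" "\<beta> (e 3) (e 1) = - \<beta> (e 1) (e 3)" "\<beta> (e 4) (e 1) = - \<beta> (e 1) (e 4)"
    "\<beta> (e 3) (e 2) = - \<beta> (e 2) (e 3)" "\<beta> (e 4) (e 2) = - \<beta> (e 2) (e 4)" "\<beta> (e 4) (e 3) = - \<beta> (e 3) (e 4)"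
  by (rule two_formD(3)[OF assms])+

text \<open>Four orthonormal vectors span the space: pairing with \<open>e i\<close> recovers the
  i-th coefficient, so the map from coefficients to vectors is injective, hence onto for reasons of
  dimension.\<close>

lemma orthonormal_expand:
  fixes e :: "4 \<Rightarrow> real^4"
  assumes "inner_form h" "orthonormal h e"
  shows "a = (\<Sum>i\<in>UNIV. h (e i) a *\<^sub>R e i)"
proof -
  have bil: "bilinear h" using assms(1) by (simp add: inner_form_def)
  define T where "T c = (\<Sum>i\<in>UNIV. (c $ i) *\<^sub>R e i)" for c :: "real^4"
  have lin: "linear T"
    by (rule linearI) (simp_all add: T_def scaleR_left_distrib sum.distrib scaleR_sum_right)
  have on: "h (e i) (e j) = (if i = j then 1 else 0)" for i j
    using assms(2) by (simp add: orthonormal_def)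
  have T: "h (e i) (T c) = c $ i" for i c
    by (simp add: T_def on bilinear_sums[OF bil] bilinearD[OF bil] if_distrib cong: if_cong)
  have "inj T"
    by (rule injI) (metis T vec_eq_iff)
  then have "surj T" using lin linear_injective_imp_surjective by blast
  then obtain c where c: "a = T c" by auto
  show ?thesis unfolding c T by (simp add: T_def)
qed

lemma det_4:
  fixes A :: "real^4^4"
  shows "det A =
    A$1$1 * (A$2$2 * (A$3$3 * A$4$4 - A$3$4 * A$4$3) - A$2$3 * (A$3$2 * A$4$4 - A$3$4 * A$4$2) + A$2$4 * (A$3$2 * A$4$3 - A$3$3 * A$4$2))
  - A$1$2 * (A$2$1 * (A$3$3 * A$4$4 - A$3$4 * A$4$3) - A$2$3 * (A$3$1 * A$4$4 - A$3$4 * A$4$1) + A$2$4 * (A$3$1 * A$4$3 - A$3$3 * A$4$1))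
  + A$1$3 * (A$2$1 * (A$3$2 * A$4$4 - A$3$4 * A$4$2) - A$2$2 * (A$3$1 * A$4$4 - A$3$4 * A$4$1) + A$2$4 * (A$3$1 * A$4$2 - A$3$2 * A$4$1))
  - A$1$4 * (A$2$1 * (A$3$2 * A$4$3 - A$3$3 * A$4$2) - A$2$2 * (A$3$1 * A$4$3 - A$3$3 * A$4$1) + A$2$3 * (A$3$1 * A$4$2 - A$3$2 * A$4$1))"
proof -
  have f1: "finite {2::4, 3, 4}" "1 \<notin> {2::4, 3, 4}" by auto
  have f2: "finite {3::4, 4}" "2 \<notin> {3::4, 4}" by auto
  have f3: "finite {4::4}" "3 \<notin> {4::4}" by auto
  show ?thesis
    unfolding det_def UNIV_4
    unfolding sum_over_permutations_insert[OF f1]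
    unfolding sum_over_permutations_insert[OF f2]
    unfolding sum_over_permutations_insert[OF f3]
    unfolding permutes_sing
    by (simp add: sign_swap_id permutation_swap_id sign_compose permutation_compose sign_id swap_id_eq
        algebra_simps)
qed

text \<open>The space of 4-forms is one-dimensional. Once skew symmetry has reduced everything to
  the six values on pairs i < j, the claim is a polynomial identity.\<close>

lemma wedge_change:
  assumes "two_form \<beta>" "two_form \<gamma>" "\<And>j. e' j = (\<Sum>i\<in>UNIV. P $ j $ i *\<^sub>R e i)"
  shows "wedge \<beta> \<gamma> e' = det P * wedge \<beta> \<gamma> e"
proof -
  have D: "\<beta> (e' j) (e' l) =
      (P$j$1 * P$l$2 - P$j$2 * P$l$1) * \<beta> (e 1) (e 2) + (P$j$1 * P$l$3 - P$j$3 * P$l$1) * \<beta> (e 1) (e 3)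
    + (P$j$1 * P$l$4 - P$j$4 * P$l$1) * \<beta> (e 1) (e 4) + (P$j$2 * P$l$3 - P$j$3 * P$l$2) * \<beta> (e 2) (e 3)
    + (P$j$2 * P$l$4 - P$j$4 * P$l$2) * \<beta> (e 2) (e 4) + (P$j$3 * P$l$4 - P$j$4 * P$l$3) * \<beta> (e 3) (e 4)"
    if "two_form \<beta>" for j l \<beta>
    using two_form_swap[OF that, of e]
    by (simp add: assms(3) sum_4 bilinearD[OF two_formD(1)[OF that]] two_formD(2)[OF that] algebra_simps)
  show ?thesis
    unfolding wedge_def D[OF assms(1)] D[OF assms(2)] det_4 by algebra
qed

lemma orthonormal_change:
  fixes e e' :: "4 \<Rightarrow> real^4"
  assumes "inner_form h" "orthonormal h e" "orthonormal h e'"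
  defines "P \<equiv> \<chi> j i. h (e i) (e' j)"
  shows "e' j = (\<Sum>i\<in>UNIV. P $ j $ i *\<^sub>R e i)" "orthogonal_matrix P"
proof -
  have bil: "bilinear h" using assms(1) by (simp add: inner_form_def)
  show e: "e' j = (\<Sum>i\<in>UNIV. P $ j $ i *\<^sub>R e i)" for j
    using orthonormal_expand[OF assms(1,2), of "e' j"] by (simp add: P_def)
  have "h (e' j) (e' l) = (\<Sum>i\<in>UNIV. P $ j $ i * P $ l $ i)" for j l
    by (subst e) (simp add: bilinear_sums[OF bil] bilinearD[OF bil] P_def)
  then have "(P ** transpose P) $ j $ l = mat 1 $ j $ l" for j l
    using assms(3) by (simp add: matrix_matrix_mult_def transpose_def orthonormal_def mat_def)
  then have "P ** transpose P = mat 1" by (simp add: vec_eq_iff)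
  then show "orthogonal_matrix P"
    unfolding orthogonal_matrix_def using matrix_left_right_inverse by blast
qed

text \<open>The sign is fixed before the forms are: it can be read off from one pair of forms and
  then used for all others.\<close>

lemma wedge_orthonormal_change:
  assumes "inner_form h" "orthonormal h e" "orthonormal h e'"
  shows "\<exists>d\<in>{1, -1}. \<forall>\<beta> \<gamma>. two_form \<beta> \<longrightarrow> two_form \<gamma> \<longrightarrow> wedge \<beta> \<gamma> e' = d * wedge \<beta> \<gamma> e"
  using wedge_change[OF _ _ orthonormal_change(1)[OF assms]]
    det_orthogonal_matrix[OF orthonormal_change(2)[OF assms]] by blast

text \<open>Invariance of the trace relative to h. Summing over the new frame first produces the
  entries of \<open>transpose P ** P\<close>, the identity matrix.\<close>

lemma trace_orthonormal_change:
  fixes e e' :: "4 \<Rightarrow> real^4"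
  assumes "inner_form h" "orthonormal h e" "orthonormal h e'" "bilinear F"
  shows "(\<Sum>j\<in>UNIV. F (e' j) (e' j)) = (\<Sum>i\<in>UNIV. F (e i) (e i) :: real)"
proof -
  define P where "P = (\<chi> j i. h (e i) (e' j))"
  note e = orthonormal_change(1)[OF assms(1-3), folded P_def]
  have "transpose P ** P = mat 1"
    using orthonormal_change(2)[OF assms(1-3), folded P_def] by (simp add: orthogonal_matrix_def)
  then have PP: "(\<Sum>j\<in>UNIV. P $ j $ i * P $ j $ k) = (if i = k then 1 else 0)" for i k
    by (simp add: vec_eq_iff matrix_matrix_mult_def transpose_def mat_def)
  have "F (e' j) (e' j) = (\<Sum>i\<in>UNIV. \<Sum>k\<in>UNIV. P $ j $ i * P $ j $ k * F (e k) (e i))" for j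
    by (subst (1 2) e) (simp add: bilinear_sums[OF assms(4)] bilinearD[OF assms(4)] sum_distrib_left mult_ac)
  then have "(\<Sum>j\<in>UNIV. F (e' j) (e' j)) = (\<Sum>j\<in>UNIV. \<Sum>i\<in>UNIV. \<Sum>k\<in>UNIV. P $ j $ i * P $ j $ k * F (e k) (e i))" by simp
  also have "\<dots> = (\<Sum>i\<in>UNIV. \<Sum>k\<in>UNIV. \<Sum>j\<in>UNIV. P $ j $ i * P $ j $ k * F (e k) (e i))"
    by (subst sum.swap, rule sum.cong[OF refl], rule sum.swap)
  also have "\<dots> = (\<Sum>i\<in>UNIV. F (e i) (e i))"
    by (simp add: PP flip: sum_distrib_right) (simp add: if_distrib[of "\<lambda>x. x * _"] cong: if_cong)
  finally show ?thesis .
qed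

text \<open>Trace invariance is applied to one slot at a time, the other slot being summed over a
  fixed frame.\<close>

lemma form_inner_orthonormal_change:
  assumes "inner_form h" "orthonormal h e" "orthonormal h e'" "two_form \<beta>" "two_form \<gamma>"
  shows "form_inner e' \<beta> \<gamma> = form_inner e \<beta> \<gamma>"
proof -
  note b = bilinearD[OF two_formD(1)[OF assms(4)]] bilinearD[OF two_formD(1)[OF assms(5)]]
  have bil: "bilinear F" if "F = (\<lambda>a b. \<Sum>j\<in>UNIV. \<beta> (f j) a * \<gamma> (f j) b) \<or> F = (\<lambda>a b. \<Sum>j\<in>UNIV. \<beta> a (f j) * \<gamma> b (f j))" for F and f :: "4 \<Rightarrow> real^4"
    using that by (auto simp: bilinear_def b algebra_simps sum.distrib sum_distrib_left intro!: linearI)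
  have "(\<Sum>i\<in>UNIV. \<Sum>j\<in>UNIV. \<beta> (e' i) (e' j) * \<gamma> (e' i) (e' j)) = (\<Sum>i\<in>UNIV. \<Sum>j\<in>UNIV. \<beta> (e' i) (e j) * \<gamma> (e' i) (e j))"
  proof (subst (1 2) sum.swap)
    show "(\<Sum>j\<in>UNIV. \<Sum>i\<in>UNIV. \<beta> (e' i) (e' j) * \<gamma> (e' i) (e' j)) = (\<Sum>j\<in>UNIV. \<Sum>i\<in>UNIV. \<beta> (e' i) (e j) * \<gamma> (e' i) (e j))"
      using trace_orthonormal_change[OF assms(1-3) bil[of "\<lambda>a b. \<Sum>j\<in>UNIV. \<beta> (e' j) a * \<gamma> (e' j) b" e']] by auto
  qed
  also have "\<dots> = (\<Sum>i\<in>UNIV. \<Sum>j\<in>UNIV. \<beta> (e i) (e j) * \<gamma> (e i) (e j))"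
    using trace_orthonormal_change[OF assms(1-3) bil[of "\<lambda>a b. \<Sum>j\<in>UNIV. \<beta> a (e j) * \<gamma> b (e j)" e]] by auto
  finally show ?thesis by (simp add: form_inner_def)
qed

subsection \<open>Anti-self-dual forms\<close>

definition wedge1 :: "('a \<Rightarrow> real) \<Rightarrow> ('a \<Rightarrow> real) \<Rightarrow> 'a \<Rightarrow> 'a \<Rightarrow> real" where
  "wedge1 \<epsilon> \<delta> a b = \<epsilon> a * \<delta> b - \<epsilon> b * \<delta> a"

text \<open>The divisor sqrt 2 gives unit length for \<open>form_inner\<close>. The forms are built
  from the coframe \<epsilon> and not from the frame, so that the Leibniz rule applies to them
  directly. The plus sign for i = 2 arises because 24 stands in place of the cyclic 42.\<close>

definition asd_basis :: "(4 \<Rightarrow> real^4 \<Rightarrow> real) \<Rightarrow> 3 \<Rightarrow> form2" where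
  "asd_basis \<epsilon> i a b =
     (if i = 1 then wedge1 (\<epsilon> 1) (\<epsilon> 2) a b - wedge1 (\<epsilon> 3) (\<epsilon> 4) a b
      else if i = 2 then wedge1 (\<epsilon> 1) (\<epsilon> 3) a b + wedge1 (\<epsilon> 2) (\<epsilon> 4) a b
      else wedge1 (\<epsilon> 1) (\<epsilon> 4) a b - wedge1 (\<epsilon> 2) (\<epsilon> 3) a b) / sqrt 2"

definition oriented :: "form2 \<Rightarrow> form2 \<Rightarrow> (4 \<Rightarrow> real^4) \<Rightarrow> bool" where
  "oriented h om e \<longleftrightarrow> orthonormal h e \<and> wedge om om e > 0"

definition asd_forms :: "form2 \<Rightarrow> form2 \<Rightarrow> form2 set" where
  "asd_forms h om = {\<beta>. two_form \<beta> \<and> (\<forall>e. oriented h om e \<longrightarrow> \<beta> (e 3) (e 4) = - \<beta> (e 1) (e 2))}"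

lemma two_form_wedge1: "linear \<epsilon> \<Longrightarrow> linear \<delta> \<Longrightarrow> two_form (wedge1 \<epsilon> \<delta>)"
  unfolding two_form_def bilinear_def wedge1_def
  by (auto intro!: linearI simp: linear_add linear_cmul algebra_simps)

lemma two_form_asd_basis: "(\<And>i. linear (\<epsilon> i)) \<Longrightarrow> two_form (asd_basis \<epsilon> i)"
  unfolding two_form_def bilinear_def asd_basis_def[abs_def] wedge1_def
  by (auto intro!: linearI simp: linear_add linear_cmul algebra_simps diff_divide_distrib add_divide_distrib)

lemma inner_formD:
  assumes "inner_form h"
  shows "bilinear h" "h a b = h b a" "a \<noteq> 0 \<Longrightarrow> 0 < h a a"
  using assms unfolding inner_form_def by auto

lemma linear_inner_form: "inner_form h \<Longrightarrow> linear (h a)"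
  unfolding inner_form_def bilinear_def by auto

text \<open>Reduces a condition on all oriented frames to three equations in one of them. Cyclic
  permutations of the last three frame vectors give the equations; the converse goes through a
  frame-independent reformulation.\<close>

lemma asd_forms_iff:
  assumes "inner_form h" "two_form om" "oriented h om e"
  shows "\<beta> \<in> asd_forms h om \<longleftrightarrow> two_form \<beta> \<and> \<beta> (e 3) (e 4) = - \<beta> (e 1) (e 2) \<and>
     \<beta> (e 2) (e 4) = \<beta> (e 1) (e 3) \<and> \<beta> (e 2) (e 3) = - \<beta> (e 1) (e 4)" (is "?L \<longleftrightarrow> ?R")
proof
  assume L: ?L
  then have t: "two_form \<beta>" by (simp add: asd_forms_def)
  have e: "\<beta> (e' 3) (e' 4) = - \<beta> (e' 1) (e' 2)" if "oriented h om e'" for e'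
    using that L by (auto simp: asd_forms_def)
  \<comment> \<open>A 3-cycle on the indices 2, 3, 4 is even, so it keeps the frame oriented; it and
    its square yield the second and the third equation.\<close>
  define \<sigma> where "\<sigma> i = (if i = 1 then 1 else if i = 2 then 3 else if i = 3 then 4 else 2 :: 4)" for i :: 4
  have s: "\<sigma> 1 = 1" "\<sigma> 2 = 3" "\<sigma> 3 = 4" "\<sigma> 4 = 2" by (simp_all add: \<sigma>_def)
  have inj: "\<sigma> i = \<sigma> j \<longleftrightarrow> i = j" for i j
    using exhaust_4[of i] exhaust_4[of j] by (auto simp: s)
  have o: "oriented h om (\<lambda>i. f (\<sigma> i))" if "oriented h om f" for f
    using that two_form_swap[OF assms(2), of f]
    by (auto simp: oriented_def orthonormal_def inj s wedge_def algebra_simps)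
  show ?R
    using e[OF assms(3)] e[OF o[OF assms(3)]] e[OF o[OF o[OF assms(3)]]] t
      two_formD(3)[OF t, of "e 4" "e 2"] by (simp add: s)
next
  assume R: ?R
  then have t: "two_form \<beta>" by simp
  have on: "orthonormal h e" and w: "wedge om om e > 0" using assms(3) by (auto simp: oriented_def)
  \<comment> \<open>The three equations together say that the wedge product with any \<gamma> is
    minus the inner product. Both sides are invariant under a change of oriented orthonormal
    frame.\<close>
  have key: "wedge \<beta> \<gamma> e = - form_inner e \<beta> \<gamma>" if "two_form \<gamma>" for \<gamma>
    using R two_form_swap[OF t, of e] two_form_swap[OF that, of e]
    by (simp add: wedge_def form_inner_def sum_4 two_formD(2)[OF t] two_formD(2)[OF that] field_simps)
  have "\<beta> (e' 3) (e' 4) = - \<beta> (e' 1) (e' 2)" if o: "oriented h om e'" for e'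
  proof -
    have on': "orthonormal h e'" and w': "wedge om om e' > 0" using o by (auto simp: oriented_def)
    obtain d where d: "d \<in> {1, -1}" "\<And>\<beta> \<gamma>. two_form \<beta> \<Longrightarrow> two_form \<gamma> \<Longrightarrow> wedge \<beta> \<gamma> e' = d * wedge \<beta> \<gamma> e"
      using wedge_orthonormal_change[OF assms(1) on on'] by blast
    have "d = 1" using d(1) d(2)[OF assms(2) assms(2)] w w' by auto
    \<comment> \<open>Testing against the dual form of the first two vectors of the new frame picks
      out the components 34 and 12 of \<beta>.\<close>
    define \<gamma> where "\<gamma> = wedge1 (h (e' 1)) (h (e' 2))"
    have g: "two_form \<gamma>"
      unfolding \<gamma>_def by (intro two_form_wedge1 linear_inner_form assms(1))
    have "wedge \<beta> \<gamma> e' = - form_inner e' \<beta> \<gamma>"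
      using d(2)[OF t g] key[OF g] form_inner_orthonormal_change[OF assms(1) on on' t g] \<open>d = 1\<close> by simp
    then show ?thesis
      using on' two_formD(3)[OF t, of "e' 2" "e' 1"]
      by (simp add: wedge_def form_inner_def sum_4 \<gamma>_def wedge1_def orthonormal_def two_formD(2)[OF t])
  qed
  then show ?L using t by (simp add: asd_forms_def)
qed

lemma coframe_simps:
  fixes e :: "4 \<Rightarrow> real^4"
  assumes "orthonormal h e"
  shows "asd_basis (\<lambda>i. h (e i)) k (e i) (e j) =
    (if k = 1 then (if i = 1 \<and> j = 2 then 1 else if i = 2 \<and> j = 1 then -1 else if i = 3 \<and> j = 4 then -1 else if i = 4 \<and> j = 3 then 1 else 0)
     else if k = 2 then (if i = 1 \<and> j = 3 then 1 else if i = 3 \<and> j = 1 then -1 else if i = 2 \<and> j = 4 then 1 else if i = 4 \<and> j = 2 then -1 else 0)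
     else (if i = 1 \<and> j = 4 then 1 else if i = 4 \<and> j = 1 then -1 else if i = 2 \<and> j = 3 then -1 else if i = 3 \<and> j = 2 then 1 else 0)) / sqrt 2"
  using assms unfolding orthonormal_def asd_basis_def wedge1_def
  using exhaust_4[of i] exhaust_4[of j] by auto

lemma asd_basis_in:
  assumes "inner_form h" "two_form om" "oriented h om e"
  shows "asd_basis (\<lambda>i. h (e i)) k \<in> asd_forms h om"
proof -
  have on: "orthonormal h e" using assms(3) by (auto simp: oriented_def)
  show ?thesis
    unfolding asd_forms_iff[OF assms]
    by (auto simp: coframe_simps[OF on] intro!: two_form_asd_basis linear_inner_form assms(1))
qed

lemma asd_basis_orthonormal:
  assumes "inner_form h" "orthonormal h e" "orthonormal h e'"
  shows "form_inner e' (asd_basis (\<lambda>i. h (e i)) k) (asd_basis (\<lambda>i. h (e i)) l) = (if k = l then 1 else 0)"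
proof -
  have t: "two_form (asd_basis (\<lambda>i. h (e i)) k)" for k
    by (intro two_form_asd_basis linear_inner_form assms(1))
  show ?thesis
    unfolding form_inner_orthonormal_change[OF assms t t]
    unfolding form_inner_def sum_4 coframe_simps[OF assms(2)]
    using exhaust_3[of k] exhaust_3[of l] by (elim disjE) simp_all
qed

lemma bilinear_frame_eqI:
  assumes "inner_form h" "orthonormal h (e :: 4 \<Rightarrow> real^4)" "bilinear \<beta>" "bilinear \<gamma>" "\<And>i j. \<beta> (e i) (e j) = \<gamma> (e i) (e j)"
  shows "\<beta> = (\<gamma> :: form2)"
proof (intro ext)
  fix a b
  have "\<beta> a b = \<beta> (\<Sum>i\<in>UNIV. h (e i) a *\<^sub>R e i) (\<Sum>i\<in>UNIV. h (e i) b *\<^sub>R e i)"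
    using orthonormal_expand[OF assms(1,2)] by simp
  also have "\<dots> = \<gamma> (\<Sum>i\<in>UNIV. h (e i) a *\<^sub>R e i) (\<Sum>i\<in>UNIV. h (e i) b *\<^sub>R e i)"
    by (simp add: bilinear_sums assms(3,4) bilinearD[OF assms(3)] bilinearD[OF assms(4)] assms(5))
  also have "\<dots> = \<gamma> a b"
    using orthonormal_expand[OF assms(1,2)] by simp
  finally show "\<beta> a b = \<gamma> a b" .
qed

lemma two_form_frame_eqI:
  assumes "inner_form h" "orthonormal h (e :: 4 \<Rightarrow> real^4)" "two_form \<beta>" "two_form \<gamma>"
    "\<beta> (e 1) (e 2) = \<gamma> (e 1) (e 2)" "\<beta> (e 1) (e 3) = \<gamma> (e 1) (e 3)" "\<beta> (e 1) (e 4) = \<gamma> (e 1) (e 4)"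
    "\<beta> (e 2) (e 3) = \<gamma> (e 2) (e 3)" "\<beta> (e 2) (e 4) = \<gamma> (e 2) (e 4)" "\<beta> (e 3) (e 4) = \<gamma> (e 3) (e 4)"
  shows "\<beta> = \<gamma>"
proof (rule bilinear_frame_eqI[OF assms(1,2) two_formD(1)[OF assms(3)] two_formD(1)[OF assms(4)]])
  have "\<forall>i j. \<beta> (e i) (e j) = \<gamma> (e i) (e j)"
    unfolding forall_4
    using assms(5-) two_form_swap[OF assms(3), of e] two_form_swap[OF assms(4), of e]
    by (simp add: two_formD(2)[OF assms(3)] two_formD(2)[OF assms(4)])
  then show "\<beta> (e i) (e j) = \<gamma> (e i) (e j)" for i j by blast
qed

lemma two_form_combine: "(\<And>i. two_form (b i)) \<Longrightarrow> two_form (combine b v)"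
proof -
  assume t: "\<And>i. two_form (b i)"
  have "bilinear (combine b v)"
    unfolding combine_def bilinear_def using bilinearD[OF two_formD(1)[OF t]]
    by (auto intro!: linearI simp: algebra_simps sum.distrib sum_distrib_left)
  then show ?thesis using two_formD(2)[OF t] by (simp add: two_form_def combine_def)
qed

lemma asd_combine:
  assumes "inner_form h" "two_form om" "oriented h om e" "\<beta> \<in> asd_forms h om"
  shows "\<beta> = combine (asd_basis (\<lambda>i. h (e i))) (vector [sqrt 2 * \<beta> (e 1) (e 2), sqrt 2 * \<beta> (e 1) (e 3), sqrt 2 * \<beta> (e 1) (e 4)])"
    (is "_ = ?\<gamma>")
proof -
  have on: "orthonormal h e" using assms(3) by (auto simp: oriented_def)
  have b: "two_form \<beta>" "\<beta> (e 3) (e 4) = - \<beta> (e 1) (e 2)" "\<beta> (e 2) (e 4) = \<beta> (e 1) (e 3)" "\<beta> (e 2) (e 3) = - \<beta> (e 1) (e 4)"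
    using assms(4) asd_forms_iff[OF assms(1-3)] by auto
  have t: "two_form ?\<gamma>"
    by (intro two_form_combine two_form_asd_basis linear_inner_form assms(1))
  show ?thesis
    by (rule two_form_frame_eqI[OF assms(1) on b(1) t])
      (simp_all add: combine_def sum_3 coframe_simps[OF on] b(2-4))
qed

lemma combine_in_asd:
  assumes "inner_form h" "two_form om" "oriented h om e"
  shows "combine (asd_basis (\<lambda>i. h (e i))) v \<in> asd_forms h om"
proof -
  have on: "orthonormal h e" using assms(3) by (auto simp: oriented_def)
  have "two_form (combine (asd_basis (\<lambda>i. h (e i))) v)"
    by (intro two_form_combine two_form_asd_basis linear_inner_form assms(1))
  then show ?thesis
    unfolding asd_forms_iff[OF assms] by (simp add: coframe_simps[OF on] sum_3 combine_def)
qed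

lemma combine_asd_basis_eval:
  assumes "orthonormal h e"
  shows "combine (asd_basis (\<lambda>i. h (e i))) v (e 1) (e 2) = v $ 1 / sqrt 2"
    "combine (asd_basis (\<lambda>i. h (e i))) v (e 1) (e 3) = v $ 2 / sqrt 2"
    "combine (asd_basis (\<lambda>i. h (e i))) v (e 1) (e 4) = v $ 3 / sqrt 2"
  by (simp_all add: combine_def sum_3 coframe_simps[OF assms])

subsection \<open>The adjoint representation of \<open>SO(3)\<close>\<close>

text \<open>Orthogonality makes the square of the scalar 1 and the determinant makes its cube 1. The
  odd dimension is what excludes minus the identity.\<close>

lemma rotation_matrix_scalar:
  fixes Q :: "real^3^3"
  assumes "rotation_matrix Q" "\<And>i j. i \<noteq> j \<Longrightarrow> Q $ i $ j = 0" "Q $ 1 $ 1 = Q $ 2 $ 2" "Q $ 2 $ 2 = Q $ 3 $ 3"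
  shows "Q = mat 1"
proof -
  have "det Q = 1" "transpose Q ** Q = mat 1"
    using assms(1) by (auto simp: rotation_matrix_def orthogonal_matrix_def)
  then have "(transpose Q ** Q) $ 1 $ 1 = 1" by (simp add: mat_def)
  then have 1: "Q $ 1 $ 1 * Q $ 1 $ 1 = 1"
    using assms(2) by (simp add: matrix_matrix_mult_def transpose_def sum_3)
  have "Q $ 1 $ 1 * (Q $ 1 $ 1 * Q $ 1 $ 1) = 1"
    using \<open>det Q = 1\<close> assms(2-4) by (simp add: det_3)
  then have "Q $ 1 $ 1 = 1" unfolding 1 by simp
  then show ?thesis
    using assms(3,4) assms(2)[of 1 2] assms(2)[of 1 3] assms(2)[of 2 1] assms(2)[of 2 3] assms(2)[of 3 1] assms(2)[of 3 2]
    by (simp add: vec_eq_iff forall_3 mat_def)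
qed

lemma SO3_centre_eq: "SO3_centre = {mat 1}"
proof (intro set_eqI iffI)
  fix Z :: "real^3^3"
  assume "Z \<in> SO3_centre"
  then have Z: "rotation_matrix Z" and c: "\<And>Q. rotation_matrix Q \<Longrightarrow> Z ** Q = Q ** Z"
    by (auto simp: SO3_centre_def)
  \<comment> \<open>\<open>D\<close> is a half-turn, and commuting with it kills the entries that
    couple the first axis to the others. \<open>E\<close> permutes the axes cyclically and carries
    this information to the remaining entries.\<close>
  define D :: "real^3^3" where "D = vector [vector [1, 0, 0], vector [0, -1, 0], vector [0, 0, -1]]"
  define E :: "real^3^3" where "E = vector [vector [0, 1, 0], vector [0, 0, 1], vector [1, 0, 0]]"
  have D: "rotation_matrix D"
    unfolding rotation_matrix_def orthogonal_matrix_def D_def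
    by (simp add: det_3 vec_eq_iff forall_3 matrix_matrix_mult_def transpose_def sum_3 mat_def)
  have E: "rotation_matrix E"
    unfolding rotation_matrix_def orthogonal_matrix_def E_def
    by (simp add: det_3 vec_eq_iff forall_3 matrix_matrix_mult_def transpose_def sum_3 mat_def)
  have d: "Z $ 1 $ 2 = 0" "Z $ 1 $ 3 = 0" "Z $ 2 $ 1 = 0" "Z $ 3 $ 1 = 0"
    using c[OF D] unfolding D_def
    by (simp_all add: vec_eq_iff forall_3 matrix_matrix_mult_def sum_3)
  have e: "Z $ 2 $ 3 = Z $ 1 $ 2" "Z $ 3 $ 2 = Z $ 2 $ 1" "Z $ 1 $ 1 = Z $ 2 $ 2" "Z $ 2 $ 2 = Z $ 3 $ 3"
    using arg_cong[OF c[OF E], of "\<lambda>A. A $ 1 $ 3"] arg_cong[OF c[OF E], of "\<lambda>A. A $ 2 $ 2"]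
      arg_cong[OF c[OF E], of "\<lambda>A. A $ 1 $ 2"] arg_cong[OF c[OF E], of "\<lambda>A. A $ 2 $ 3"]
    unfolding E_def by (simp_all add: matrix_matrix_mult_def sum_3)
  have "Z = mat 1"
  proof (rule rotation_matrix_scalar[OF Z])
    show "Z $ i $ j = 0" if "i \<noteq> j" for i j
      using that exhaust_3[of i] exhaust_3[of j] d e by auto
  qed (use e in auto)
  then show "Z \<in> {mat 1}" by simp
next
  fix Z :: "real^3^3"
  assume "Z \<in> {mat 1}"
  then show "Z \<in> SO3_centre"
    by (simp add: SO3_centre_def rotation_matrix_def orthogonal_matrix_def transpose_mat)
qed

section \<open>The Levi-Civita connection in a coframe\<close>

lemma frechet_derivative_eq: "(f has_derivative f') (at x) \<Longrightarrow> frechet_derivative f (at x) = f'"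
  using frechet_derivative_at by metis

lemma differentiable_frechet: "f differentiable (at x) \<Longrightarrow> (f has_derivative frechet_derivative f (at x)) (at x)"
  using frechet_derivative_works by blast

text \<open>Supplies the existence half of the description in \<open>christoffel\<close>; the
  uniqueness half is \<open>inner_form_unique\<close>.\<close>

lemma inner_form_riesz:
  fixes h :: "'e::euclidean_space \<Rightarrow> 'e \<Rightarrow> real"
  assumes "inner_form h" "linear F"
  shows "\<exists>v. \<forall>c. h v c = F c"
proof -
  note bil = inner_formD(1)[OF assms(1)]
  define T where "T v = (\<Sum>b\<in>Basis. h v b *\<^sub>R b)" for v
  have lin: "linear T"
    by (rule linearI) (simp_all add: T_def bilinearD[OF bil] scaleR_left_distrib sum.distrib scaleR_sum_right)
  have T: "T v \<bullet> c = h v c" for v c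
  proof -
    have "h v c = h v (\<Sum>b\<in>Basis. (c \<bullet> b) *\<^sub>R b)" by (simp add: euclidean_representation)
    also have "\<dots> = T v \<bullet> c"
      by (simp add: bilinear_sums[OF bil] bilinearD[OF bil] T_def inner_sum_left inner_sum_right inner_commute mult.commute)
    finally show ?thesis by simp
  qed
  have "v = 0" if "T v = 0" for v
    using T[of v v] that inner_formD(3)[OF assms(1), of v] by auto
  then have "inj T" using lin linear_injective_0 by blast
  then have "surj T" using lin linear_injective_imp_surjective by blast
  then obtain v where v: "T v = (\<Sum>b\<in>Basis. F b *\<^sub>R b)" by (metis surjD)
  have "h v c = F c" for c
  proof -
    have "F c = F (\<Sum>b\<in>Basis. (c \<bullet> b) *\<^sub>R b)" by (simp add: euclidean_representation)
    also have "\<dots> = (\<Sum>b\<in>Basis. F b *\<^sub>R b) \<bullet> c"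
      by (simp add: linear_sum[OF assms(2)] linear_cmul[OF assms(2)] inner_sum_left inner_sum_right inner_commute mult.commute)
    finally show ?thesis using T[of v c] v by simp
  qed
  then show ?thesis by blast
qed

lemma inner_form_unique:
  assumes "inner_form h" "\<And>c. h v c = h v' c"
  shows "v = v'"
proof (rule ccontr)
  assume "v \<noteq> v'"
  then have "0 < h (v - v') (v - v')" using inner_formD(3)[OF assms(1)] by simp
  then show False using assms(2) by (simp add: bilinearD[OF inner_formD(1)[OF assms(1)]])
qed

lemma christoffel_eqI:
  assumes "inner_form (h x)"
    "\<And>c. 2 * h x v c = frechet_derivative (\<lambda>z. h z b c) (at x) a
        + frechet_derivative (\<lambda>z. h z a c) (at x) b
        - frechet_derivative (\<lambda>z. h z a b) (at x) c"
  shows "christoffel h x a b = v"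
  unfolding christoffel_def
proof (rule the_equality)
  show "\<forall>c. 2 * h x v c = frechet_derivative (\<lambda>z. h z b c) (at x) a
        + frechet_derivative (\<lambda>z. h z a c) (at x) b
        - frechet_derivative (\<lambda>z. h z a b) (at x) c" using assms(2) by blast
next
  fix v' assume "\<forall>c. 2 * h x v' c = frechet_derivative (\<lambda>z. h z b c) (at x) a
        + frechet_derivative (\<lambda>z. h z a c) (at x) b
        - frechet_derivative (\<lambda>z. h z a b) (at x) c"
  then have "h x v' c = h x v c" for c using assms(2)[of c] by (metis mult_cancel_left zero_neq_numeral)
  then show "v' = v" by (rule inner_form_unique[OF assms(1)])
qed

locale metric_on =
  fixes h :: "'e::euclidean_space \<Rightarrow> 'e \<Rightarrow> 'e \<Rightarrow> real" and S :: "'e set"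
  assumes open_S: "open S"
    and inner: "\<And>x. x \<in> S \<Longrightarrow> inner_form (h x)"
    and differentiable: "\<And>x a b. x \<in> S \<Longrightarrow> (\<lambda>z. h z a b) differentiable (at x)"
begin

definition dh :: "'e \<Rightarrow> 'e \<Rightarrow> 'e \<Rightarrow> 'e \<Rightarrow> real" where
  "dh x v a b = frechet_derivative (\<lambda>z. h z a b) (at x) v"

lemma dh: "x \<in> S \<Longrightarrow> ((\<lambda>z. h z a b) has_derivative (\<lambda>v. dh x v a b)) (at x)"
  unfolding dh_def by (rule differentiable_frechet[OF differentiable])

lemma dh_eqI:
  assumes "x \<in> S" "(f has_derivative f') (at x)" "\<And>z. z \<in> S \<Longrightarrow> f z = h z a b"
  shows "dh x v a b = f' v"
proof -
  have "((\<lambda>z. h z a b) has_derivative f') (at x)"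
    by (rule has_derivative_transform_within_open[OF assms(2) open_S assms(1,3)])
  then show ?thesis unfolding dh_def by (simp add: frechet_derivative_eq)
qed

lemma dh_sym: "x \<in> S \<Longrightarrow> dh x v a b = dh x v b a"
  by (rule dh_eqI[OF _ dh]) (auto intro: inner_formD(2) inner)

lemma dh_linear:
  assumes "x \<in> S"
  shows "linear (\<lambda>v. dh x v a b)" "linear (\<lambda>a. dh x v a b)" "linear (\<lambda>b. dh x v a b)"
proof -
  show "linear (\<lambda>v. dh x v a b)" using dh[OF assms] has_derivative_linear by blast
  have *: "linear (\<lambda>a. dh x v a b)" for b
  proof (rule linearI)
    show "dh x v (a + a') b = dh x v a b + dh x v a' b" for a a'
      by (rule dh_eqI[OF assms has_derivative_add[OF dh[OF assms] dh[OF assms]]])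
        (simp add: bilinearD[OF inner_formD(1)[OF inner]])
    show "dh x v (r *\<^sub>R a) b = r *\<^sub>R dh x v a b" for r a
      by (rule dh_eqI[OF assms has_derivative_scaleR_right[OF dh[OF assms]]])
        (simp add: bilinearD[OF inner_formD(1)[OF inner]])
  qed
  show "linear (\<lambda>a. dh x v a b)" by (rule *)
  show "linear (\<lambda>b. dh x v a b)"
    using *[of a] unfolding dh_sym[OF assms, of v _ a] .
qed

lemmas dh_simps =
  linear_add[OF dh_linear(1)] linear_add[OF dh_linear(2)] linear_add[OF dh_linear(3)]
  linear_cmul[OF dh_linear(1)] linear_cmul[OF dh_linear(2)] linear_cmul[OF dh_linear(3)]

lemma koszul:
  assumes "x \<in> S"
  shows "2 * h x (christoffel h x a b) c = dh x a b c + dh x b a c - dh x c a b"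
proof -
  have "linear (\<lambda>c. (dh x a b c + dh x b a c - dh x c a b) / 2)"
    by (rule linearI) (simp_all add: dh_simps[OF assms] field_simps)
  then obtain v where v: "\<forall>c. h x v c = (dh x a b c + dh x b a c - dh x c a b) / 2"
    using inner_form_riesz[OF inner[OF assms]] by blast
  have "christoffel h x a b = v"
    by (rule christoffel_eqI[where h=h and x=x, OF inner[OF assms]]) (simp add: v dh_def)
  then show ?thesis using v[rule_format, of c] by simp
qed

text \<open>In the sum of the Koszul formulas for (v, a, b) and (v, b, a) everything cancels except
  twice the derivative along v.\<close>

lemma christoffel_compatible:
  assumes "x \<in> S"
  shows "dh x v a b = h x (christoffel h x v a) b + h x a (christoffel h x v b)"
  using koszul[OF assms, of v a b] koszul[OF assms, of v b a] dh_sym[OF assms]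
    inner_formD(2)[OF inner[OF assms], of a]
  by (smt (verit))

lemma christoffel_linear:
  assumes "x \<in> S"
  shows "linear (christoffel h x a)"
proof (rule linearI)
  note bil = bilinearD[OF inner_formD(1)[OF inner[OF assms]]]
  note lin = dh_simps[OF assms]
  show "christoffel h x a (b + b') = christoffel h x a b + christoffel h x a b'" for b b'
  proof (rule inner_form_unique[OF inner[OF assms]])
    fix c show "h x (christoffel h x a (b + b')) c = h x (christoffel h x a b + christoffel h x a b') c"
      using koszul[OF assms, of a b c] koszul[OF assms, of a b' c] koszul[OF assms, of a "b + b'" c]
      by (simp add: bil lin)
  qed
  show "christoffel h x a (r *\<^sub>R b) = r *\<^sub>R christoffel h x a b" for r b
  proof (rule inner_form_unique[OF inner[OF assms]])
    fix c
    have "2 * h x (christoffel h x a (r *\<^sub>R b)) c = r * (2 * h x (christoffel h x a b) c)"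
      unfolding koszul[OF assms] by (simp add: lin algebra_simps)
    then show "h x (christoffel h x a (r *\<^sub>R b)) c = h x (r *\<^sub>R christoffel h x a b) c"
      by (simp add: bil)
  qed
qed

lemma has_derivative_coframe_metric:
  fixes \<epsilon> :: "'e \<Rightarrow> 'i::finite \<Rightarrow> 'e \<Rightarrow> real"
  assumes "x \<in> S" "\<And>z a b. z \<in> S \<Longrightarrow> h z a b = (\<Sum>i\<in>UNIV. \<epsilon> z i a * \<epsilon> z i b)"
    "\<And>i a. ((\<lambda>z. \<epsilon> z i a) has_derivative (\<lambda>v. d\<epsilon> v i a)) (at x)"
  shows "dh x v a b = (\<Sum>i\<in>UNIV. \<epsilon> x i a * d\<epsilon> v i b + d\<epsilon> v i a * \<epsilon> x i b)"
  by (rule dh_eqI[OF assms(1), where f="\<lambda>z. \<Sum>i\<in>UNIV. \<epsilon> z i a * \<epsilon> z i b"])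
    (auto intro!: has_derivative_sum has_derivative_mult[OF assms(3) assms(3)] simp: assms(2))

text \<open>Cartan's first structure equation determines the connection forms \<open>\<omega>\<close> of a coframe.\<close>

lemma christoffel_coframe:
  fixes \<epsilon> :: "'e \<Rightarrow> 'i::finite \<Rightarrow> 'e \<Rightarrow> real"
  assumes "x \<in> S" "\<And>z a b. z \<in> S \<Longrightarrow> h z a b = (\<Sum>i\<in>UNIV. \<epsilon> z i a * \<epsilon> z i b)"
    "\<And>i a. ((\<lambda>z. \<epsilon> z i a) has_derivative (\<lambda>v. d\<epsilon> v i a)) (at x)"
    "\<And>i. linear (\<epsilon> x i)" "\<And>i j. \<epsilon> x i (E j) = (if i = j then 1 else 0)"
    "\<And>v i j. \<omega> v i j = - \<omega> v j i"
    "\<And>v a i. d\<epsilon> v i a + (\<Sum>j\<in>UNIV. \<omega> v i j * \<epsilon> x j a) = d\<epsilon> a i v + (\<Sum>j\<in>UNIV. \<omega> a i j * \<epsilon> x j v)"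
  shows "\<epsilon> x i (christoffel h x v a) = d\<epsilon> v i a + (\<Sum>j\<in>UNIV. \<omega> v i j * \<epsilon> x j a)"
proof -
  \<comment> \<open>The expected i-th component of the covariant derivative along v of the constant
    field a. Its symmetry in v and a is the structure equation, that is, vanishing torsion.\<close>
  define r where "r v i a = d\<epsilon> v i a + (\<Sum>j\<in>UNIV. \<omega> v i j * \<epsilon> x j a)" for v i a
  have rs: "r v i a = r a i v" for v a i unfolding r_def by (rule assms(7))
  \<comment> \<open>Skew symmetry of \<omega> allows the derivatives of the coframe to be replaced
    by r in the derivative of the metric; by the symmetry of r the Koszul sum then
    collapses.\<close>
  have skew: "(\<Sum>i\<in>UNIV. \<Sum>j\<in>UNIV. \<epsilon> x i a * (\<omega> v i j * \<epsilon> x j b) + (\<omega> v i j * \<epsilon> x j a) * \<epsilon> x i b) = 0" for v a b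
  proof -
    have "(\<Sum>i\<in>UNIV. \<Sum>j\<in>UNIV. (\<omega> v i j * \<epsilon> x j a) * \<epsilon> x i b) = (\<Sum>i\<in>UNIV. \<Sum>j\<in>UNIV. (\<omega> v j i * \<epsilon> x i a) * \<epsilon> x j b)"
      by (rule sum.swap)
    also have "\<dots> = (\<Sum>i\<in>UNIV. \<Sum>j\<in>UNIV. - (\<epsilon> x i a * (\<omega> v i j * \<epsilon> x j b)))"
      by (intro sum.cong refl) (subst assms(6), simp)
    finally show ?thesis by (simp add: sum.distrib sum_negf)
  qed
  have DM: "dh x v a b = (\<Sum>i\<in>UNIV. \<epsilon> x i a * d\<epsilon> v i b + d\<epsilon> v i a * \<epsilon> x i b)" for v a b
    by (rule has_derivative_coframe_metric[where \<epsilon>=\<epsilon> and d\<epsilon>=d\<epsilon>, OF assms(1-3)])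
  have D: "dh x v a b = (\<Sum>i\<in>UNIV. \<epsilon> x i a * r v i b + r v i a * \<epsilon> x i b)" for v a b
  proof -
    have "\<epsilon> x i a * r v i b + r v i a * \<epsilon> x i b = (\<epsilon> x i a * d\<epsilon> v i b + d\<epsilon> v i a * \<epsilon> x i b) +
      (\<Sum>j\<in>UNIV. \<epsilon> x i a * (\<omega> v i j * \<epsilon> x j b) + (\<omega> v i j * \<epsilon> x j a) * \<epsilon> x i b)" for i
      by (simp add: r_def algebra_simps sum.distrib sum_distrib_left sum_distrib_right)
    then have "(\<Sum>i\<in>UNIV. \<epsilon> x i a * r v i b + r v i a * \<epsilon> x i b) = dh x v a b +
      (\<Sum>i\<in>UNIV. \<Sum>j\<in>UNIV. \<epsilon> x i a * (\<omega> v i j * \<epsilon> x j b) + (\<omega> v i j * \<epsilon> x j a) * \<epsilon> x i b)"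
      unfolding DM by (simp only: sum.distrib)
    then show ?thesis unfolding skew by simp
  qed
  define u where "u = (\<Sum>i\<in>UNIV. r v i a *\<^sub>R E i)"
  have u: "\<epsilon> x i u = r v i a" for i
    unfolding u_def
    by (simp add: linear_sum[OF assms(4)] linear_cmul[OF assms(4)] assms(5) if_distrib cong: if_cong)
  have "christoffel h x v a = u"
  proof (rule christoffel_eqI[where h=h and x=x, OF inner[OF assms(1)]], fold dh_def)
    fix c
    have "dh x v a c + dh x a v c - dh x c v a =
      (\<Sum>i\<in>UNIV. (\<epsilon> x i a * r v i c + r v i a * \<epsilon> x i c) + (\<epsilon> x i v * r a i c + r a i v * \<epsilon> x i c)
         - (\<epsilon> x i v * r c i a + r c i v * \<epsilon> x i a))"
      unfolding D by (simp add: sum.distrib sum_subtractf)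
    also have "\<dots> = (\<Sum>i\<in>UNIV. 2 * (r v i a * \<epsilon> x i c))"
      by (intro sum.cong refl) (simp add: rs[of c] rs[of a _ v] mult.commute)
    also have "\<dots> = 2 * h x u c" by (simp add: assms(2)[OF assms(1)] u sum_distrib_left)
    finally show "2 * h x u c = dh x v a c + dh x a v c - dh x c v a" by simp
  qed
  then show ?thesis using u by (simp add: r_def)
qed

end

section \<open>Foliated charts\<close>

text \<open>\<open>killing\<close> says that the Lie derivative of g along \<xi> vanishes, since
  \<xi> is the last coordinate field. It is not part of \<open>foliated\<close>, so it has to be
  established for each chart before the locale can be used.\<close>

locale foliated_chart =
  fixes g :: "'m metric" and \<xi> :: "'m vfield" and \<kappa> :: "'m param" and S :: "(real^4) set" and T :: "real set"
  assumes domain: "fst \<kappa> = S \<times> T" "open S" "open T" "connected T"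
    and reeb: "\<And>w. w \<in> S \<times> T \<Longrightarrow> \<xi> \<kappa> w = (0, 1)"
    and inner_g: "\<And>w. w \<in> S \<times> T \<Longrightarrow> inner_form (g \<kappa> w)"
    and smooth_g: "\<And>a b. smooth_on (S \<times> T) (\<lambda>w. g \<kappa> w a b)"
    and killing: "\<And>w a b. w \<in> S \<times> T \<Longrightarrow> frechet_derivative (\<lambda>z. g \<kappa> z a b) (at w) (0, 1) = 0"
begin

lemma open_V: "open (S \<times> T)" using domain by (simp add: open_Times)

lemmas bil_g = bilinearD[OF inner_formD(1)[OF inner_g]]

lemma g_xi_pos: "w \<in> S \<times> T \<Longrightarrow> 0 < g \<kappa> w (0, 1) (0, 1)"
  by (rule inner_formD(3)[OF inner_g]) (auto simp: zero_prod_def)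

lemma g_leaf:
  assumes "(x, t) \<in> S \<times> T" "(x, t') \<in> S \<times> T"
  shows "g \<kappa> (x, t) a b = g \<kappa> (x, t') a b"
proof (rule has_derivative_zero_unique_connected[where f="\<lambda>t. g \<kappa> (x, t) a b", OF domain(3,4)])
  show "((\<lambda>t. g \<kappa> (x, t) a b) has_derivative (\<lambda>_. 0)) (at s)" if "s \<in> T" for s
  proof -
    have xs: "(x, s) \<in> S \<times> T" using assms that by auto
    note d = smooth_on_deriv[OF smooth_g xs, of a b]
    have "((\<lambda>t. g \<kappa> (x, t) a b) has_derivative (\<lambda>r. frechet_derivative (\<lambda>z. g \<kappa> z a b) (at (x, s)) (0, r))) (at s)"
      by (rule has_derivative_compose[where f="\<lambda>t. (x, t)" and g="\<lambda>z. g \<kappa> z a b", OF _ d])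
        (auto intro!: derivative_eq_intros)
    moreover have "frechet_derivative (\<lambda>z. g \<kappa> z a b) (at (x, s)) (0, r) = 0" for r
      using linear_cmul[OF has_derivative_linear[OF d], of r "(0, 1)"] killing[OF xs] by simp
    ultimately show ?thesis by simp
  qed
qed (use assms in auto)

definition lift :: "E5 \<Rightarrow> real^4 \<Rightarrow> E5" where
  "lift w a = (a, - g \<kappa> w (0, 1) (a, 0) / g \<kappa> w (0, 1) (0, 1))"

text \<open>An explicit formula for the quotient metric, evaluated at a point of the leaf. Its
  smoothness is visible, unlike that of a quantity given by a description operator.\<close>

definition H :: "E5 \<Rightarrow> form2" where
  "H w a b = g \<kappa> w (a, 0) (b, 0) - g \<kappa> w (0, 1) (a, 0) * g \<kappa> w (0, 1) (b, 0) / g \<kappa> w (0, 1) (0, 1)"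

lemma eta_split:
  assumes "w \<in> S \<times> T"
  shows "g \<kappa> w c (a, r) = g \<kappa> w c (a, 0) + r * g \<kappa> w c (0, 1)"
    "g \<kappa> w (a, r) c = g \<kappa> w (a, 0) c + r * g \<kappa> w (0, 1) c"
proof -
  have e: "(a, r) = (a, 0) + r *\<^sub>R (0, 1)" by simp
  show "g \<kappa> w c (a, r) = g \<kappa> w c (a, 0) + r * g \<kappa> w c (0, 1)"
    by (subst e) (simp only: bil_g[OF assms])
  show "g \<kappa> w (a, r) c = g \<kappa> w (a, 0) c + r * g \<kappa> w (0, 1) c"
    by (subst e) (simp only: bil_g[OF assms])
qed

lemma eta_lift:
  assumes "w \<in> S \<times> T"
  shows "eta g \<xi> \<kappa> w v = 0 \<and> fst v = a \<longleftrightarrow> v = lift w a"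
proof -
  obtain a' r where v: "v = (a', r)" by (cases v)
  show ?thesis
    using g_xi_pos[OF assms]
    unfolding eta_def reeb[OF assms] v eta_split(1)[OF assms, where a=a' and r=r] lift_def
    by (auto simp: field_simps eq_neg_iff_add_eq_0)
qed

lemma horizontal_lift: "w \<in> S \<times> T \<Longrightarrow> horizontal_lift g \<xi> \<kappa> w a = lift w a"
  unfolding horizontal_lift_def by (simp add: eta_lift)

lemma g_lift:
  assumes "w \<in> S \<times> T"
  shows "g \<kappa> w (lift w a) (lift w b) = H w a b"
proof -
  define c d where "c = - g \<kappa> w (0, 1) (a, 0) / g \<kappa> w (0, 1) (0, 1)"
    and "d = - g \<kappa> w (0, 1) (b, 0) / g \<kappa> w (0, 1) (0, 1)"
  have "g \<kappa> w (a, c) (b, d) = g \<kappa> w (a, 0) (b, 0) + d * g \<kappa> w (a, 0) (0, 1)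
     + c * (g \<kappa> w (0, 1) (b, 0) + d * g \<kappa> w (0, 1) (0, 1))"
    using eta_split(2)[OF assms, where a=a and r=c and c="(b, d)"] eta_split(1)[OF assms, where a=b and r=d]
    by simp
  then show ?thesis
    using g_xi_pos[OF assms] inner_formD(2)[OF inner_g[OF assms], of "(a, 0)" "(0, 1)"]
    unfolding lift_def H_def c_def d_def by (simp add: field_simps)
qed

lemma lift_linear: "w \<in> S \<times> T \<Longrightarrow> linear (lift w)"
proof -
  assume w: "w \<in> S \<times> T"
  have "g \<kappa> w (0, 1) (a + b, 0) = g \<kappa> w (0, 1) (a, 0) + g \<kappa> w (0, 1) (b, 0)" for a b :: "real^4"
    using bil_g(2)[OF w, of "(0, 1)" "(a, 0)" "(b, 0)"] by simp
  moreover have "g \<kappa> w (0, 1) (r *\<^sub>R a, 0) = r * g \<kappa> w (0, 1) (a, 0)" for r and a :: "real^4"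
    using bil_g(4)[OF w, of "(0, 1)" r "(a, 0)"] by simp
  ultimately show ?thesis
    by (auto intro!: linearI simp: lift_def add_divide_distrib diff_divide_distrib)
qed

lemma inner_H: "w \<in> S \<times> T \<Longrightarrow> inner_form (H w)"
proof -
  assume w: "w \<in> S \<times> T"
  have "bilinear (H w)"
    unfolding bilinear_def g_lift[OF w, symmetric]
    using lift_linear[OF w] by (auto intro!: linearI simp: linear_add linear_cmul bil_g[OF w])
  moreover have "lift w a \<noteq> 0" if "a \<noteq> 0" for a using that by (simp add: lift_def zero_prod_def)
  ultimately show ?thesis
    unfolding inner_form_def using inner_formD(2,3)[OF inner_g[OF w]] g_lift[OF w, symmetric] by metis
qed

lemma smooth_H: "smooth_on (S \<times> T) (\<lambda>w. H w a b)"
  unfolding H_def by (intro smooth_intros open_V smooth_g) (use g_xi_pos in force)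

lemma quotient_metric:
  assumes "w \<in> S \<times> T"
  shows "quotient_metric g \<xi> \<kappa> (fst w) a b = H w a b"
  unfolding quotient_metric_def
proof (rule the_equality)
  obtain x t where w: "w = (x, t)" by (cases w)
  show *: "\<forall>t. (fst w, t) \<in> fst \<kappa> \<longrightarrow> H w a b =
      g \<kappa> (fst w, t) (horizontal_lift g \<xi> \<kappa> (fst w, t) a) (horizontal_lift g \<xi> \<kappa> (fst w, t) b)"
  proof (intro allI impI)
    fix t' assume "(fst w, t') \<in> fst \<kappa>"
    then have x: "(x, t') \<in> S \<times> T" "(x, t) \<in> S \<times> T" using assms by (auto simp: w domain)
    have "H (x, t') a b = H (x, t) a b" unfolding H_def g_leaf[OF x] ..
    then show "H w a b =
      g \<kappa> (fst w, t') (horizontal_lift g \<xi> \<kappa> (fst w, t') a) (horizontal_lift g \<xi> \<kappa> (fst w, t') b)"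
      using x by (simp add: w horizontal_lift g_lift)
  qed
  show "r = H w a b" if "\<forall>t. (fst w, t) \<in> fst \<kappa> \<longrightarrow>
      r = g \<kappa> (fst w, t) (horizontal_lift g \<xi> \<kappa> (fst w, t) a) (horizontal_lift g \<xi> \<kappa> (fst w, t) b)" for r
    using that * assms unfolding domain(1) by (metis prod.collapse)
qed

text \<open>\<open>H\<close> is constant along leaves, so its derivative factors through
  \<open>fst\<close>. Derivatives on the leaf space can thus be computed in the five-dimensional
  chart.\<close>

lemma quotient_metric_differentiable:
  assumes "w \<in> S \<times> T"
  shows "(\<lambda>x. quotient_metric g \<xi> \<kappa> x a b) differentiable (at (fst w))"
    "frechet_derivative (\<lambda>x. quotient_metric g \<xi> \<kappa> x a b) (at (fst w)) (fst v) =
       frechet_derivative (\<lambda>z. H z a b) (at w) v"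
proof -
  let ?q = "\<lambda>x. quotient_metric g \<xi> \<kappa> x a b"
  let ?D = "frechet_derivative (\<lambda>z. H z a b) (at w)"
  have w: "w = (fst w, snd w)" "fst w \<in> S" "snd w \<in> T" using assms by auto
  note d = smooth_on_deriv[OF smooth_H assms, of a b]
  have "((\<lambda>x. H (x, snd w) a b) has_derivative (\<lambda>r. ?D (r, 0))) (at (fst w))"
    by (rule has_derivative_compose[where f="\<lambda>x. (x, snd w)" and g="\<lambda>z. H z a b"])
      (use d w(1) in \<open>auto intro!: derivative_eq_intros\<close>)
  then have q: "(?q has_derivative (\<lambda>r. ?D (r, 0))) (at (fst w))"
    by (rule has_derivative_transform_within_open[OF _ domain(2) w(2)])
      (use quotient_metric[of "(_, snd w)"] w(3) in auto)
  then show "?q differentiable (at (fst w))" using differentiable_def by blast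
  have "((\<lambda>z. ?q (fst z)) has_derivative (\<lambda>v. ?D (fst v, 0))) (at w)"
    by (rule has_derivative_compose[where f=fst and g="?q", OF _ q]) (auto intro!: derivative_eq_intros)
  then have "((\<lambda>z. H z a b) has_derivative (\<lambda>v. ?D (fst v, 0))) (at w)"
    by (rule has_derivative_transform_within_open[OF _ open_V assms]) (simp add: quotient_metric)
  then have "?D = (\<lambda>v. ?D (fst v, 0))" by (rule frechet_derivative_eq)
  then have "?D v = ?D (fst v, 0)" by metis
  then show "frechet_derivative ?q (at (fst w)) (fst v) = ?D v"
    using frechet_derivative_eq[OF q] by metis
qed

text \<open>For empty \<open>T\<close> every real number satisfies the condition in
  \<open>quotient_metric\<close>, so the description has no definite value and the domain has to be
  empty too.\<close>

sublocale q: metric_on "quotient_metric g \<xi> \<kappa>" "if T = {} then {} else S"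
proof
  show "open (if T = {} then {} else S)" using domain by simp
  fix x assume x: "x \<in> (if T = {} then {} else S)"
  then obtain t where "t \<in> T" "x \<in> S" by (auto split: if_splits)
  then have xt: "(x, t) \<in> S \<times> T" by simp
  show "inner_form (quotient_metric g \<xi> \<kappa> x)"
    using inner_H[OF xt] quotient_metric[OF xt] by (simp add: inner_form_def[of "H _"] inner_form_def[of "quotient_metric _ _ _ _"] bilinear_def)
  show "(\<lambda>z. quotient_metric g \<xi> \<kappa> z a b) differentiable at x" for a b
    using quotient_metric_differentiable(1)[OF xt] by simp
qed

lemma fst_in: "w \<in> S \<times> T \<Longrightarrow> fst w \<in> (if T = {} then {} else S)" by auto

sublocale m: metric_on "g \<kappa>" "S \<times> T"
  by standard (auto intro: open_V inner_g smooth_on_differentiable[OF smooth_g])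

text \<open>This is \<omega> = d\<eta> / 2 on constant fields: in the Koszul formula for the
  covariant derivative of \<xi> the term differentiated along \<xi> drops out by
  \<open>killing\<close>, and the other two form the exterior derivative.\<close>

lemma omega_eq:
  assumes "w \<in> S \<times> T"
  shows "omega g \<xi> \<kappa> w a b = (m.dh w a (0, 1) b - m.dh w b (0, 1) a) / 2"
proof -
  have "(\<xi> \<kappa> has_derivative (\<lambda>v. 0)) (at w)"
    by (rule has_derivative_transform_within_open[OF has_derivative_const[of "(0, 1)"] open_V assms])
      (simp add: reeb)
  then have "omega g \<xi> \<kappa> w a b = - g \<kappa> w a (christoffel (g \<kappa>) w b (0, 1))"
    by (simp add: omega_def Phi_def reeb[OF assms] frechet_derivative_eq bil_g[OF assms])
  then show ?thesis
    using m.koszul[OF assms, of b "(0, 1)" a] killing[OF assms, of b a]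
      inner_formD(2)[OF inner_g[OF assms], of a] m.dh_sym[OF assms, of a b]
    by (simp add: m.dh_def)
qed

lemma omega_H_eq:
  assumes "w \<in> S \<times> T"
  shows "omega_H g \<xi> \<kappa> w a b = (m.dh w (lift w a) (0, 1) (lift w b) - m.dh w (lift w b) (0, 1) (lift w a)) / 2"
  unfolding omega_H_def omega_eq[OF assms] horizontal_lift[OF assms] ..

lemma two_form_omega_H:
  assumes "w \<in> S \<times> T"
  shows "two_form (omega_H g \<xi> \<kappa> w)"
proof -
  note l = m.dh_simps[OF assms] linear_add[OF lift_linear[OF assms]] linear_cmul[OF lift_linear[OF assms]]
  have "bilinear (omega_H g \<xi> \<kappa> w)"
    unfolding bilinear_def omega_H_eq[OF assms]
    by (auto intro!: linearI simp: l field_simps)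
  then show ?thesis by (simp add: two_form_def omega_H_eq[OF assms])
qed

abbreviation \<Gamma> :: "E5 \<Rightarrow> E5 \<Rightarrow> real^4 \<Rightarrow> real^4" where
  "\<Gamma> w v \<equiv> christoffel (quotient_metric g \<xi> \<kappa>) (fst w) (fst v)"

abbreviation om :: "E5 \<Rightarrow> form2" where "om w \<equiv> omega_H g \<xi> \<kappa> w"

lemma oriented_onb_iff:
  assumes "w \<in> S \<times> T"
  shows "oriented_onb g \<xi> \<kappa> w e \<longleftrightarrow> oriented (H w) (om w) e"
  unfolding oriented_onb_def oriented_def orthonormal_def wedge_def quotient_metric[OF assms] Let_def
  by (simp add: algebra_simps)

lemma asd_eq:
  assumes "w \<in> S \<times> T"
  shows "asd g \<xi> \<kappa> w = asd_forms (H w) (om w)"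
proof -
  have "two_form (\<lambda>a b. - \<beta> a b)" if "two_form \<beta>" for \<beta>
    using that by (auto simp: two_form_def bilinear_def intro: linear_compose_neg)
  then show ?thesis
    unfolding asd_def asd_forms_def hodge_star_of_def oriented_onb_iff[OF assms] by force
qed

end

subsection \<open>Local frames\<close>

lemma smooth_on_bilinear_eval:
  fixes B :: "'z::real_normed_vector \<Rightarrow> 'e::euclidean_space \<Rightarrow> 'f::euclidean_space \<Rightarrow> real"
  assumes "open W" "\<And>z. z \<in> W \<Longrightarrow> bilinear (B z)" "\<And>a b. smooth_on W (\<lambda>z. B z a b)"
    "smooth_on W u" "smooth_on W v"
  shows "smooth_on W (\<lambda>z. B z (u z) (v z))"
proof -
  have "smooth_on W (\<lambda>z. \<Sum>i\<in>Basis. \<Sum>j\<in>Basis. (u z \<bullet> i) * (v z \<bullet> j) * B z i j)"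
    by (intro smooth_intros assms smooth_on_linear_comp[OF bounded_linear_inner_left])
  then show ?thesis
  proof (rule smooth_on_cong[OF _ assms(1)])
    fix z assume "z \<in> W"
    note b = assms(2)[OF this]
    have "B z (u z) (v z) = B z (\<Sum>i\<in>Basis. (u z \<bullet> i) *\<^sub>R i) (\<Sum>j\<in>Basis. (v z \<bullet> j) *\<^sub>R j)"
      by (simp add: euclidean_representation)
    also have "\<dots> = (\<Sum>i\<in>Basis. \<Sum>j\<in>Basis. (u z \<bullet> i) * (v z \<bullet> j) * B z i j)"
    proof -
      have "linear (B z a)" "linear (\<lambda>a. B z a c)" for a c using b by (auto simp: bilinear_def)
      then show ?thesis by (subst sum.swap) (simp add: linear_sum[of "B z _"] linear_sum[of "\<lambda>a. B z a _"]
            bilinear_lmul[OF b] bilinear_rmul[OF b] sum_distrib_left mult_ac)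
    qed
    finally show "(\<Sum>i\<in>Basis. \<Sum>j\<in>Basis. (u z \<bullet> i) * (v z \<bullet> j) * B z i j) = B z (u z) (v z)" by simp
  qed
qed

text \<open>The constant vectors \<open>e i\<close> are orthonormalised near w. At w they are
  orthonormal already, so each residue \<open>F\<close> equals \<open>e k\<close> there; hence the
  frame takes the prescribed values at w, and w survives the restriction to the set where the
  residue has positive length.\<close>

lemma gram_schmidt:
  fixes h :: "'z::real_normed_vector \<Rightarrow> 'e::euclidean_space \<Rightarrow> 'e \<Rightarrow> real" and e :: "'i \<Rightarrow> 'e"
  assumes "open V" "w \<in> V" "\<And>z. z \<in> V \<Longrightarrow> inner_form (h z)" "\<And>a b. smooth_on V (\<lambda>z. h z a b)"
    "finite I" "\<forall>i\<in>I. \<forall>j\<in>I. h w (e i) (e j) = (if i = j then 1 else 0)"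
  shows "\<exists>W E. open W \<and> w \<in> W \<and> W \<subseteq> V \<and> (\<forall>i\<in>I. smooth_on W (\<lambda>z. E z i) \<and> E w i = e i) \<and>
     (\<forall>z\<in>W. \<forall>i\<in>I. \<forall>j\<in>I. h z (E z i) (E z j) = (if i = j then 1 else 0))"
  using assms(5,6)
proof (induction I rule: finite_induct)
  case empty
  then show ?case using assms(1,2) by auto
next
  case (insert k I)
  have ih: "\<forall>i\<in>I. \<forall>j\<in>I. h w (e i) (e j) = (if i = j then 1 else 0)" using insert.prems by simp
  obtain W E where W: "open W" "w \<in> W" "W \<subseteq> V"
    and E: "\<And>i. i \<in> I \<Longrightarrow> smooth_on W (\<lambda>z. E z i)" "\<And>i. i \<in> I \<Longrightarrow> E w i = e i"
    and on: "\<And>z i j. z \<in> W \<Longrightarrow> i \<in> I \<Longrightarrow> j \<in> I \<Longrightarrow> h z (E z i) (E z j) = (if i = j then 1 else 0)"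
    using insert.IH[OF ih] by blast
  have hV: "inner_form (h z)" if "z \<in> W" for z using that W assms(3) by auto
  note bil = inner_formD(1)[OF hV]
  have sm: "smooth_on W (\<lambda>z. h z a b)" for a b using smooth_on_subset[OF assms(4) W(3)] .
  have sc: "smooth_on W (\<lambda>z. h z (u z) (v z))" if "smooth_on W u" "smooth_on W v" for u v
    by (rule smooth_on_bilinear_eval[OF W(1) bil sm that])
  define F where "F z = e k - (\<Sum>i\<in>I. h z (e k) (E z i) *\<^sub>R E z i)" for z
  have sF: "smooth_on W F"
    unfolding F_def by (intro smooth_on_diff smooth_on_sum smooth_on_scaleR sc smooth_on_const W(1) E(1))
  have F0: "F w = e k"
  proof -
    have "h w (e k) (E w i) = 0" if "i \<in> I" for i
      using insert.prems insert.hyps that E(2)[OF that] by auto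
    then show ?thesis by (simp add: F_def)
  qed
  have FE: "h z (F z) (E z j) = 0" "h z (E z j) (F z) = 0" if "z \<in> W" "j \<in> I" for z j
  proof -
    have "(\<Sum>i\<in>I. h z (e k) (E z i) * h z (E z i) (E z j)) = (\<Sum>i\<in>I. if i = j then h z (e k) (E z j) else 0)"
      by (rule sum.cong) (use that on in auto)
    then show 1: "h z (F z) (E z j) = 0"
      using that insert.hyps
      by (simp add: F_def bilinearD[OF bil[OF that(1)]] bilinear_sums[OF bil[OF that(1)]])
    show "h z (E z j) (F z) = 0" using 1 inner_formD(2)[OF hV[OF that(1)]] by metis
  qed
  define N where "N z = h z (F z) (F z)" for z
  have sN: "smooth_on W N" unfolding N_def by (intro sc sF)
  define W' where "W' = W \<inter> N -` {0<..}"
  have W': "open W'" unfolding W'_def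
    by (rule continuous_open_preimage[OF smooth_on_continuous[OF sN] W(1)]) auto
  have sub: "W' \<subseteq> W" by (auto simp: W'_def)
  have Nw: "N w = 1" using insert.prems by (simp add: N_def F0)
  have w: "w \<in> W'" using W Nw by (simp add: W'_def)
  have Npos: "N z > 0" if "z \<in> W'" for z using that by (simp add: W'_def)
  define E' where "E' z i = (if i = k then (1 / sqrt (N z)) *\<^sub>R F z else E z i)" for z i
  have sN': "smooth_on W' N" "smooth_on W' F" using smooth_on_subset[OF _ sub] sN sF by auto
  have Nn: "sqrt (N z) \<noteq> 0" if "z \<in> W'" for z using Npos[OF that] by simp
  have "smooth_on W' (\<lambda>z. (1 / sqrt (N z)) *\<^sub>R F z)"
    by (intro smooth_on_scaleR smooth_on_divide smooth_on_sqrt smooth_on_const W' sN' Npos Nn)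
  then have "smooth_on W' (\<lambda>z. E' z i) \<and> E' w i = e i" if "i \<in> insert k I" for i
    using that smooth_on_subset[OF E(1) sub] E(2) Nw F0 by (auto simp: E'_def)
  moreover have "h z (E' z i) (E' z j) = (if i = j then 1 else 0)"
    if "z \<in> W'" "i \<in> insert k I" "j \<in> insert k I" for z i j
  proof -
    have z: "z \<in> W" using that sub by auto
    have "h z (E' z k) (E' z k) = 1"
      using Npos[OF that(1)] by (simp add: E'_def bilinearD[OF bil[OF z]] flip: N_def)
    then show ?thesis
      using that insert.hyps on[OF z] FE[OF z] by (auto simp: E'_def bilinearD[OF bil[OF z]])
  qed
  ultimately show ?case using W' w sub W(3) by (intro exI[of _ W'] exI[of _ E']) auto
qed

lemma orthonormal_exists:
  fixes h :: form2
  assumes "inner_form h"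
  shows "\<exists>e :: 4 \<Rightarrow> real^4. orthonormal h e"
proof -
  note bil = inner_formD(1)[OF assms]
  have ex: "\<exists>e. \<forall>i\<in>I. \<forall>j\<in>I. h (e i) (e j) = (if i = j then 1 else 0)" for I :: "4 set"
  proof (induction I rule: finite_induct[OF finite])
    case 1
    then show ?case by simp
  next
    case (2 k I)
    then obtain e where e: "\<And>i j. i \<in> I \<Longrightarrow> j \<in> I \<Longrightarrow> h (e i) (e j) = (if i = j then 1 else 0)" by blast
    have "card (e ` I) < DIM(real^4)"
    proof -
      have "card (e ` I) \<le> card I" by (simp add: card_image_le)
      also have "\<dots> < card (UNIV :: 4 set)"
        by (rule psubset_card_mono) (use 2 in auto)
      finally show ?thesis by simp
    qed
    then have "span (e ` I) \<noteq> UNIV"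
      by (metis dim_UNIV dim_le_card' dim_span finite_imageI finite linorder_not_less)
    then obtain f where f: "f \<notin> span (e ` I)" by auto
    define F where "F = f - (\<Sum>i\<in>I. h f (e i) *\<^sub>R e i)"
    have "(\<Sum>i\<in>I. h f (e i) *\<^sub>R e i) \<in> span (e ` I)"
      by (intro span_sum span_scale span_base) auto
    then have "F \<noteq> 0" using f by (auto simp: F_def)
    then have N: "h F F > 0" using inner_formD(3)[OF assms] by blast
    have FE: "h F (e j) = 0" "h (e j) F = 0" if "j \<in> I" for j
    proof -
      have "(\<Sum>i\<in>I. h f (e i) * h (e i) (e j)) = (\<Sum>i\<in>I. if i = j then h f (e j) else 0)"
        by (rule sum.cong) (use that e in auto)
      then show 1: "h F (e j) = 0"
        using that 2 by (simp add: F_def bilinearD[OF bil] bilinear_sums[OF bil])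
      show "h (e j) F = 0" using 1 inner_formD(2)[OF assms] by metis
    qed
    show ?case
      by (rule exI[of _ "\<lambda>i. if i = k then (1 / sqrt (h F F)) *\<^sub>R F else e i"])
        (use N FE e 2 in \<open>auto simp: bilinearD[OF bil]\<close>)
  qed
  show ?thesis using ex[of UNIV] by (auto simp: orthonormal_def)
qed

lemma form2_eval_smooth:
  assumes "open W" "\<And>z. z \<in> W \<Longrightarrow> two_form (\<beta> z)" "\<And>a b. smooth_on W (\<lambda>z. \<beta> z a b)"
    "\<And>i. smooth_on W (\<lambda>z. E z i)"
  shows "smooth_on W (\<lambda>z. \<beta> z (E z i) (E z j))"
  by (rule smooth_on_bilinear_eval[OF assms(1) two_formD(1)[OF assms(2)] assms(3,4,4)])

lemma smooth_asd_basis: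
  assumes "open W" "\<And>i a. smooth_on W (\<lambda>z. \<epsilon> z i a)"
  shows "smooth_on W (\<lambda>z. asd_basis (\<epsilon> z) k a b)"
proof -
  have "smooth_on W (\<lambda>z. x z / sqrt 2)" if "smooth_on W x" for x
    using smooth_on_mult[OF assms(1) that smooth_on_const[OF assms(1), of "1 / sqrt 2"]] by simp
  then show ?thesis
    unfolding asd_basis_def wedge1_def
    by (cases "k = 1"; cases "k = 2") (simp_all add: smooth_on_add smooth_on_diff smooth_on_mult assms)
qed

text \<open>The matrix, column by column, of the covariant derivative of the anti-self-dual basis forms
  in terms of the connection forms \<open>\<omega>\<close> of the coframe.\<close>

definition asd_connection :: "(4 \<Rightarrow> 4 \<Rightarrow> real) \<Rightarrow> 3 \<Rightarrow> real^3" where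
  "asd_connection \<omega> k =
     (let A1 = \<omega> 1 2 - \<omega> 3 4; A2 = \<omega> 1 3 + \<omega> 2 4; A3 = \<omega> 1 4 - \<omega> 2 3
      in if k = 1 then vector [0, A3, - A2] else if k = 2 then vector [- A3, 0, A1] else vector [A2, - A1, 0])"

text \<open>The last hypothesis says that the covariant derivative of the i-th coframe form is minus
  the sum of \<open>\<omega> i j\<close> times the j-th. Under the Leibniz rule only three
  combinations of the six connection forms act on the anti-self-dual basis, as so(4) splits into two
  copies of so(3).\<close>

lemma transverse_nabla_asd_basis:
  assumes d\<epsilon>: "\<And>i a. ((\<lambda>z. \<epsilon> z i a) has_derivative (\<lambda>v. d\<epsilon> v i a)) (at w)"
    and dc: "\<And>k. ((\<lambda>z. c z $ k) has_derivative (\<lambda>v. dc v $ k)) (at w)"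
    and skew: "\<And>i j. \<omega> i j = - \<omega> j i"
    and \<omega>: "\<And>i a. d\<epsilon> v i a = \<epsilon> w i (christoffel (quotient_metric g \<xi> \<kappa>) (fst w) (fst v) a)
        - (\<Sum>j\<in>UNIV. \<omega> i j * \<epsilon> w j a)"
  shows "transverse_nabla g \<xi> \<kappa> (\<lambda>z. combine (asd_basis (\<epsilon> z)) (c z)) w v =
    combine (asd_basis (\<epsilon> w)) (dc v + (\<Sum>k\<in>UNIV. c w $ k *\<^sub>R asd_connection \<omega> k))"
proof (intro ext)
  fix a b
  define \<Gamma> where "\<Gamma> = christoffel (quotient_metric g \<xi> \<kappa>) (fst w) (fst v)"
  have sk: "\<omega> i i = 0" "\<omega> 2 1 = - \<omega> 1 2" "\<omega> 3 1 = - \<omega> 1 3" "\<omega> 4 1 = - \<omega> 1 4" "\<omega> 3 2 = - \<omega> 2 3"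
    "\<omega> 4 2 = - \<omega> 2 4" "\<omega> 4 3 = - \<omega> 3 4" for i
    using skew[of i i] skew[of 2 1] skew[of 3 1] skew[of 4 1] skew[of 3 2] skew[of 4 2] skew[of 4 3] by auto
  define s where "s = 1 / sqrt (2::real)"
  have B: "combine (asd_basis \<delta>) x a b = s * (x $ 1 * (wedge1 (\<delta> 1) (\<delta> 2) a b - wedge1 (\<delta> 3) (\<delta> 4) a b)
     + x $ 2 * (wedge1 (\<delta> 1) (\<delta> 3) a b + wedge1 (\<delta> 2) (\<delta> 4) a b)
     + x $ 3 * (wedge1 (\<delta> 1) (\<delta> 4) a b - wedge1 (\<delta> 2) (\<delta> 3) a b))" for \<delta> x a b
    by (simp add: combine_def sum_3 asd_basis_def s_def divide_inverse algebra_simps)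
  have dw: "((\<lambda>z. wedge1 (\<epsilon> z i) (\<epsilon> z j) a b) has_derivative
     (\<lambda>v. wedge1 (d\<epsilon> v i) (\<epsilon> w j) a b + wedge1 (\<epsilon> w i) (d\<epsilon> v j) a b)) (at w)" for i j
    unfolding wedge1_def by (auto intro!: derivative_eq_intros d\<epsilon> simp: algebra_simps)
  define D where "D v = s * ((dc v $ 1 * (wedge1 (\<epsilon> w 1) (\<epsilon> w 2) a b - wedge1 (\<epsilon> w 3) (\<epsilon> w 4) a b)
     + dc v $ 2 * (wedge1 (\<epsilon> w 1) (\<epsilon> w 3) a b + wedge1 (\<epsilon> w 2) (\<epsilon> w 4) a b)
     + dc v $ 3 * (wedge1 (\<epsilon> w 1) (\<epsilon> w 4) a b - wedge1 (\<epsilon> w 2) (\<epsilon> w 3) a b))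
     + (c w $ 1 * (wedge1 (d\<epsilon> v 1) (\<epsilon> w 2) a b + wedge1 (\<epsilon> w 1) (d\<epsilon> v 2) a b - wedge1 (d\<epsilon> v 3) (\<epsilon> w 4) a b - wedge1 (\<epsilon> w 3) (d\<epsilon> v 4) a b)
     + c w $ 2 * (wedge1 (d\<epsilon> v 1) (\<epsilon> w 3) a b + wedge1 (\<epsilon> w 1) (d\<epsilon> v 3) a b + wedge1 (d\<epsilon> v 2) (\<epsilon> w 4) a b + wedge1 (\<epsilon> w 2) (d\<epsilon> v 4) a b)
     + c w $ 3 * (wedge1 (d\<epsilon> v 1) (\<epsilon> w 4) a b + wedge1 (\<epsilon> w 1) (d\<epsilon> v 4) a b - wedge1 (d\<epsilon> v 2) (\<epsilon> w 3) a b - wedge1 (\<epsilon> w 2) (d\<epsilon> v 3) a b)))" for v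
  have "((\<lambda>z. combine (asd_basis (\<epsilon> z)) (c z) a b) has_derivative D) (at w)"
    unfolding B D_def by (auto intro!: derivative_eq_intros dw dc simp: algebra_simps)
  then have "frechet_derivative (\<lambda>z. combine (asd_basis (\<epsilon> z)) (c z) a b) (at w) v = D v"
    by (simp add: frechet_derivative_eq)
  then have "transverse_nabla g \<xi> \<kappa> (\<lambda>z. combine (asd_basis (\<epsilon> z)) (c z)) w v a b =
     D v - combine (asd_basis (\<epsilon> w)) (c w) (\<Gamma> a) b - combine (asd_basis (\<epsilon> w)) (c w) a (\<Gamma> b)"
    by (simp add: transverse_nabla_def \<Gamma>_def Let_def)
  also have "\<dots> = combine (asd_basis (\<epsilon> w)) (dc v + (\<Sum>k\<in>UNIV. c w $ k *\<^sub>R asd_connection \<omega> k)) a b"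
    unfolding B D_def wedge1_def \<omega> \<Gamma>_def[symmetric] sum_4 sk
    by (simp add: sum_3 asd_connection_def Let_def) algebra
  finally show "transverse_nabla g \<xi> \<kappa> (\<lambda>z. combine (asd_basis (\<epsilon> z)) (c z)) w v a b =
     combine (asd_basis (\<epsilon> w)) (dc v + (\<Sum>k\<in>UNIV. c w $ k *\<^sub>R asd_connection \<omega> k)) a b" .
qed

section \<open>Smooth local frames and anti-self-dual sections in a foliated chart\<close>

context foliated_chart begin

lemma smooth_omega_H: "smooth_on (S \<times> T) (\<lambda>z. om z a b)"
proof -
  have 1: "bilinear (\<lambda>v b. m.dh z v (0, 1) b)" if "z \<in> S \<times> T" for z
    unfolding bilinear_def using m.dh_linear[OF that] by blast
  have 2: "smooth_on (S \<times> T) (\<lambda>z. m.dh z v (0, 1) b)" for v b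
    unfolding m.dh_def by (rule smooth_on_frechet_derivative[OF smooth_g])
  have 3: "smooth_on (S \<times> T) (\<lambda>z. lift z a)" for a
    unfolding lift_def
    by (intro smooth_on_Pair smooth_on_const smooth_on_divide smooth_on_minus open_V smooth_g) (use g_xi_pos in force)
  have "smooth_on (S \<times> T) (\<lambda>z. m.dh z (lift z a) (0, 1) (lift z b))" for a b
    by (rule smooth_on_bilinear_eval[where B="\<lambda>z v b. m.dh z v (0, 1) b", OF open_V 1 2 3 3])
  then have "smooth_on (S \<times> T) (\<lambda>z. (m.dh z (lift z a) (0, 1) (lift z b) - m.dh z (lift z b) (0, 1) (lift z a)) / 2)"
    by (intro smooth_on_divide smooth_on_diff smooth_on_const open_V) auto
  then show ?thesis by (rule smooth_on_cong[OF _ open_V]) (simp add: omega_H_eq)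
qed

lemma orthonormal_frame:
  fixes e :: "4 \<Rightarrow> real^4"
  assumes "w \<in> S \<times> T" "orthonormal (H w) e"
  shows "\<exists>W E. open W \<and> w \<in> W \<and> W \<subseteq> S \<times> T \<and> (\<forall>i. smooth_on W (\<lambda>z. E z i)) \<and> E w = e \<and>
     (\<forall>z\<in>W. orthonormal (H z) (E z))"
proof -
  have "\<exists>W E. open W \<and> w \<in> W \<and> W \<subseteq> S \<times> T \<and> (\<forall>i\<in>UNIV. smooth_on W (\<lambda>z. E z i) \<and> E w i = e i) \<and>
     (\<forall>z\<in>W. \<forall>i\<in>UNIV. \<forall>j\<in>UNIV. H z (E z i) (E z j) = (if i = j then 1 else 0))"
    by (rule gram_schmidt[OF open_V assms(1) inner_H smooth_H])
      (use assms in \<open>auto simp: orthonormal_def\<close>)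
  then obtain W E where "open W" "w \<in> W" "W \<subseteq> S \<times> T" "\<And>i. smooth_on W (\<lambda>z. E z i)" "\<And>i. E w i = e i"
    "\<And>z i j. z \<in> W \<Longrightarrow> H z (E z i) (E z j) = (if i = j then 1 else 0)" by (metis UNIV_I)
  then show ?thesis unfolding orthonormal_def by (intro exI[of _ W] exI[of _ E]) auto
qed

lemma smooth_coframe:
  assumes "open W" "W \<subseteq> S \<times> T" "\<And>i. smooth_on W (\<lambda>z. E z i)"
  shows "smooth_on W (\<lambda>z. H z (E z i) a)"
  by (rule smooth_on_bilinear_eval[OF assms(1) _ _ assms(3) smooth_on_const[OF assms(1)]])
    (use assms inner_formD(1)[OF inner_H] smooth_on_subset[OF smooth_H] in blast)+

lemma smooth_wedge_om:
  assumes "open W" "W \<subseteq> S \<times> T" "\<And>i. smooth_on W (\<lambda>z. E z i)"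
  shows "smooth_on W (\<lambda>z. wedge (om z) (om z) (E z))"
proof -
  have "smooth_on W (\<lambda>z. om z (E z i) (E z j))" for i j
    by (rule form2_eval_smooth[OF assms(1) two_form_omega_H smooth_on_subset[OF smooth_omega_H assms(2)] assms(3)])
      (use assms(2) in auto)
  then show ?thesis
    unfolding wedge_def by (intro smooth_on_add smooth_on_diff smooth_on_mult assms(1))
qed

lemma oriented_frame:
  assumes "w \<in> S \<times> T" "oriented (H w) (om w) e"
  shows "\<exists>W E. open W \<and> w \<in> W \<and> W \<subseteq> S \<times> T \<and> (\<forall>i. smooth_on W (\<lambda>z. E z i)) \<and> E w = e \<and>
     (\<forall>z\<in>W. oriented (H z) (om z) (E z))"
proof -
  obtain W E where W: "open W" "w \<in> W" "W \<subseteq> S \<times> T" and E: "\<And>i. smooth_on W (\<lambda>z. E z i)" "E w = e"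
    "\<And>z. z \<in> W \<Longrightarrow> orthonormal (H z) (E z)"
    using orthonormal_frame[OF assms(1)] assms(2) unfolding oriented_def by blast
  define W' where "W' = W \<inter> (\<lambda>z. wedge (om z) (om z) (E z)) -` {0<..}"
  have W': "open W'" unfolding W'_def
    by (rule continuous_open_preimage[OF smooth_on_continuous[OF smooth_wedge_om[OF W(1,3) E(1)]] W(1)]) auto
  have sub: "W' \<subseteq> W" by (auto simp: W'_def)
  have "w \<in> W'" using W assms(2) E(2) by (simp add: W'_def oriented_def)
  moreover have "oriented (H z) (om z) (E z)" if "z \<in> W'" for z
    using that E(3) by (auto simp: W'_def oriented_def)
  ultimately show ?thesis
    using W' sub W(3) E(2) smooth_on_subset[OF E(1) sub] by (intro exI[of _ W'] exI[of _ E]) auto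
qed

text \<open>The covariant derivatives \<open>n i\<close> of the coframe forms are linear, so they
  expand in the coframe, and metric compatibility makes the coefficient matrix skew. The frame may
  vary along the leaf as well, hence the derivative in all five directions.\<close>

lemma connection_forms:
  fixes E :: "E5 \<Rightarrow> 4 \<Rightarrow> real^4"
  assumes "open W" "w \<in> W" "W \<subseteq> S \<times> T" "\<And>i. smooth_on W (\<lambda>z. E z i)" "\<And>z. z \<in> W \<Longrightarrow> orthonormal (H z) (E z)"
  shows "\<exists>\<omega>. (\<forall>i j. \<omega> i j = - \<omega> j i) \<and> (\<forall>i a. frechet_derivative (\<lambda>z. H z (E z i) a) (at w) v =
     H w (E w i) (\<Gamma> w v a) - (\<Sum>j\<in>UNIV. \<omega> i j * H w (E w j) a))"
proof -
  have w: "w \<in> S \<times> T" using assms by auto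
  have lG: "linear (\<Gamma> w v)" by (rule q.christoffel_linear[OF fst_in[OF w]])
  note bil = bilinearD[OF inner_formD(1)[OF inner_H]]
  define d where "d i a = frechet_derivative (\<lambda>z. H z (E z i) a) (at w)" for i a
  have d: "((\<lambda>z. H z (E z i) a) has_derivative d i a) (at w)" for i a
    unfolding d_def by (rule smooth_on_deriv[OF smooth_coframe[OF assms(1,3,4)] assms(2)])
  have d_eqI: "d i a v = f' v" if "(f has_derivative f') (at w)" "\<And>z. z \<in> W \<Longrightarrow> f z = H z (E z i) a" for i a f f'
    unfolding d_def
    using frechet_derivative_eq[OF has_derivative_transform_within_open[OF that(1) assms(1,2)]] that(2) by simp
  define n where "n i a = d i a v - H w (E w i) (\<Gamma> w v a)" for i a
  have ln: "linear (n i)" for i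
  proof (rule linearI)
    fix a b r
    have "d i (a + b) v = d i a v + d i b v"
      by (rule d_eqI[OF has_derivative_add[OF d d]]) (use assms(3) bil in auto)
    then show "n i (a + b) = n i a + n i b" by (simp add: n_def linear_add[OF lG] bil[OF w])
    have "d i (r *\<^sub>R a) v = r *\<^sub>R d i a v"
      by (rule d_eqI[OF has_derivative_scaleR_right[OF d]]) (use assms(3) bil in auto)
    then show "n i (r *\<^sub>R a) = r *\<^sub>R n i a" by (simp add: n_def linear_cmul[OF lG] bil[OF w] algebra_simps)
  qed
  have expand: "a = (\<Sum>i\<in>UNIV. H z (E z i) a *\<^sub>R E z i)" if "z \<in> W" for z a
    using orthonormal_expand[OF inner_H assms(5)[OF that], of a] that assms(3) by auto
  have HE: "H z a b = (\<Sum>i\<in>UNIV. H z (E z i) a * H z (E z i) b)" if "z \<in> W" for z a b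
  proof -
    have z: "z \<in> S \<times> T" using that assms(3) by auto
    have "H z a b = H z (\<Sum>i\<in>UNIV. H z (E z i) a *\<^sub>R E z i) b" using expand[OF that, of a] by simp
    then show ?thesis by (simp add: bilinear_sums[OF inner_formD(1)[OF inner_H[OF z]]] bil[OF z])
  qed
  have D: "(\<Sum>i\<in>UNIV. H w (E w i) a * d i b v + d i a v * H w (E w i) b) = H w (\<Gamma> w v a) b + H w a (\<Gamma> w v b)" for a b
  proof -
    have "((\<lambda>z. \<Sum>i\<in>UNIV. H z (E z i) a * H z (E z i) b) has_derivative
       (\<lambda>v. \<Sum>i\<in>UNIV. H w (E w i) a * d i b v + d i a v * H w (E w i) b)) (at w)"
      by (intro has_derivative_sum has_derivative_mult d)
    then have "((\<lambda>z. H z a b) has_derivative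
       (\<lambda>v. \<Sum>i\<in>UNIV. H w (E w i) a * d i b v + d i a v * H w (E w i) b)) (at w)"
      by (rule has_derivative_transform_within_open[OF _ assms(1,2)]) (simp add: HE[symmetric])
    then have "(\<Sum>i\<in>UNIV. H w (E w i) a * d i b v + d i a v * H w (E w i) b) = frechet_derivative (\<lambda>z. H z a b) (at w) v"
      by (simp add: frechet_derivative_eq)
    also have "\<dots> = q.dh (fst w) (fst v) a b"
      unfolding q.dh_def quotient_metric_differentiable(2)[OF w] ..
    also have "\<dots> = H w (\<Gamma> w v a) b + H w a (\<Gamma> w v b)"
      unfolding q.christoffel_compatible[OF fst_in[OF w]] quotient_metric[OF w] ..
    finally show ?thesis .
  qed
  have on: "H w (E w i) (E w j) = (if i = j then 1 else 0)" for i j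
    using assms(5)[OF assms(2)] by (simp add: orthonormal_def)
  have nn: "n k (E w j) + n j (E w k) = 0" for j k
  proof -
    have "(\<Sum>i\<in>UNIV. H w (E w i) a * n i b + n i a * H w (E w i) b) = 0" for a b
      using D[of a b] HE[OF assms(2), of "\<Gamma> w v a" b] HE[OF assms(2), of a "\<Gamma> w v b"]
      by (simp add: n_def algebra_simps sum.distrib sum_subtractf)
    from this[of "E w j" "E w k"] show ?thesis
      by (simp add: on sum.distrib if_distrib[of "\<lambda>x. x * _"] if_distrib[of "\<lambda>x. _ * x"] cong: if_cong)
  qed
  have ne: "n i a = (\<Sum>j\<in>UNIV. H w (E w j) a * n i (E w j))" for i a
  proof -
    have "n i a = n i (\<Sum>j\<in>UNIV. H w (E w j) a *\<^sub>R E w j)" using expand[OF assms(2), of a] by simp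
    then show ?thesis by (simp add: linear_sum[OF ln] linear_cmul[OF ln])
  qed
  show ?thesis
  proof (intro exI[of _ "\<lambda>i j. - n i (E w j)"] conjI allI)
    show "- n i (E w j) = - (- n j (E w i))" for i j using nn[of i j] by simp
    show "frechet_derivative (\<lambda>z. H z (E z i) a) (at w) v =
       H w (E w i) (\<Gamma> w v a) - (\<Sum>j\<in>UNIV. - n i (E w j) * H w (E w j) a)" for i a
    proof -
      have "(\<Sum>j\<in>UNIV. - n i (E w j) * H w (E w j) a) = - n i a"
        unfolding ne[of i a] by (simp add: sum_negf mult.commute)
      then show ?thesis unfolding n_def[of i a] by (simp add: d_def)
    qed
  qed
qed

lemma asd_section_coefficients:
  assumes "open W" "W \<subseteq> S \<times> T" "\<And>i. smooth_on W (\<lambda>z. E z i)" "\<And>z. z \<in> W \<Longrightarrow> oriented (H z) (om z) (E z)"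
    "asd_section g \<xi> \<kappa> W \<beta>"
  shows "\<exists>c. (\<forall>k. smooth_on W (\<lambda>z. c z $ k)) \<and> (\<forall>z\<in>W. \<beta> z = combine (asd_basis (\<lambda>i. H z (E z i))) (c z))"
proof -
  define c :: "E5 \<Rightarrow> real^3" where "c z = vector [sqrt 2 * \<beta> z (E z 1) (E z 2), sqrt 2 * \<beta> z (E z 1) (E z 3), sqrt 2 * \<beta> z (E z 1) (E z 4)]" for z
  have sub: "z \<in> S \<times> T" if "z \<in> W" for z using that assms(2) by auto
  have b: "\<beta> z \<in> asd_forms (H z) (om z)" if "z \<in> W" for z
    using assms(5) that asd_eq[OF sub] unfolding asd_section_def by blast
  then have t: "two_form (\<beta> z)" if "z \<in> W" for z using that by (auto simp: asd_forms_def)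
  have s: "smooth_on W (\<lambda>z. \<beta> z a b)" for a b using assms(5) unfolding asd_section_def by blast
  have "smooth_on W (\<lambda>z. sqrt 2 * \<beta> z (E z i) (E z j))" for i j
    by (rule smooth_on_mult[OF assms(1) smooth_on_const[OF assms(1)] form2_eval_smooth[OF assms(1) t s assms(3)]])
  then have "smooth_on W (\<lambda>z. c z $ k)" for k
    using exhaust_3[of k] by (auto simp: c_def)
  moreover have "\<beta> z = combine (asd_basis (\<lambda>i. H z (E z i))) (c z)" if "z \<in> W" for z
    unfolding c_def by (rule asd_combine[OF inner_H two_form_omega_H assms(4) b]) (use that sub in auto)
  ultimately show ?thesis by blast
qed

lemma asd_section_combine:
  assumes "open W" "W \<subseteq> S \<times> T" "\<And>i. smooth_on W (\<lambda>z. E z i)" "\<And>z. z \<in> W \<Longrightarrow> oriented (H z) (om z) (E z)"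
    "\<And>k. smooth_on W (\<lambda>z. c z $ k)"
  shows "asd_section g \<xi> \<kappa> W (\<lambda>z. combine (asd_basis (\<lambda>i. H z (E z i))) (c z))"
  unfolding asd_section_def
proof (intro conjI ballI allI)
  fix z assume "z \<in> W"
  then show "combine (asd_basis (\<lambda>i. H z (E z i))) (c z) \<in> asd g \<xi> \<kappa> z"
    using assms(2,4) asd_eq[of z] combine_in_asd[OF inner_H two_form_omega_H assms(4)] by auto
next
  show "smooth_on W (\<lambda>z. combine (asd_basis (\<lambda>i. H z (E z i))) (c z) a b)" for a b
    unfolding combine_def
    by (rule smooth_on_sum[OF assms(1) smooth_on_mult[OF assms(1,5) smooth_asd_basis[OF assms(1) smooth_coframe[OF assms(1-3)]]]])
qed

text \<open>Continuity arguments need sections, whereas the action of a gauge transformation is to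
  be determined on single forms. Constant coefficients in a local frame provide the
  extension.\<close>

lemma asd_section_extend:
  assumes "w \<in> S \<times> T" "oriented (H w) (om w) e" "\<beta>\<^sub>0 \<in> asd g \<xi> \<kappa> w"
  shows "\<exists>W \<beta>. open W \<and> w \<in> W \<and> W \<subseteq> S \<times> T \<and> asd_section g \<xi> \<kappa> W \<beta> \<and> \<beta> w = \<beta>\<^sub>0"
proof -
  obtain W E where W: "open W" "w \<in> W" "W \<subseteq> S \<times> T" and E: "\<And>i. smooth_on W (\<lambda>z. E z i)" "E w = e"
    "\<And>z. z \<in> W \<Longrightarrow> oriented (H z) (om z) (E z)"
    using oriented_frame[OF assms(1,2)] by blast
  obtain x where x: "\<beta>\<^sub>0 = combine (asd_basis (\<lambda>i. H w (e i))) x"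
    using asd_combine[OF inner_H two_form_omega_H assms(2)] assms(1,3) asd_eq by blast
  have "asd_section g \<xi> \<kappa> W (\<lambda>z. combine (asd_basis (\<lambda>i. H z (E z i))) x)"
    by (rule asd_section_combine[OF W(1,3) E(1,3) smooth_on_const[OF W(1)]])
  then show ?thesis using W x E(2) by (intro exI[of _ W] exI) auto
qed

lemma transverse_nabla_cong:
  assumes "open W" "w \<in> W" "\<And>z. z \<in> W \<Longrightarrow> \<beta> z = \<gamma> z" "\<And>a b. (\<lambda>z. \<beta> z a b) differentiable (at w)"
  shows "transverse_nabla g \<xi> \<kappa> \<beta> w v = transverse_nabla g \<xi> \<kappa> \<gamma> w v"
proof -
  have "frechet_derivative (\<lambda>z. \<beta> z a b) (at w) = frechet_derivative (\<lambda>z. \<gamma> z a b) (at w)" for a b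
    by (rule frechet_derivative_transform_within_open[OF assms(4,1,2)]) (simp add: assms(3))
  then show ?thesis using assms(2,3) by (simp add: transverse_nabla_def[abs_def])
qed

lemma transverse_nabla_section:
  assumes "open W" "w \<in> W" "W \<subseteq> S \<times> T" "\<And>i. smooth_on W (\<lambda>z. E z i)" "\<And>z. z \<in> W \<Longrightarrow> oriented (H z) (om z) (E z)"
    and "asd_section g \<xi> \<kappa> W \<beta>" "\<And>k. smooth_on W (\<lambda>z. c z $ k)"
    and "\<And>z. z \<in> W \<Longrightarrow> \<beta> z = combine (asd_basis (\<lambda>i. H z (E z i))) (c z)"
    and "\<And>i j. \<omega> i j = - \<omega> j i" "\<And>i a. frechet_derivative (\<lambda>z. H z (E z i) a) (at w) v =
     H w (E w i) (\<Gamma> w v a) - (\<Sum>j\<in>UNIV. \<omega> i j * H w (E w j) a)"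
  shows "transverse_nabla g \<xi> \<kappa> \<beta> w v = combine (asd_basis (\<lambda>i. H w (E w i)))
    ((\<chi> k. frechet_derivative (\<lambda>z. c z $ k) (at w) v) + (\<Sum>k\<in>UNIV. c w $ k *\<^sub>R asd_connection \<omega> k))"
proof -
  have "transverse_nabla g \<xi> \<kappa> \<beta> w v = transverse_nabla g \<xi> \<kappa> (\<lambda>z. combine (asd_basis (\<lambda>i. H z (E z i))) (c z)) w v"
    by (rule transverse_nabla_cong[OF assms(1,2,8) smooth_on_differentiable[OF _ assms(2)]])
      (use assms(6) in \<open>auto simp: asd_section_def\<close>)
  also have "\<dots> = combine (asd_basis (\<lambda>i. H w (E w i)))
    ((\<chi> k. frechet_derivative (\<lambda>z. c z $ k) (at w) v) + (\<Sum>k\<in>UNIV. c w $ k *\<^sub>R asd_connection \<omega> k))"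
  proof (rule transverse_nabla_asd_basis[where dc="\<lambda>v. \<chi> k. frechet_derivative (\<lambda>z. c z $ k) (at w) v"
          and d\<epsilon>="\<lambda>v i a. frechet_derivative (\<lambda>z. H z (E z i) a) (at w) v"])
    show "((\<lambda>z. H z (E z i) a) has_derivative frechet_derivative (\<lambda>z. H z (E z i) a) (at w)) (at w)" for i a
      by (rule smooth_on_deriv[OF smooth_coframe[OF assms(1,3,4)] assms(2)])
    show "((\<lambda>z. c z $ k) has_derivative (\<lambda>v. (\<chi> k. frechet_derivative (\<lambda>z. c z $ k) (at w) v) $ k)) (at w)" for k
      using smooth_on_deriv[OF assms(7,2), of k] by simp
    show "\<omega> i j = - \<omega> j i" for i j by (rule assms(9))
  qed (rule assms(10))
  finally show ?thesis .
qed

text \<open>Needed to show that the identity is covariantly constant: a gauge transformation known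
  to fix anti-self-dual forms can be evaluated on the derivative only if that is
  anti-self-dual.\<close>

lemma transverse_nabla_in_asd:
  assumes "open W" "w \<in> W" "W \<subseteq> S \<times> T" "asd_section g \<xi> \<kappa> W \<beta>" "oriented (H w) (om w) e"
  shows "transverse_nabla g \<xi> \<kappa> \<beta> w v \<in> asd g \<xi> \<kappa> w"
proof -
  have w: "w \<in> S \<times> T" using assms by auto
  obtain W1 E where W1: "open W1" "w \<in> W1" "W1 \<subseteq> S \<times> T" and E1: "\<And>i. smooth_on W1 (\<lambda>z. E z i)" "E w = e"
    "\<And>z. z \<in> W1 \<Longrightarrow> oriented (H z) (om z) (E z)"
    using oriented_frame[OF w assms(5)] by blast
  define W' where "W' = W \<inter> W1"
  have W': "open W'" "w \<in> W'" "W' \<subseteq> S \<times> T" and sub: "W' \<subseteq> W" "W' \<subseteq> W1"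
    using assms W1 by (auto simp: W'_def)
  have E: "\<And>i. smooth_on W' (\<lambda>z. E z i)" "\<And>z. z \<in> W' \<Longrightarrow> oriented (H z) (om z) (E z)"
    using smooth_on_subset[OF E1(1) sub(2)] E1(3) sub by auto
  have sec: "asd_section g \<xi> \<kappa> W' \<beta>"
    using assms(4) smooth_on_subset[OF _ sub(1)] sub(1) unfolding asd_section_def by blast
  obtain c where c: "\<And>k. smooth_on W' (\<lambda>z. c z $ k)" "\<And>z. z \<in> W' \<Longrightarrow> \<beta> z = combine (asd_basis (\<lambda>i. H z (E z i))) (c z)"
    using asd_section_coefficients[OF W'(1,3) E sec] by blast
  have on: "\<And>z. z \<in> W' \<Longrightarrow> orthonormal (H z) (E z)" using E(2) by (auto simp: oriented_def)
  obtain \<omega> where o: "\<And>i j. \<omega> i j = - \<omega> j i" "\<And>i a. frechet_derivative (\<lambda>z. H z (E z i) a) (at w) v =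
     H w (E w i) (\<Gamma> w v a) - (\<Sum>j\<in>UNIV. \<omega> i j * H w (E w j) a)"
    using connection_forms[OF W' E(1) on] by blast
  have "transverse_nabla g \<xi> \<kappa> \<beta> w v = combine (asd_basis (\<lambda>i. H w (E w i)))
    ((\<chi> k. frechet_derivative (\<lambda>z. c z $ k) (at w) v) + (\<Sum>k\<in>UNIV. c w $ k *\<^sub>R asd_connection \<omega> k))"
    by (rule transverse_nabla_section[where c=c and E=E, OF W' E sec c o])
  then show ?thesis
    unfolding asd_eq[OF w] by simp
      (rule combine_in_asd[OF inner_H[OF w] two_form_omega_H[OF w] E(2)[OF W'(2)]])
qed

text \<open>Connects the concrete basis with the abstract frames in terms of which
  \<open>gauge_transformation\<close> and \<open>acts_as\<close> speak of matrices.\<close>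

lemma asd_frame_basis:
  assumes "w \<in> S \<times> T" "oriented (H w) (om w) e"
  shows "asd_frame g \<xi> \<kappa> w (asd_basis (\<lambda>i. H w (e i)))"
  unfolding asd_frame_def asd_eq[OF assms(1)] oriented_onb_iff[OF assms(1)]
  using asd_basis_in[OF inner_H[OF assms(1)] two_form_omega_H[OF assms(1)] assms(2)]
    asd_basis_orthonormal[OF inner_H[OF assms(1)]] assms(2)
  by (auto simp: oriented_def)

end

section \<open>Transition maps\<close>

lemma symmetric_second_derivative_vector:
  fixes \<tau> :: "'a::real_normed_vector \<Rightarrow> 'b::euclidean_space"
  assumes "open S" "smooth_on S \<tau>" "x \<in> S"
  shows "frechet_derivative (\<lambda>z. frechet_derivative \<tau> (at z) a) (at x) b =
         frechet_derivative (\<lambda>z. frechet_derivative \<tau> (at z) b) (at x) a"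
proof (rule euclidean_eqI)
  fix i :: 'b assume "i \<in> Basis"
  have s: "smooth_on S (\<lambda>z. \<tau> z \<bullet> i)"
    by (rule smooth_on_linear_comp[OF bounded_linear_inner_left assms(1,2)])
  have 1: "frechet_derivative (\<lambda>z. \<tau> z \<bullet> i) (at z) v = frechet_derivative \<tau> (at z) v \<bullet> i" if "z \<in> S" for z v
    using frechet_derivative_eq[OF bounded_linear.has_derivative[OF bounded_linear_inner_left smooth_on_deriv[OF assms(2) that]]]
    by metis
  have 2: "frechet_derivative (\<lambda>z. frechet_derivative (\<lambda>z. \<tau> z \<bullet> i) (at z) v) (at x) u =
      frechet_derivative (\<lambda>z. frechet_derivative \<tau> (at z) v) (at x) u \<bullet> i" for u v
  proof -
    have "((\<lambda>z. frechet_derivative \<tau> (at z) v \<bullet> i) has_derivative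
      (\<lambda>u. frechet_derivative (\<lambda>z. frechet_derivative \<tau> (at z) v) (at x) u \<bullet> i)) (at x)"
      by (rule bounded_linear.has_derivative[OF bounded_linear_inner_left
            smooth_on_deriv[OF smooth_on_frechet_derivative[OF assms(2)] assms(3)]])
    then have "((\<lambda>z. frechet_derivative (\<lambda>z. \<tau> z \<bullet> i) (at z) v) has_derivative
      (\<lambda>u. frechet_derivative (\<lambda>z. frechet_derivative \<tau> (at z) v) (at x) u \<bullet> i)) (at x)"
      by (rule has_derivative_transform_within_open[OF _ assms(1,3)]) (simp add: 1)
    then show ?thesis using frechet_derivative_eq by metis
  qed
  show "frechet_derivative (\<lambda>z. frechet_derivative \<tau> (at z) a) (at x) b \<bullet> i =
         frechet_derivative (\<lambda>z. frechet_derivative \<tau> (at z) b) (at x) a \<bullet> i"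
    using symmetric_second_derivative[OF assms(1) s assms(3)] unfolding 2 .
qed

lemma (in metric_on) has_derivative_pullback:
  fixes \<tau> X Y :: "'z::real_normed_vector \<Rightarrow> 'e"
  assumes "open W" "w \<in> W" "\<tau> ` W \<subseteq> S" "(\<tau> has_derivative d\<tau>) (at w)" "(X has_derivative dX) (at w)" "(Y has_derivative dY) (at w)"
  shows "((\<lambda>z. h (\<tau> z) (X z) (Y z)) has_derivative
    (\<lambda>v. dh (\<tau> w) (d\<tau> v) (X w) (Y w) + h (\<tau> w) (dX v) (Y w) + h (\<tau> w) (X w) (dY v))) (at w)"
proof -
  have tw: "\<tau> z \<in> S" if "z \<in> W" for z using assms that by auto
  have ex: "B a b = (\<Sum>i\<in>Basis. \<Sum>j\<in>Basis. (a \<bullet> i) * (b \<bullet> j) * B i j)" if "bilinear B" for B :: "'e \<Rightarrow> 'e \<Rightarrow> real" and a b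
  proof -
    have "B a b = B (\<Sum>i\<in>Basis. (a \<bullet> i) *\<^sub>R i) (\<Sum>j\<in>Basis. (b \<bullet> j) *\<^sub>R j)" by (simp add: euclidean_representation)
    also have "\<dots> = (\<Sum>i\<in>Basis. \<Sum>j\<in>Basis. (a \<bullet> i) * (b \<bullet> j) * B i j)"
      by (subst sum.swap) (simp add: bilinear_sums[OF that] bilinearD[OF that] sum_distrib_left mult_ac)
    finally show ?thesis .
  qed
  have bdh: "bilinear (dh (\<tau> w) v)" for v
    unfolding bilinear_def using dh_linear[OF tw[OF assms(2)]] by blast
  have bh: "bilinear (h (\<tau> z))" if "z \<in> W" for z using inner_formD(1)[OF inner[OF tw[OF that]]] .
  have d: "((\<lambda>z. h (\<tau> z) i j) has_derivative (\<lambda>v. dh (\<tau> w) (d\<tau> v) i j)) (at w)" for i j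
    by (rule has_derivative_compose[where f=\<tau> and g="\<lambda>x. h x i j", OF assms(4) dh[OF tw[OF assms(2)]]])
  have "((\<lambda>z. \<Sum>i\<in>Basis. \<Sum>j\<in>Basis. (X z \<bullet> i) * (Y z \<bullet> j) * h (\<tau> z) i j) has_derivative
    (\<lambda>v. \<Sum>i\<in>Basis. \<Sum>j\<in>Basis. (X w \<bullet> i) * (Y w \<bullet> j) * dh (\<tau> w) (d\<tau> v) i j +
       ((X w \<bullet> i) * (dY v \<bullet> j) + (dX v \<bullet> i) * (Y w \<bullet> j)) * h (\<tau> w) i j)) (at w)"
    by (intro has_derivative_sum has_derivative_mult d bounded_linear.has_derivative[OF bounded_linear_inner_left] assms)
  also have "(\<lambda>v. \<Sum>i\<in>Basis. \<Sum>j\<in>Basis. (X w \<bullet> i) * (Y w \<bullet> j) * dh (\<tau> w) (d\<tau> v) i j +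
       ((X w \<bullet> i) * (dY v \<bullet> j) + (dX v \<bullet> i) * (Y w \<bullet> j)) * h (\<tau> w) i j) =
    (\<lambda>v. dh (\<tau> w) (d\<tau> v) (X w) (Y w) + h (\<tau> w) (dX v) (Y w) + h (\<tau> w) (X w) (dY v))"
    by (rule ext, subst ex[OF bdh, of _ "X w" "Y w"], subst ex[OF bh[OF assms(2)], of _ "Y w"], subst ex[OF bh[OF assms(2)], of "X w"])
      (simp add: sum.distrib distrib_right)
  finally show ?thesis
    by (rule has_derivative_transform_within_open[OF _ assms(1,2)]) (simp add: ex[OF bh, symmetric])
qed

locale foliated_transition = A: foliated_chart g \<xi> \<kappa> S T + B: foliated_chart g \<xi> \<kappa>' S' T'
  for g :: "'m metric" and \<xi> :: "'m vfield" and \<kappa> S T \<kappa>' S' T' +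
  fixes W :: "E5 set" and \<tau> :: "E5 \<Rightarrow> E5"
  assumes open_W: "open W" and W_sub: "W \<subseteq> S \<times> T" and smooth_\<tau>: "smooth_on W \<tau>"
    and \<tau>_in: "\<tau> ` W \<subseteq> S' \<times> T'"
    and metric_law: "\<And>w a b. w \<in> W \<Longrightarrow> g \<kappa> w a b =
           g \<kappa>' (\<tau> w) (frechet_derivative \<tau> (at w) a) (frechet_derivative \<tau> (at w) b)"
    and reeb_law: "\<And>w. w \<in> W \<Longrightarrow> frechet_derivative \<tau> (at w) (0, 1) = (0, 1)"
begin

abbreviation D\<tau> :: "E5 \<Rightarrow> E5 \<Rightarrow> E5" where "D\<tau> w \<equiv> frechet_derivative \<tau> (at w)"

definition L :: "E5 \<Rightarrow> real^4 \<Rightarrow> real^4" where "L w a = fst (D\<tau> w (a, 0))"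

lemma D\<tau>: "w \<in> W \<Longrightarrow> (\<tau> has_derivative D\<tau> w) (at w)"
  by (rule smooth_on_deriv[OF smooth_\<tau>])

lemma linear_D\<tau>: "w \<in> W \<Longrightarrow> linear (D\<tau> w)"
  using D\<tau> has_derivative_linear by blast

lemma fst_D\<tau>:
  assumes "w \<in> W"
  shows "fst (D\<tau> w v) = L w (fst v)"
proof -
  have "v = (fst v, 0) + snd v *\<^sub>R (0, 1)" by (simp add: prod_eq_iff)
  then have "D\<tau> w v = D\<tau> w (fst v, 0) + snd v *\<^sub>R (0, 1)"
    using linear_add[OF linear_D\<tau>[OF assms]] linear_cmul[OF linear_D\<tau>[OF assms]] reeb_law[OF assms] by metis
  then show ?thesis by (simp add: L_def)
qed

lemma in_A: "w \<in> W \<Longrightarrow> w \<in> S \<times> T" and in_B: "w \<in> W \<Longrightarrow> \<tau> w \<in> S' \<times> T'"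
  using W_sub \<tau>_in by auto

text \<open>The transition map preserves g and \<xi>, hence \<eta>. So it sends horizontal vectors
  to horizontal ones, and a horizontal vector is determined by its projection.\<close>

lemma D\<tau>_lift:
  assumes "w \<in> W"
  shows "D\<tau> w (A.lift w a) = B.lift (\<tau> w) (L w a)"
proof -
  have "eta g \<xi> \<kappa> w (A.lift w a) = 0 \<and> fst (A.lift w a) = a" using A.eta_lift[OF in_A[OF assms]] by blast
  then have "eta g \<xi> \<kappa>' (\<tau> w) (D\<tau> w (A.lift w a)) = 0 \<and> fst (D\<tau> w (A.lift w a)) = L w a"
    using metric_law[OF assms, of "(0, 1)"] reeb_law[OF assms] fst_D\<tau>[OF assms]
    by (simp add: eta_def A.reeb[OF in_A[OF assms]] B.reeb[OF in_B[OF assms]])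
  then show ?thesis using B.eta_lift[OF in_B[OF assms]] by blast
qed

lemma H_law: "w \<in> W \<Longrightarrow> A.H w a b = B.H (\<tau> w) (L w a) (L w b)"
  using A.g_lift[OF in_A] B.g_lift[OF in_B] D\<tau>_lift metric_law by metis

lemma linear_L: "w \<in> W \<Longrightarrow> linear (L w)"
proof (rule linearI)
  assume w: "w \<in> W"
  show "L w (a + b) = L w a + L w b" for a b
    using linear_add[OF linear_D\<tau>[OF w], of "(a, 0)" "(b, 0)"] by (simp add: L_def)
  show "L w (r *\<^sub>R a) = r *\<^sub>R L w a" for r a
    using linear_cmul[OF linear_D\<tau>[OF w], of r "(a, 0)"] by (simp add: L_def)
qed

lemma bij_L:
  assumes "w \<in> W"
  shows "bij (L w)"
proof -
  have "a = 0" if "L w a = 0" for a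
  proof (rule ccontr)
    assume "a \<noteq> 0"
    then have "0 < A.H w a a" using inner_formD(3)[OF A.inner_H[OF in_A[OF assms]]] by blast
    then show False
      using H_law[OF assms, of a a] that bilinearD(5)[OF inner_formD(1)[OF B.inner_H[OF in_B[OF assms]]]] by simp
  qed
  then have "inj (L w)" using linear_injective_0[OF linear_L[OF assms]] by blast
  then show ?thesis using linear_injective_imp_surjective[OF linear_L[OF assms]] by (simp add: bij_def)
qed

text \<open>The last term, the second derivative of \<tau>, is symmetric in a and b. It disappears
  on antisymmetrising in \<open>om_law\<close>, which is the naturality of the exterior
  derivative.\<close>

lemma deta_law:
  assumes "w \<in> W"
  shows "A.m.dh w a (0, 1) b = B.m.dh (\<tau> w) (D\<tau> w a) (0, 1) (D\<tau> w b)
    + g \<kappa>' (\<tau> w) (0, 1) (frechet_derivative (\<lambda>z. D\<tau> z b) (at w) a)"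
proof -
  have "((\<lambda>z. g \<kappa>' (\<tau> z) (0, 1) (D\<tau> z b)) has_derivative
    (\<lambda>v. B.m.dh (\<tau> w) (D\<tau> w v) (0, 1) (D\<tau> w b) + g \<kappa>' (\<tau> w) 0 (D\<tau> w b)
       + g \<kappa>' (\<tau> w) (0, 1) (frechet_derivative (\<lambda>z. D\<tau> z b) (at w) v))) (at w)"
    by (rule B.m.has_derivative_pullback[OF open_W assms \<tau>_in D\<tau>[OF assms] has_derivative_const
          smooth_on_deriv[OF smooth_on_frechet_derivative[OF smooth_\<tau>] assms]])
  then have "((\<lambda>z. g \<kappa> z (0, 1) b) has_derivative
    (\<lambda>v. B.m.dh (\<tau> w) (D\<tau> w v) (0, 1) (D\<tau> w b) + g \<kappa>' (\<tau> w) 0 (D\<tau> w b)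
       + g \<kappa>' (\<tau> w) (0, 1) (frechet_derivative (\<lambda>z. D\<tau> z b) (at w) v))) (at w)"
    by (rule has_derivative_transform_within_open[OF _ open_W assms]) (simp add: metric_law reeb_law)
  then show ?thesis
    by (simp add: A.m.dh_def frechet_derivative_eq B.bil_g(5)[OF in_B[OF assms]])
qed

lemma om_law:
  assumes "w \<in> W"
  shows "A.om w a b = B.om (\<tau> w) (L w a) (L w b)"
proof -
  have "frechet_derivative (\<lambda>z. D\<tau> z b) (at w) a = frechet_derivative (\<lambda>z. D\<tau> z a) (at w) b" for a b
    by (rule symmetric_second_derivative_vector[OF open_W smooth_\<tau> assms])
  then have "A.m.dh w a (0, 1) b - A.m.dh w b (0, 1) a =
     B.m.dh (\<tau> w) (D\<tau> w a) (0, 1) (D\<tau> w b) - B.m.dh (\<tau> w) (D\<tau> w b) (0, 1) (D\<tau> w a)" for a b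
    by (simp add: deta_law[OF assms])
  then show ?thesis
    unfolding A.omega_H_eq[OF in_A[OF assms]] B.omega_H_eq[OF in_B[OF assms]] D\<tau>_lift[OF assms, symmetric] by simp
qed

lemma wedge_law: "w \<in> W \<Longrightarrow> wedge (A.om w) (A.om w) e = wedge (B.om (\<tau> w)) (B.om (\<tau> w)) (\<lambda>i. L w (e i))"
  by (simp add: wedge_def om_law)

lemma orthonormal_law: "w \<in> W \<Longrightarrow> orthonormal (A.H w) e \<longleftrightarrow> orthonormal (B.H (\<tau> w)) (\<lambda>i. L w (e i))"
  by (simp add: orthonormal_def H_law)

lemma oriented_law: "w \<in> W \<Longrightarrow> oriented (A.H w) (A.om w) e \<longleftrightarrow> oriented (B.H (\<tau> w)) (B.om (\<tau> w)) (\<lambda>i. L w (e i))"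
  by (simp add: oriented_def wedge_law orthonormal_law)

text \<open>The transformation law of gauge transformations speaks of pulled back forms only; by
  inverting \<open>L w\<close>, every anti-self-dual form at w is seen to be one.\<close>

lemma asd_law:
  assumes "w \<in> W" "\<beta> \<in> asd g \<xi> \<kappa> w"
  shows "\<exists>\<gamma>\<in>asd g \<xi> \<kappa>' (\<tau> w). \<beta> = pullback_form (L w) \<gamma>"
proof -
  have b: "\<beta> \<in> asd_forms (A.H w) (A.om w)" using assms A.asd_eq[OF in_A] by blast
  then have t: "two_form \<beta>" by (simp add: asd_forms_def)
  define M where "M = inv (L w)"
  have inv1: "L w (M a) = a" and inv2: "M (L w a) = a" for a
    using bij_L[OF assms(1)] by (simp_all add: M_def bij_def surj_f_inv_f)
  have lM: "linear M"
    using linear_L[OF assms(1)] inv1 inv2 unfolding linear_iff by metis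
  define \<gamma> where "\<gamma> = pullback_form M \<beta>"
  have "two_form \<gamma>"
    unfolding two_form_def bilinear_def \<gamma>_def pullback_form_def
    by (auto intro!: linearI simp: linear_add[OF lM] linear_cmul[OF lM] bilinearD[OF two_formD(1)[OF t]] two_formD(2)[OF t])
  moreover have "\<gamma> (e 3) (e 4) = - \<gamma> (e 1) (e 2)" if "oriented (B.H (\<tau> w)) (B.om (\<tau> w)) e" for e
  proof -
    have "oriented (A.H w) (A.om w) (\<lambda>i. M (e i))"
      using that by (simp add: oriented_law[OF assms(1)] inv1)
    then show ?thesis using b by (auto simp: asd_forms_def \<gamma>_def pullback_form_def)
  qed
  ultimately have "\<gamma> \<in> asd g \<xi> \<kappa>' (\<tau> w)"
    unfolding B.asd_eq[OF in_B[OF assms(1)]] by (auto simp: asd_forms_def)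
  moreover have "\<beta> = pullback_form (L w) \<gamma>" by (simp add: \<gamma>_def pullback_form_def inv2)
  ultimately show ?thesis by blast
qed

end

text \<open>The Killing property is pulled back. The derivative of \<tau> maps the leaf direction to
  a constant vector, so by symmetry of second derivatives its values on constant vectors do not
  change along leaves; the target metric does not either.\<close>

lemma killing_transition:
  assumes "foliated_chart g \<xi> \<kappa>' S' T'"
    and "open W" "smooth_on W \<tau>" "\<tau> ` W \<subseteq> S' \<times> T'" "w \<in> W"
    and metric_law: "\<And>w a b. w \<in> W \<Longrightarrow> g \<kappa> w a b =
           g \<kappa>' (\<tau> w) (frechet_derivative \<tau> (at w) a) (frechet_derivative \<tau> (at w) b)"
    and reeb_law: "\<And>w. w \<in> W \<Longrightarrow> frechet_derivative \<tau> (at w) (0, 1) = (0, 1)"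
  shows "frechet_derivative (\<lambda>z. g \<kappa> z a b) (at w) (0, 1 :: real) = 0"
proof -
  interpret B: foliated_chart g \<xi> \<kappa>' S' T' by fact
  let ?D = "\<lambda>w. frechet_derivative \<tau> (at w)"
  have tw: "\<tau> w \<in> S' \<times> T'" using assms by auto
  have 2: "frechet_derivative (\<lambda>z. ?D z a) (at w) (0, 1) = 0" for a
  proof -
    have "((\<lambda>z. ?D z (0, 1)) has_derivative (\<lambda>v. 0)) (at w)"
      by (rule has_derivative_transform_within_open[OF has_derivative_const[of "(0, 1)"] assms(2,5)]) (simp add: reeb_law)
    then show ?thesis
      using symmetric_second_derivative_vector[OF assms(2,3,5), of a "(0, 1)"] by (simp add: frechet_derivative_eq)
  qed
  note dd = smooth_on_deriv[OF smooth_on_frechet_derivative[OF assms(3)] assms(5)]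
  have "((\<lambda>z. g \<kappa>' (\<tau> z) (?D z a) (?D z b)) has_derivative
    (\<lambda>v. B.m.dh (\<tau> w) (?D w v) (?D w a) (?D w b) + g \<kappa>' (\<tau> w) (frechet_derivative (\<lambda>z. ?D z a) (at w) v) (?D w b)
       + g \<kappa>' (\<tau> w) (?D w a) (frechet_derivative (\<lambda>z. ?D z b) (at w) v))) (at w)"
    by (rule B.m.has_derivative_pullback[OF assms(2,5,4) smooth_on_deriv[OF assms(3,5)] dd dd])
  then have "((\<lambda>z. g \<kappa> z a b) has_derivative
    (\<lambda>v. B.m.dh (\<tau> w) (?D w v) (?D w a) (?D w b) + g \<kappa>' (\<tau> w) (frechet_derivative (\<lambda>z. ?D z a) (at w) v) (?D w b)
       + g \<kappa>' (\<tau> w) (?D w a) (frechet_derivative (\<lambda>z. ?D z b) (at w) v))) (at w)"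
    by (rule has_derivative_transform_within_open[OF _ assms(2,5)]) (simp add: metric_law)
  then show ?thesis
    by (simp add: frechet_derivative_eq 2 reeb_law[OF assms(5)] B.m.dh_def B.killing[OF tw] B.bil_g[OF tw])
qed

section \<open>Irreducibility from a dense chart\<close>

lemma riemannian_metricD:
  assumes "riemannian_metric A g" "\<kappa> \<in> A"
  shows "w \<in> fst \<kappa> \<Longrightarrow> inner_form (g \<kappa> w)" "smooth_on (fst \<kappa>) (\<lambda>w. g \<kappa> w a b)"
    "\<kappa>' \<in> A \<Longrightarrow> transition \<kappa> \<kappa>' W \<tau> \<Longrightarrow> w \<in> W \<Longrightarrow>
      g \<kappa> w a b = g \<kappa>' (\<tau> w) (frechet_derivative \<tau> (at w) a) (frechet_derivative \<tau> (at w) b)"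
proof -
  note m = assms(1)[unfolded riemannian_metric_def]
  show "w \<in> fst \<kappa> \<Longrightarrow> inner_form (g \<kappa> w)" using m[THEN conjunct1] assms(2) by (simp add: inner_form_def)
  show "smooth_on (fst \<kappa>) (\<lambda>w. g \<kappa> w a b)" using m[THEN conjunct2, THEN conjunct1] assms(2) by blast
  show "\<kappa>' \<in> A \<Longrightarrow> transition \<kappa> \<kappa>' W \<tau> \<Longrightarrow> w \<in> W \<Longrightarrow>
      g \<kappa> w a b = g \<kappa>' (\<tau> w) (frechet_derivative \<tau> (at w) a) (frechet_derivative \<tau> (at w) b)"
    using m[THEN conjunct2, THEN conjunct2] assms(2) by metis
qed

lemma foliatedD:
  assumes "foliated A \<xi> \<kappa>"
  shows "\<kappa> \<in> A" "w \<in> fst \<kappa> \<Longrightarrow> \<xi> \<kappa> w = (0, 1)"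
    "\<exists>S T. fst \<kappa> = S \<times> T \<and> open S \<and> open T \<and> connected T"
  using assms by (simp_all add: foliated_def)

lemma gauge_transformationD:
  assumes "gauge_transformation A g \<xi> u" "foliated A \<xi> \<kappa>"
  shows "w \<in> fst \<kappa> \<Longrightarrow> asd_frame g \<xi> \<kappa> w b \<Longrightarrow>
      \<exists>Q. rotation_matrix Q \<and> (\<forall>v. u \<kappa> w (combine b v) = combine b (Q *v v))"
    "open W \<Longrightarrow> W \<subseteq> fst \<kappa> \<Longrightarrow> asd_section g \<xi> \<kappa> W \<beta> \<Longrightarrow> asd_section g \<xi> \<kappa> W (\<lambda>w. u \<kappa> w (\<beta> w))"
    "foliated A \<xi> \<kappa>' \<Longrightarrow> transition \<kappa> \<kappa>' W \<tau> \<Longrightarrow> w \<in> W \<Longrightarrow> \<gamma> \<in> asd g \<xi> \<kappa>' (\<tau> w) \<Longrightarrow>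
      u \<kappa> w (pullback_form (\<lambda>a. fst (frechet_derivative \<tau> (at w) (a, 0))) \<gamma>) =
      pullback_form (\<lambda>a. fst (frechet_derivative \<tau> (at w) (a, 0))) (u \<kappa>' (\<tau> w) \<gamma>)"
proof -
  note m = assms(1)[unfolded gauge_transformation_def Let_def]
  show "w \<in> fst \<kappa> \<Longrightarrow> asd_frame g \<xi> \<kappa> w b \<Longrightarrow>
      \<exists>Q. rotation_matrix Q \<and> (\<forall>v. u \<kappa> w (combine b v) = combine b (Q *v v))"
    using m[THEN conjunct1] assms(2) by blast
  show "open W \<Longrightarrow> W \<subseteq> fst \<kappa> \<Longrightarrow> asd_section g \<xi> \<kappa> W \<beta> \<Longrightarrow> asd_section g \<xi> \<kappa> W (\<lambda>w. u \<kappa> w (\<beta> w))"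
    using m[THEN conjunct2, THEN conjunct1] assms(2) by blast
  show "foliated A \<xi> \<kappa>' \<Longrightarrow> transition \<kappa> \<kappa>' W \<tau> \<Longrightarrow> w \<in> W \<Longrightarrow> \<gamma> \<in> asd g \<xi> \<kappa>' (\<tau> w) \<Longrightarrow>
      u \<kappa> w (pullback_form (\<lambda>a. fst (frechet_derivative \<tau> (at w) (a, 0))) \<gamma>) =
      pullback_form (\<lambda>a. fst (frechet_derivative \<tau> (at w) (a, 0))) (u \<kappa>' (\<tau> w) \<gamma>)"
    using m[THEN conjunct2, THEN conjunct2] assms(2) by metis
qed

lemma continuous_dense_eq:
  fixes f :: "'a::topological_space \<Rightarrow> real"
  assumes "open V" "continuous_on V f" "w \<in> V" "\<And>U. open U \<Longrightarrow> w \<in> U \<Longrightarrow> U \<subseteq> V \<Longrightarrow> \<exists>z\<in>U. f z = c"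
  shows "f w = c"
proof (rule ccontr)
  assume "f w \<noteq> c"
  have "open (V \<inter> f -` (- {c}))" by (rule continuous_open_preimage[OF assms(2,1)]) auto
  moreover have "w \<in> V \<inter> f -` (- {c})" using \<open>f w \<noteq> c\<close> assms(3) by auto
  ultimately show False using assms(4)[of "V \<inter> f -` (- {c})"] by auto
qed

text \<open>\<open>frame0\<close> asks for the exact value 2 and not merely a positive one:
  positivity on a dense set could degenerate in the limit, an exact value cannot.\<close>

theorem irreducible_from_dense_chart:
  fixes A :: "'m param set" and g :: "'m metric" and \<xi> :: "'m vfield" and \<kappa>\<^sub>0 :: "'m param"
  assumes metric: "riemannian_metric A g" and field: "vector_field A \<xi>" and A0: "foliated A \<xi> \<kappa>\<^sub>0"
    and chart0: "foliated_chart g \<xi> \<kappa>\<^sub>0 S\<^sub>0 T\<^sub>0"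
    and frame0: "\<And>w. w \<in> S\<^sub>0 \<times> T\<^sub>0 \<Longrightarrow> \<exists>e. orthonormal (foliated_chart.H g \<kappa>\<^sub>0 w) e \<and>
        wedge (omega_H g \<xi> \<kappa>\<^sub>0 w) (omega_H g \<xi> \<kappa>\<^sub>0 w) e = 2"
    and dense: "\<And>\<kappa> U. foliated A \<xi> \<kappa> \<Longrightarrow> open U \<Longrightarrow> U \<noteq> {} \<Longrightarrow> U \<subseteq> fst \<kappa> \<Longrightarrow>
        \<exists>w\<in>U. \<exists>W \<tau>. w \<in> W \<and> transition \<kappa> \<kappa>\<^sub>0 W \<tau>"
    and parallel0: "\<And>u w \<beta>. gauge_transformation A g \<xi> u \<Longrightarrow> covariantly_constant A g \<xi> u \<Longrightarrow>
        w \<in> S\<^sub>0 \<times> T\<^sub>0 \<Longrightarrow> \<beta> \<in> asd g \<xi> \<kappa>\<^sub>0 w \<Longrightarrow> u \<kappa>\<^sub>0 w \<beta> = \<beta>"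
  shows "transverse_LC_irreducible A g \<xi>"
proof -
  have inA: "\<kappa> \<in> A" if "foliated A \<xi> \<kappa>" for \<kappa> using that by (simp add: foliated_def)
  have dom0: "fst \<kappa>\<^sub>0 = S\<^sub>0 \<times> T\<^sub>0" using chart0 by (simp add: foliated_chart_def)
  have trans: "open W" "W \<subseteq> fst \<kappa>" "smooth_on W \<tau>" "\<tau> ` W \<subseteq> S\<^sub>0 \<times> T\<^sub>0"
     "\<And>w a b. w \<in> W \<Longrightarrow> g \<kappa> w a b = g \<kappa>\<^sub>0 (\<tau> w) (frechet_derivative \<tau> (at w) a) (frechet_derivative \<tau> (at w) b)"
     "\<And>w. w \<in> W \<Longrightarrow> frechet_derivative \<tau> (at w) (0, 1) = (0, 1)"
    if f: "foliated A \<xi> \<kappa>" and t: "transition \<kappa> \<kappa>\<^sub>0 W \<tau>" for \<kappa> W \<tau>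
  proof -
    show 1: "open W" "W \<subseteq> fst \<kappa>" "smooth_on W \<tau>" "\<tau> ` W \<subseteq> S\<^sub>0 \<times> T\<^sub>0"
      using t by (auto simp: transition_def local_diffeo_on_def dom0)
    show "g \<kappa> w a b = g \<kappa>\<^sub>0 (\<tau> w) (frechet_derivative \<tau> (at w) a) (frechet_derivative \<tau> (at w) b)" if "w \<in> W" for w a b
      using riemannian_metricD(3)[OF metric inA[OF f] inA[OF A0] t that] .
    show "frechet_derivative \<tau> (at w) (0, 1) = (0, 1)" if w: "w \<in> W" for w
    proof -
      have "frechet_derivative \<tau> (at w) (\<xi> \<kappa> w) = \<xi> \<kappa>\<^sub>0 (\<tau> w)"
        using field[unfolded vector_field_def, THEN conjunct2] inA[OF f] inA[OF A0] t w by blast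
      moreover have "w \<in> fst \<kappa>" "\<tau> w \<in> fst \<kappa>\<^sub>0" using w 1 dom0 by auto
      then have "\<xi> \<kappa> w = (0, 1)" "\<xi> \<kappa>\<^sub>0 (\<tau> w) = (0, 1)"
        using foliatedD(2)[OF f] foliatedD(2)[OF A0] by auto
      ultimately show ?thesis by simp
    qed
  qed
  \<comment> \<open>The Killing equation holds at the points that a transition map carries into the
    dense chart, and extends by continuity of the derivative of the metric.\<close>
  have chart: "\<exists>S T. foliated_chart g \<xi> \<kappa> S T" if f: "foliated A \<xi> \<kappa>" for \<kappa>
  proof -
    obtain S T where ST: "fst \<kappa> = S \<times> T" "open S" "open T" "connected T"
      using foliatedD(3)[OF f] by blast
    have V: "open (S \<times> T)" using ST by (simp add: open_Times)
    have inner: "inner_form (g \<kappa> w)" if "w \<in> S \<times> T" for w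
      using riemannian_metricD(1)[OF metric inA[OF f]] that ST(1) by simp
    have sm: "smooth_on (S \<times> T) (\<lambda>w. g \<kappa> w a b)" for a b
      using riemannian_metricD(2)[OF metric inA[OF f], of a b] ST(1) by simp
    have "frechet_derivative (\<lambda>z. g \<kappa> z a b) (at w) (0, 1) = 0" if w: "w \<in> S \<times> T" for w a b
    proof (rule continuous_dense_eq[OF V smooth_on_continuous[OF smooth_on_frechet_derivative[OF sm]] w])
      fix U assume U: "open U" "w \<in> U" "U \<subseteq> S \<times> T"
      then obtain z W \<tau> where z: "z \<in> U" "z \<in> W" "transition \<kappa> \<kappa>\<^sub>0 W \<tau>"
        using dense[OF f, of U] ST(1) by blast
      note tr = trans[OF f z(3)]
      show "\<exists>z\<in>U. frechet_derivative (\<lambda>z. g \<kappa> z a b) (at z) (0, 1) = 0"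
        using z(1) killing_transition[OF chart0 tr(1,3,4) z(2) tr(5,6)] by blast
    qed
    then have "foliated_chart g \<xi> \<kappa> S T"
      using ST inner sm foliatedD(2)[OF f] by unfold_locales auto
    then show ?thesis by blast
  qed
  \<comment> \<open>Guarantees that anti-self-duality is a genuine condition at every point, also
    outside the dense chart.\<close>
  have nondeg: "\<exists>e. oriented (foliated_chart.H g \<kappa> w) (omega_H g \<xi> \<kappa> w) e"
    if f: "foliated A \<xi> \<kappa>" and w: "w \<in> fst \<kappa>" and c: "foliated_chart g \<xi> \<kappa> S T" for \<kappa> w S T
  proof -
    interpret C: foliated_chart g \<xi> \<kappa> S T by (rule c)
    have wST: "w \<in> S \<times> T" using w C.domain by simp
    obtain e :: "4 \<Rightarrow> real^4" where e: "orthonormal (C.H w) e" using orthonormal_exists[OF C.inner_H[OF wST]] by blast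
    obtain W E where W: "open W" "w \<in> W" "W \<subseteq> S \<times> T" and E: "\<And>i. smooth_on W (\<lambda>z. E z i)" "E w = e"
      "\<And>z. z \<in> W \<Longrightarrow> orthonormal (C.H z) (E z)"
      using C.orthonormal_frame[OF wST e] by blast
    define f where "f z = wedge (C.om z) (C.om z) (E z)" for z
    have sf: "smooth_on W f" unfolding f_def by (rule C.smooth_wedge_om[OF W(1,3) E(1)])
    \<comment> \<open>Orthonormal frames change the value by a sign only, so the square is
      independent of the frame; it is 4 on a dense set, hence everywhere.\<close>
    have "f w * f w = 4"
    proof (rule continuous_dense_eq[OF W(1) smooth_on_continuous[OF smooth_on_mult[OF W(1) sf sf]] W(2)])
      fix U assume U: "open U" "w \<in> U" "U \<subseteq> W"
      then obtain z W' \<tau> where z: "z \<in> U" "z \<in> W'" "transition \<kappa> \<kappa>\<^sub>0 W' \<tau>"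
        using dense[OF f, of U] W(3) C.domain(1) by blast
      note tr = trans[OF f z(3)]
      interpret X: foliated_transition g \<xi> \<kappa> S T \<kappa>\<^sub>0 S\<^sub>0 T\<^sub>0 W' \<tau>
        by (intro foliated_transition.intro foliated_transition_axioms.intro c chart0)
          (use tr C.domain(1) in auto)
      have oz: "orthonormal (X.B.H (\<tau> z)) (\<lambda>i. X.L z (E z i))"
        using X.orthonormal_law[OF z(2), of "E z"] E(3)[of z] z(1) U(3) by blast
      obtain e0 where e0: "orthonormal (X.B.H (\<tau> z)) e0" "wedge (X.B.om (\<tau> z)) (X.B.om (\<tau> z)) e0 = 2"
        using frame0[OF X.in_B[OF z(2)]] by blast
      obtain d where d: "d \<in> {1, -1}" "wedge (X.B.om (\<tau> z)) (X.B.om (\<tau> z)) (\<lambda>i. X.L z (E z i)) = d * 2"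
        using wedge_orthonormal_change[OF X.B.inner_H[OF X.in_B[OF z(2)]] e0(1) oz]
          X.B.two_form_omega_H[OF X.in_B[OF z(2)]] e0(2) by metis
      have "f z * f z = 4" unfolding f_def X.wedge_law[OF z(2)] d(2) using d(1) by auto
      then show "\<exists>z\<in>U. f z * f z = 4" using z(1) by blast
    qed
    then have "f w \<noteq> 0" by auto
    then consider "f w > 0" | "f w < 0" by linarith
    then show ?thesis
    proof cases
      case 1
      then have "oriented (C.H w) (C.om w) e" using e E(2) by (simp add: oriented_def f_def)
      then show ?thesis by blast
    next
      case 2
      \<comment> \<open>An odd permutation of a negatively oriented frame orients it
        positively.\<close>
      define \<sigma> where "\<sigma> = Transposition.transpose (1::4) 2"
      have s: "\<sigma> 1 = 2" "\<sigma> 2 = 1" "\<sigma> 3 = 3" "\<sigma> 4 = 4" by (simp_all add: \<sigma>_def transpose_def)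
      have inj: "\<sigma> i = \<sigma> j \<longleftrightarrow> i = j" for i j unfolding \<sigma>_def by (metis transpose_involutory)
      note anti = two_formD(3)[OF C.two_form_omega_H[OF wST]]
      have "wedge (C.om w) (C.om w) (\<lambda>i. e (\<sigma> i)) = - f w"
        using anti[of "e 2" "e 1"] by (simp add: wedge_def s f_def E(2))
      moreover have "orthonormal (C.H w) (\<lambda>i. e (\<sigma> i))" using e by (simp add: orthonormal_def inj)
      ultimately have "oriented (C.H w) (C.om w) (\<lambda>i. e (\<sigma> i))" using 2 by (simp add: oriented_def)
      then show ?thesis by blast
    qed
  qed
  show ?thesis
    unfolding transverse_LC_irreducible_def SO3_centre_eq
  proof (intro allI impI iffI)
    fix u assume u: "gauge_transformation A g \<xi> u" and cc: "covariantly_constant A g \<xi> u"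
    \<comment> \<open>Triviality of u is known only at points carried into the dense chart.
      Extending the form to a section makes the difference of u applied to it and the section itself
      a smooth function that vanishes on a dense set.\<close>
    have id: "u \<kappa> w \<beta>\<^sub>0 = \<beta>\<^sub>0" if f: "foliated A \<xi> \<kappa>" and w: "w \<in> fst \<kappa>" and b0: "\<beta>\<^sub>0 \<in> asd g \<xi> \<kappa> w" for \<kappa> w \<beta>\<^sub>0
    proof (intro ext)
      fix a b
      obtain S T where c: "foliated_chart g \<xi> \<kappa> S T" using chart[OF f] by blast
      interpret C: foliated_chart g \<xi> \<kappa> S T by (rule c)
      have wST: "w \<in> S \<times> T" using w C.domain by simp
      obtain e where e: "oriented (C.H w) (C.om w) e" using nondeg[OF f w c] by blast
      obtain W \<beta> where W: "open W" "w \<in> W" "W \<subseteq> S \<times> T" and \<beta>: "asd_section g \<xi> \<kappa> W \<beta>" "\<beta> w = \<beta>\<^sub>0"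
        using C.asd_section_extend[OF wST e b0] by blast
      have "asd_section g \<xi> \<kappa> W (\<lambda>w. u \<kappa> w (\<beta> w))"
        using gauge_transformationD(2)[OF u f W(1) _ \<beta>(1)] W(3) C.domain(1) by simp
      then have sm: "smooth_on W (\<lambda>z. u \<kappa> z (\<beta> z) a b - \<beta> z a b)"
        using \<beta>(1) unfolding asd_section_def by (intro smooth_on_diff W(1)) auto
      have "u \<kappa> w (\<beta> w) a b - \<beta> w a b = 0"
      proof (rule continuous_dense_eq[OF W(1) smooth_on_continuous[OF sm] W(2)])
        fix U assume U: "open U" "w \<in> U" "U \<subseteq> W"
        then obtain z W' \<tau> where z: "z \<in> U" "z \<in> W'" "transition \<kappa> \<kappa>\<^sub>0 W' \<tau>"
          using dense[OF f, of U] W(3) C.domain(1) by blast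
        note tr = trans[OF f z(3)]
        interpret X: foliated_transition g \<xi> \<kappa> S T \<kappa>\<^sub>0 S\<^sub>0 T\<^sub>0 W' \<tau>
          by (intro foliated_transition.intro foliated_transition_axioms.intro c chart0)
            (use tr C.domain(1) in auto)
        have "\<beta> z \<in> asd g \<xi> \<kappa> z" using \<beta>(1) z(1) U by (auto simp: asd_section_def)
        then obtain \<gamma> where \<gamma>: "\<gamma> \<in> asd g \<xi> \<kappa>\<^sub>0 (\<tau> z)" "\<beta> z = pullback_form (X.L z) \<gamma>"
          using X.asd_law[OF z(2)] by blast
        have "u \<kappa> z (pullback_form (X.L z) \<gamma>) = pullback_form (X.L z) (u \<kappa>\<^sub>0 (\<tau> z) \<gamma>)"
          using gauge_transformationD(3)[OF u f A0 z(3,2) \<gamma>(1)] unfolding X.L_def[abs_def] .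
        also have "\<dots> = pullback_form (X.L z) \<gamma>"
          using parallel0[OF u cc X.in_B[OF z(2)] \<gamma>(1)] by simp
        finally have "u \<kappa> z (\<beta> z) = \<beta> z" using \<gamma>(2) by simp
        then show "\<exists>z\<in>U. u \<kappa> z (\<beta> z) a b - \<beta> z a b = 0" by (intro bexI[OF _ z(1)]) simp
      qed
      then show "u \<kappa> w \<beta>\<^sub>0 a b = \<beta>\<^sub>0 a b" using \<beta>(2) by simp
    qed
    have "acts_as A g \<xi> u (mat 1)"
      unfolding acts_as_def matrix_vector_mul_lid
    proof (intro allI impI ballI)
      fix \<kappa> w b v assume f: "foliated A \<xi> \<kappa>" and w: "w \<in> fst \<kappa>" and b: "asd_frame g \<xi> \<kappa> w b"
      obtain S T where c: "foliated_chart g \<xi> \<kappa> S T" using chart[OF f] by blast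
      interpret C: foliated_chart g \<xi> \<kappa> S T by (rule c)
      have wST: "w \<in> S \<times> T" using w C.domain by simp
      have bi: "b i \<in> asd_forms (C.H w) (C.om w)" for i
        using b C.asd_eq[OF wST] by (auto simp: asd_frame_def)
      then have "two_form (combine b v)" by (intro two_form_combine) (auto simp: asd_forms_def)
      moreover have "combine b v (e 3) (e 4) = - combine b v (e 1) (e 2)" if "oriented (C.H w) (C.om w) e" for e
        using bi that by (simp add: combine_def asd_forms_def sum_3)
      ultimately have "combine b v \<in> asd g \<xi> \<kappa> w" unfolding C.asd_eq[OF wST] by (auto simp: asd_forms_def)
      then show "u \<kappa> w (combine b v) = combine b v" by (rule id[OF f w])
    qed
    then show "\<exists>Z\<in>{mat 1}. acts_as A g \<xi> u Z" by blast
  next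
    fix u assume u: "gauge_transformation A g \<xi> u" and "\<exists>Z\<in>{mat 1}. acts_as A g \<xi> u Z"
    then have act: "acts_as A g \<xi> u (mat 1)" by blast
    show "covariantly_constant A g \<xi> u"
      unfolding covariantly_constant_def
    proof (intro allI impI ballI)
      fix \<kappa> W \<beta> w v
      assume "foliated A \<xi> \<kappa> \<and> open W \<and> W \<subseteq> fst \<kappa> \<and> asd_section g \<xi> \<kappa> W \<beta>" and w: "w \<in> W"
      then have f: "foliated A \<xi> \<kappa>" and W: "open W" "W \<subseteq> fst \<kappa>" and \<beta>: "asd_section g \<xi> \<kappa> W \<beta>" by auto
      obtain S T where c: "foliated_chart g \<xi> \<kappa> S T" using chart[OF f] by blast
      interpret C: foliated_chart g \<xi> \<kappa> S T by (rule c)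
      have sub: "W \<subseteq> S \<times> T" using W C.domain by simp
      have id: "u \<kappa> z \<gamma> = \<gamma>" if z: "z \<in> W" and g: "\<gamma> \<in> asd g \<xi> \<kappa> z" for z \<gamma>
      proof -
        have zST: "z \<in> S \<times> T" using z sub by auto
        obtain e where e: "oriented (C.H z) (C.om z) e" using nondeg[OF f _ c] z W by blast
        obtain x where x: "\<gamma> = combine (asd_basis (\<lambda>i. C.H z (e i))) x"
          using asd_combine[OF C.inner_H[OF zST] C.two_form_omega_H[OF zST] e] g C.asd_eq[OF zST] by blast
        show ?thesis
          using act f z W(2) C.asd_frame_basis[OF zST e] unfolding acts_as_def x matrix_vector_mul_lid by blast
      qed
      obtain e where e: "oriented (C.H w) (C.om w) e" using nondeg[OF f _ c] w W by blast
      have "transverse_nabla g \<xi> \<kappa> \<beta> w v = transverse_nabla g \<xi> \<kappa> (\<lambda>z. u \<kappa> z (\<beta> z)) w v"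
      proof (rule C.transverse_nabla_cong[OF W(1) w])
        show "\<beta> z = u \<kappa> z (\<beta> z)" if "z \<in> W" for z using id[OF that] \<beta> that by (simp add: asd_section_def)
        show "(\<lambda>z. \<beta> z a b) differentiable (at w)" for a b
          by (rule smooth_on_differentiable[OF _ w]) (use \<beta> in \<open>auto simp: asd_section_def\<close>)
      qed
      then show "transverse_nabla g \<xi> \<kappa> (\<lambda>z. u \<kappa> z (\<beta> z)) w v = u \<kappa> w (transverse_nabla g \<xi> \<kappa> \<beta> w v)"
        using id[OF w C.transverse_nabla_in_asd[OF W(1) w sub \<beta> e]] by metis
    qed
  qed
qed

section \<open>The parameters of \<open>Y\<^sup>p\<^sup>,\<^sup>q\<close>\<close>

lemma vector_4 [simp]:
  "(vector [x, y, z, w] :: real^4) $ 1 = x" "(vector [x, y, z, w] :: real^4) $ 2 = y"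
  "(vector [x, y, z, w] :: real^4) $ 3 = z" "(vector [x, y, z, w] :: real^4) $ 4 = w"
  by (simp_all add: vector_def)

lemma has_derivative_fst_nth: "((\<lambda>x. fst x $ i) has_derivative (\<lambda>v. fst v $ i)) (at (z :: (real^'n) \<times> real))"
  by (rule bounded_linear_imp_has_derivative)
    (rule bounded_linear_compose[OF bounded_linear_vec_nth bounded_linear_fst])

lemma E5_eqI:
  assumes "fst a $ 1 = fst b $ 1" "fst a $ 2 = fst b $ 2" "fst a $ 3 = fst b $ 3" "fst a $ 4 = fst b $ 4" "snd a = snd b"
  shows "a = (b :: E5)"
  using assms by (simp add: prod_eq_iff vec_eq_iff forall_4)

locale Y_params =
  fixes p q :: nat
  assumes q_pos: "0 < q" and q_less: "q < p"
begin

abbreviation a0 :: real where "a0 \<equiv> Y_a p q"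
abbreviation y1 :: real where "y1 \<equiv> Y_y1 p q"
abbreviation y2 :: real where "y2 \<equiv> Y_y2 p q"

lemma sqrt_bounds:
  defines "m \<equiv> sqrt (4 * (real p)^2 - 3 * (real q)^2)"
  shows "m * m = 4 * (real p)^2 - 3 * (real q)^2" "real p < m" "m < 2 * real p"
proof -
  have pq: "0 < real q" "real q < real p" using q_pos q_less by auto
  have "(real q)^2 < (real p)^2" using pq by (intro power_strict_mono) auto
  then have 1: "(real p)^2 < 4 * (real p)^2 - 3 * (real q)^2" by linarith
  have 2: "4 * (real p)^2 - 3 * (real q)^2 < (2 * real p)^2" using pq by (simp add: power2_eq_square)
  have "0 \<le> 4 * (real p)^2 - 3 * (real q)^2" using 1 by (smt (verit) zero_le_power2)
  then show "m * m = 4 * (real p)^2 - 3 * (real q)^2" by (simp add: m_def)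
  show "real p < m" unfolding m_def by (rule real_less_rsqrt[OF 1])
  show "m < 2 * real p" unfolding m_def by (rule real_less_lsqrt[OF _ 2]) (use pq in auto)
qed

text \<open>With m the square root in \<open>Y_a\<close>, substituting 3 q^2 = 4 p^2 - m^2 makes
  both 4 p^3 a and 4 p^3 (1 - a) factor; the factors are positive because p < m < 2 p.\<close>

lemma a_bounds: "0 < a0" "a0 < 1"
proof -
  define P m where "P = real p" and "m = sqrt (4 * (real p)^2 - 3 * (real q)^2)"
  note m = sqrt_bounds[folded m_def, folded P_def]
  have P: "0 < P" using q_pos q_less by (simp add: P_def)
  have a0: "a0 = 1 / 2 - (P^2 - 3 * (real q)^2) / (4 * P^3) * m" by (simp add: Y_a_def P_def m_def)
  have R: "3 * (real q)^2 = 4 * P^2 - m * m" using m(1) by simp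
  have "a0 * (4 * P^3) = (2 * P - m) * (m + P)^2"
    unfolding a0 R using P by (simp add: field_simps power2_eq_square power3_eq_cube)
  moreover have "0 < (2 * P - m) * (m + P)^2" using m P by (intro mult_pos_pos zero_less_power) auto
  ultimately show "0 < a0" using zero_less_mult_pos2[of a0 "4 * P^3"] P by simp
  have "(1 - a0) * (4 * P^3) = (m - P)^2 * (m + 2 * P)"
    unfolding a0 R using P by (simp add: field_simps power2_eq_square power3_eq_cube)
  moreover have "0 < (m - P)^2 * (m + 2 * P)" using m P by (intro mult_pos_pos zero_less_power) auto
  ultimately have "0 < 1 - a0" using zero_less_mult_pos2[of "1 - a0" "4 * P^3"] P by simp
  then show "a0 < 1" by simp
qed

text \<open>The denominator is (2 p - m) (p + m), a product of positive factors. Division by this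
  period recovers the leaf-like coordinate of the corner parametrisations.\<close>

lemma Y_l_nonzero: "Y_l p q \<noteq> 0"
proof -
  define P m where "P = real p" and "m = sqrt (4 * (real p)^2 - 3 * (real q)^2)"
  note m = sqrt_bounds[folded m_def, folded P_def]
  have P: "0 < P" using q_pos q_less by (simp add: P_def)
  have "3 * (real q)^2 - 2 * P^2 + P * m = (2 * P - m) * (P + m)"
    using m(1) by (simp add: algebra_simps power2_eq_square)
  also have "\<dots> > 0" using m P by (intro mult_pos_pos) auto
  finally have "3 * (real q)^2 - 2 * (real p)^2 + real p * m > 0" by (simp add: P_def)
  then show ?thesis using q_pos unfolding Y_l_def m_def[symmetric] by simp
qed

section \<open>The cubic whose roots bound the range of y\<close>

definition N :: "real \<Rightarrow> real" where "N y = a0 - 3 * y^2 + 2 * y^3"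

lemma N_diff: "N y - N z = (y - z) * (2 * (y^2 + y * z + z^2) - 3 * (y + z))"
  by (simp add: N_def algebra_simps power2_eq_square power3_eq_cube)

lemma N_increasing: "y < z \<Longrightarrow> z \<le> 0 \<Longrightarrow> N y < N z"
proof -
  assume "y < z" "z \<le> 0"
  then have "0 \<le> y^2 + y * z + z^2" "y + z < 0" by (auto simp: mult_nonpos_nonpos)
  then have "(y - z) * (2 * (y^2 + y * z + z^2) - 3 * (y + z)) < 0" using \<open>y < z\<close> by (intro mult_neg_pos) auto
  then show ?thesis using N_diff[of y z] by linarith
qed

lemma N_decreasing: "0 \<le> y \<Longrightarrow> y < z \<Longrightarrow> z \<le> 1 \<Longrightarrow> N z < N y"
proof -
  assume yz: "0 \<le> y" "y < z" "z \<le> 1"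
  have "z * z \<le> z" "y * y \<le> y" "y * z \<le> y"
    using yz by (auto intro!: mult_left_le)
  then have "y^2 + y * z + z^2 \<le> y + y + z" unfolding power2_eq_square by (intro add_mono)
  then have "2 * (y^2 + y * z + z^2) - 3 * (y + z) < 0" using yz by argo
  then have "0 < (y - z) * (2 * (y^2 + y * z + z^2) - 3 * (y + z))" using yz by (intro mult_neg_neg) auto
  then show ?thesis using N_diff[of y z] by linarith
qed

lemma continuous_N: "continuous_on A N"
  unfolding N_def by (intro continuous_intros)

text \<open>The values a - 5 at -1 and a at 0 have opposite signs, which gives existence;
  monotonicity on the negative axis gives the uniqueness that the description of \<open>Y_y1\<close>
  needs.\<close>

lemma y1: "-1 < y1" "y1 < 0" "N y1 = 0"
proof -
  have "\<exists>y\<ge>-1. y \<le> 0 \<and> N y = 0"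
    by (rule IVT') (use a_bounds in \<open>auto simp: N_def intro!: continuous_intros\<close>)
  then obtain r where r: "-1 \<le> r" "r \<le> 0" "N r = 0" by blast
  have n: "N (-1) \<noteq> 0" "N 0 \<noteq> 0" using a_bounds by (auto simp: N_def)
  have r': "-1 < r" "r < 0" using r n by (auto simp: less_le)
  have "y1 = r"
    unfolding Y_y1_def N_def[symmetric]
  proof (rule the_equality)
    show "s = r" if "s < 0 \<and> N s = 0" for s
      using that r r' N_increasing[of s r] N_increasing[of r s] by (cases s r rule: linorder_cases) auto
  qed (use r r' in auto)
  then show "-1 < y1" "y1 < 0" "N y1 = 0" using r r' by auto
qed

text \<open>The sign change is between the values a at 0 and a - 1 at 1; strict decrease on that
  interval shows that no smaller positive root exists.\<close>

lemma y2: "0 < y2" "y2 < 1" "N y2 = 0"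
proof -
  have "\<exists>y\<ge>0. y \<le> 1 \<and> N y = 0"
    by (rule IVT2') (use a_bounds in \<open>auto simp: N_def intro!: continuous_intros\<close>)
  then obtain r where r: "0 \<le> r" "r \<le> 1" "N r = 0" by blast
  have n: "N 1 \<noteq> 0" "N 0 \<noteq> 0" using a_bounds by (auto simp: N_def)
  have r': "0 < r" "r < 1" using r n by (auto simp: less_le)
  have "y2 = r"
    unfolding Y_y2_def N_def[symmetric]
  proof (rule Least_equality)
    show "r \<le> s" if "0 < s \<and> N s = 0" for s
      using that r r' N_decreasing[of s r] by (cases s r rule: linorder_cases) auto
  qed (use r r' in auto)
  then show "0 < y2" "y2 < 1" "N y2 = 0" using r r' by auto
qed

lemma N_pos: "y1 < y \<Longrightarrow> y < y2 \<Longrightarrow> 0 < N y"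
  using N_increasing[of y1 y] N_decreasing[of y y2] y1 y2 by (cases "y \<le> 0") auto

lemma a_minus_square_pos: "y1 < y \<Longrightarrow> y < y2 \<Longrightarrow> 0 < a0 - y^2"
proof -
  assume y: "y1 < y" "y < y2"
  \<comment> \<open>Because a - y^2 = N y + 2 y^2 (1 - y).\<close>
  have "0 \<le> y^2 * (2 * (1 - y))" using y y2 by (intro mult_nonneg_nonneg) auto
  then show ?thesis using N_pos[OF y] by (simp add: N_def algebra_simps power2_eq_square power3_eq_cube)
qed

text \<open>The transverse metric is
  \<open>P (d\<theta>\<^sup>2 + sin\<^sup>2 \<theta> d\<phi>\<^sup>2) + dy\<^sup>2 / Q + Q / 36 (d\<beta> + cos \<theta> d\<phi>)\<^sup>2\<close> with \<open>\<beta> = - 6 \<alpha> - \<psi>\<close>.\<close>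

definition P :: "real \<Rightarrow> real" where "P y = (1 - y) / 6"
definition Q :: "real \<Rightarrow> real" where "Q y = 2 * N y / (1 - y)"
text \<open>With u = 1 - y the cubic is (a - 1) + 3 u^2 - 2 u^3, so Q = 2 ((a - 1) / u + 3 u - 2
  u^2), and the y-derivative is minus the u-derivative of this.\<close>

definition Q' :: "real \<Rightarrow> real" where "Q' y = 2 * ((a0 - 1) / (1 - y)^2 - 3 + 4 * (1 - y))"

lemma P_pos: "y < y2 \<Longrightarrow> 0 < P y"
  using y2 by (simp add: P_def)

lemma Q_pos: "y1 < y \<Longrightarrow> y < y2 \<Longrightarrow> 0 < Q y"
  using N_pos y2 by (simp add: Q_def)

lemma Q_deriv: "y < 1 \<Longrightarrow> (Q has_real_derivative Q' y) (at y)"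
proof -
  assume y: "y < 1"
  define d where "d = (1 - y)^2"
  have d: "d \<noteq> 0" using y by (simp add: d_def)
  have "(N has_real_derivative 6 * y^2 - 6 * y) (at y)"
    unfolding N_def by (auto intro!: derivative_eq_intros)
  then have "(Q has_real_derivative (2 * (6 * y^2 - 6 * y) * (1 - y) + 2 * N y) / d) (at y)"
    unfolding Q_def d_def using y by (auto intro!: derivative_eq_intros simp: power2_eq_square)
  also have "(2 * (6 * y^2 - 6 * y) * (1 - y) + 2 * N y) / d = (2 * (a0 - 1) + d * (8 * (1 - y) - 6)) / d"
    unfolding N_def d_def by (rule arg_cong[of _ _ "\<lambda>x. x / _"]) algebra
  also have "\<dots> = Q' y" unfolding Q'_def d_def[symmetric] using d by (simp add: field_simps)
  finally show ?thesis .
qed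

text \<open>The first identity turns the dy-term into dy^2 / Q. With \<sigma> = d\<psi> - cos
  \<theta> d\<phi> and \<delta> = d\<alpha>, the other right-hand sides are the coefficients of
  \<delta>^2, of the mixed term and of \<sigma>^2 in ((1 - y) \<sigma> / 3 - 2 y \<delta>)^2 + Q (6
  \<delta> + \<sigma>)^2 / 36, the split of the angular part into \<eta>^2 and the transverse
  remainder.\<close>

lemma Y_identities:
  assumes "y1 < y" "y < y2"
  shows "Y_w p q y * Y_v p q y = Q y"
    "Y_w p q y = 4 * y^2 + Q y"
    "Y_w p q y * Y_f p q y = - 2 * y * (1 - y) / 3 + Q y / 6"
    "Y_v p q y / 9 + Y_w p q y * (Y_f p q y * Y_f p q y) = (1 - y)^2 / 9 + Q y / 36"
proof -
  have n: "a0 - y^2 \<noteq> 0" "1 - y \<noteq> 0" using a_minus_square_pos[OF assms] y2 assms by auto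
  show "Y_w p q y * Y_v p q y = Q y"
  proof -
    define A where "A = a0 - y^2"
    have "A \<noteq> 0" using n by (simp add: A_def)
    then show ?thesis unfolding Y_w_def Y_v_def Q_def N_def[symmetric] A_def[symmetric] by simp
  qed
  show "Y_w p q y = 4 * y^2 + Q y"
    using n by (simp add: Y_w_def Q_def N_def field_simps power2_eq_square power3_eq_cube)
  show "Y_w p q y * Y_f p q y = - 2 * y * (1 - y) / 3 + Q y / 6"
  proof -
    have "Y_w p q y * Y_f p q y = (a0 - 2 * y + y^2) / (3 * (1 - y))"
    proof -
      define A M where "A = a0 - y^2" and "M = a0 - 2 * y + y^2"
      have "A \<noteq> 0" using n by (simp add: A_def)
      then have "2 * A / (1 - y) * (M / (6 * A)) = M / (3 * (1 - y))" using n by (simp add: field_simps)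
      then show ?thesis unfolding Y_w_def Y_f_def A_def M_def .
    qed
    also have "\<dots> = - 2 * y * (1 - y) / 3 + Q y / 6"
      using n by (simp add: Q_def N_def field_simps power2_eq_square power3_eq_cube)
    finally show ?thesis .
  qed
  show "Y_v p q y / 9 + Y_w p q y * (Y_f p q y * Y_f p q y) = (1 - y)^2 / 9 + Q y / 36"
  proof -
    have "Y_w p q y * (Y_f p q y * Y_f p q y) = (a0 - 2 * y + y^2)^2 / (18 * (1 - y) * (a0 - y^2))"
    proof -
      define A M where "A = a0 - y^2" and "M = a0 - 2 * y + y^2"
      have "A \<noteq> 0" using n by (simp add: A_def)
      then have "2 * A / (1 - y) * (M / (6 * A) * (M / (6 * A))) = M^2 / (18 * (1 - y) * A)"
        using n by (simp add: field_simps power2_eq_square)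
      then show ?thesis unfolding Y_w_def Y_f_def A_def M_def .
    qed
    moreover have "Y_v p q y = N y / (a0 - y^2)" by (simp add: Y_v_def N_def)
    ultimately have "Y_v p q y / 9 + Y_w p q y * (Y_f p q y * Y_f p q y) =
        (2 * (1 - y) * N y + (a0 - 2 * y + y^2)^2) / (18 * (1 - y) * (a0 - y^2))"
      using n by (simp add: add_frac_eq) (simp add: divide_simps, simp add: algebra_simps)
    also have "2 * (1 - y) * N y + (a0 - 2 * y + y^2)^2 = (2 * (1 - y)^3 + N y) * (a0 - y^2)"
      unfolding N_def by algebra
    also have "\<dots> / (18 * (1 - y) * (a0 - y^2)) = (2 * (1 - y)^3 + N y) / (18 * (1 - y))"
      using n by simp
    also have "\<dots> = (1 - y)^2 / 9 + Q y / 36"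
      using n by (simp add: Q_def field_simps power2_eq_square power3_eq_cube)
    finally show ?thesis .
  qed
qed

section \<open>A foliated chart of \<open>Y\<^sup>p\<^sup>,\<^sup>q\<close>\<close>


text \<open>Coordinates (\<theta>, \<phi>, y, \<beta>, t) adapted to the foliation: \<psi> = 3 t and
  \<alpha> = - \<beta> / 6 - t / 2, so the t-direction is \<xi> and - 6 \<alpha> - \<psi> gives back
  \<beta>.\<close>

definition iota :: "E5 \<Rightarrow> E5" where
  "iota z = mk (fst z $ 1) (fst z $ 2) (fst z $ 3) (3 * snd z) (- (fst z $ 4) / 6 - snd z / 2)"

definition iota_inv :: "E5 \<Rightarrow> E5" where
  "iota_inv c = (vector [fst c $ 1, fst c $ 2, fst c $ 3, - 6 * snd c - fst c $ 4], fst c $ 4 / 3)"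

definition D0 :: "(real^4) set" where
  "D0 = {x. 0 < x $ 1 \<and> x $ 1 < pi \<and> y1 < x $ 3 \<and> x $ 3 < y2}"

text \<open>All angular coordinates range over the whole line, which parametrisations allow since
  they need not be injective. The leaf factor is thereby connected and the domain invariant under
  shifts in t.\<close>

definition kappa0 :: "E5 set param" where
  "kappa0 = (D0 \<times> UNIV, \<lambda>z. Y_point p q (iota z))"

lemma iota_inverse: "iota (iota_inv c) = c" "iota_inv (iota z) = z"
proof -
  show "iota (iota_inv c) = c" by (rule E5_eqI) (simp_all add: iota_def iota_inv_def mk_def field_simps)
  show "iota_inv (iota z) = z" by (rule E5_eqI) (simp_all add: iota_def iota_inv_def mk_def field_simps)
qed

lemma bounded_linear_iota: "bounded_linear iota"
  unfolding linear_conv_bounded_linear[symmetric]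
  by (rule linearI; rule E5_eqI) (simp_all add: iota_def mk_def algebra_simps diff_divide_distrib add_divide_distrib)

lemma bounded_linear_iota_inv: "bounded_linear iota_inv"
  unfolding linear_conv_bounded_linear[symmetric]
  by (rule linearI; rule E5_eqI) (simp_all add: iota_inv_def mk_def algebra_simps add_divide_distrib)

lemma bij_iota: "bij iota" "bij iota_inv"
  by (metis bijI' iota_inverse)+

lemma open_D0: "open D0"
  unfolding D0_def by (intro open_Collect_conj open_Collect_less continuous_intros)

lemma open_D0_UNIV: "open (D0 \<times> (UNIV :: real set))"
  by (simp add: open_Times open_D0)

lemma Y_coords_domain: "c \<in> fst (Y_coords p q) \<longleftrightarrow> fst c \<in> D0"
  by (simp add: Y_coords_def D0_def)

lemma open_coords: "open (fst (Y_coords p q))"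
proof -
  have "fst (Y_coords p q) = fst -` D0" using Y_coords_domain by auto
  then show ?thesis using open_vimage_fst[OF open_D0] by simp
qed

lemma snd_Y_coords: "snd (Y_coords p q) = Y_point p q"
  by (simp add: Y_coords_def)

lemma iota_domain: "iota z \<in> fst (Y_coords p q) \<longleftrightarrow> fst z \<in> D0"
  by (simp add: Y_coords_domain D0_def iota_def mk_def)

definition coframe :: "real^4 \<Rightarrow> 4 \<Rightarrow> real^4 \<Rightarrow> real" where
  "coframe x i a = (if i = 1 then sqrt (P (x $ 3)) * a $ 1 else if i = 2 then sqrt (P (x $ 3)) * sin (x $ 1) * a $ 2
     else if i = 3 then a $ 3 / sqrt (Q (x $ 3)) else sqrt (Q (x $ 3)) / 6 * (a $ 4 + cos (x $ 1) * a $ 2))"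

definition frame :: "real^4 \<Rightarrow> 4 \<Rightarrow> real^4" where
  "frame x i = (if i = 1 then vector [1 / sqrt (P (x $ 3)), 0, 0, 0]
     else if i = 2 then vector [0, 1 / (sqrt (P (x $ 3)) * sin (x $ 1)), 0, - cos (x $ 1) / (sqrt (P (x $ 3)) * sin (x $ 1))]
     else if i = 3 then vector [0, 0, sqrt (Q (x $ 3)), 0] else vector [0, 0, 0, 6 / sqrt (Q (x $ 3))])"

text \<open>The contact form (1 - y) (d\<psi> - cos \<theta> d\<phi>) / 3 - 2 y d\<alpha> in the
  coordinates of \<open>iota\<close>.\<close>

definition eta0 :: "real^4 \<Rightarrow> E5 \<Rightarrow> real" where
  "eta0 x b = snd b - (1 - x $ 3) / 3 * cos (x $ 1) * fst b $ 2 + x $ 3 / 3 * fst b $ 4"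

lemma D0_pos:
  assumes "x \<in> D0"
  shows "0 < P (x $ 3)" "0 < Q (x $ 3)" "0 < sin (x $ 1)" "x $ 3 < 1" "y1 < x $ 3" "x $ 3 < y2"
  using assms P_pos Q_pos y2 by (auto simp: D0_def intro: sin_gt_zero)

lemma coframe_frame: "x \<in> D0 \<Longrightarrow> coframe x i (frame x j) = (if i = j then 1 else 0)"
  using D0_pos[of x] exhaust_4[of i] exhaust_4[of j] by (auto simp: coframe_def frame_def)

lemma linear_coframe: "linear (coframe x i)"
  by (rule linearI) (auto simp: coframe_def algebra_simps add_divide_distrib)

lemma Y_form_iota:
  assumes "fst z \<in> D0"
  shows "Y_form p q (iota z) (iota b) (iota c) = eta0 (fst z) b * eta0 (fst z) c
    + (\<Sum>i\<in>UNIV. coframe (fst z) i (fst b) * coframe (fst z) i (fst c))"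
proof -
  define y where "y = fst z $ 3"
  have y: "y1 < y" "y < y2" and PQ: "0 < P y" "0 < Q y" using D0_pos[OF assms] by (auto simp: y_def)
  note Y = Y_identities[OF y]
  \<comment> \<open>The pullbacks under \<open>iota\<close> of d\<psi> - cos \<theta> d\<phi> and of
    d\<alpha>; the angular part of the metric is a quadratic form in these two.\<close>
  define \<sigma> where "\<sigma> b = 3 * snd b - cos (fst z $ 1) * fst b $ 2" for b :: E5
  define \<delta> where "\<delta> b = - (fst b $ 4) / 6 - snd b / 2" for b :: E5
  have e: "eta0 (fst z) b = (1 - y) / 3 * \<sigma> b - 2 * y * \<delta> b" for b
    by (simp add: eta0_def \<sigma>_def \<delta>_def field_simps flip: y_def)
  have c4: "fst b $ 4 + cos (fst z $ 1) * fst b $ 2 = - 6 * \<delta> b - \<sigma> b" for b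
    by (simp add: \<sigma>_def \<delta>_def)
  have ss: "(sqrt r * u) * (sqrt r * v) = r * (u * v)" if "0 < r" for r u v :: real
  proof -
    have "(sqrt r * u) * (sqrt r * v) = (sqrt r * sqrt r) * (u * v)" by (simp only: mult_ac)
    then show ?thesis using that by simp
  qed
  have cof4: "coframe (fst z) 4 (fst b) = sqrt (Q y) * (- (6 * \<delta> b + \<sigma> b) / 6)" for b
    by (simp add: coframe_def c4 flip: y_def)
  have "coframe (fst z) 4 (fst b) * coframe (fst z) 4 (fst c) = Q y * ((- (6 * \<delta> b + \<sigma> b) / 6) * (- (6 * \<delta> c + \<sigma> c) / 6))"
    unfolding cof4 by (rule ss[OF PQ(2)])
  moreover have "coframe (fst z) 1 (fst b) * coframe (fst z) 1 (fst c) = P y * (fst b $ 1 * fst c $ 1)"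
    using ss[OF PQ(1)] by (simp add: coframe_def flip: y_def)
  moreover have "coframe (fst z) 2 (fst b) * coframe (fst z) 2 (fst c) = P y * ((sin (fst z $ 1) * fst b $ 2) * (sin (fst z $ 1) * fst c $ 2))"
    using ss[OF PQ(1)] by (simp add: coframe_def mult.assoc flip: y_def)
  moreover have "coframe (fst z) 3 (fst b) * coframe (fst z) 3 (fst c) = fst b $ 3 * fst c $ 3 / Q y"
    using PQ by (simp add: coframe_def flip: y_def)
  ultimately have R: "(\<Sum>i\<in>UNIV. coframe (fst z) i (fst b) * coframe (fst z) i (fst c)) =
    P y * (fst b $ 1 * fst c $ 1 + (sin (fst z $ 1))^2 * (fst b $ 2 * fst c $ 2))
    + fst b $ 3 * fst c $ 3 / Q y + Q y / 36 * ((6 * \<delta> b + \<sigma> b) * (6 * \<delta> c + \<sigma> c))"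
    by (simp add: sum_4 algebra_simps power2_eq_square)
  have "Y_form p q (iota z) (iota b) (iota c) =
     P y * (fst b $ 1 * fst c $ 1 + (sin (fst z $ 1))^2 * (fst b $ 2 * fst c $ 2))
     + fst b $ 3 * fst c $ 3 / Q y
     + (Y_v p q y / 9 * (\<sigma> b * \<sigma> c) + Y_w p q y * ((\<delta> b + Y_f p q y * \<sigma> b) * (\<delta> c + Y_f p q y * \<sigma> c)))"
    by (simp add: Y_form_def iota_def mk_def \<sigma>_def \<delta>_def P_def Y(1) Let_def flip: y_def)
  also have "Y_v p q y / 9 * (\<sigma> b * \<sigma> c) + Y_w p q y * ((\<delta> b + Y_f p q y * \<sigma> b) * (\<delta> c + Y_f p q y * \<sigma> c))
    = (Y_v p q y / 9 + Y_w p q y * (Y_f p q y * Y_f p q y)) * (\<sigma> b * \<sigma> c) + Y_w p q y * (\<delta> b * \<delta> c)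
      + (Y_w p q y * Y_f p q y) * (\<sigma> b * \<delta> c + \<delta> b * \<sigma> c)"
    by (simp add: algebra_simps)
  also have "\<dots> = ((1 - y) / 3 * \<sigma> b - 2 * y * \<delta> b) * ((1 - y) / 3 * \<sigma> c - 2 * y * \<delta> c)
      + Q y / 36 * ((6 * \<delta> b + \<sigma> b) * (6 * \<delta> c + \<sigma> c))"
    unfolding Y(4) unfolding Y(3) unfolding Y(2) by (simp add: field_simps power2_eq_square)
  finally show ?thesis unfolding R e by simp
qed

end

section \<open>Local diffeomorphisms and membership in a smooth structure\<close>

lemma local_diffeo_on_linear:
  assumes "bounded_linear f" "bij f" "open S"
  shows "local_diffeo_on S f"
  using assms smooth_on_bounded_linear[OF assms(1,3)] frechet_derivative_eq[OF bounded_linear_imp_has_derivative[OF assms(1)]]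
  by (simp add: local_diffeo_on_def)

lemma local_diffeo_on_compose:
  fixes f :: "'a::real_normed_vector \<Rightarrow> 'b::euclidean_space" and h :: "'b \<Rightarrow> 'c::real_normed_vector"
  assumes "open S" "open T" "local_diffeo_on S f" "f ` S \<subseteq> T" "local_diffeo_on T h"
  shows "local_diffeo_on S (\<lambda>x. h (f x))"
proof -
  have s: "smooth_on S f" "smooth_on T h" using assms by (auto simp: local_diffeo_on_def)
  have "bij (frechet_derivative (\<lambda>x. h (f x)) (at x))" if x: "x \<in> S" for x
  proof -
    have fx: "f x \<in> T" using assms(4) x by auto
    have "frechet_derivative (\<lambda>x. h (f x)) (at x) = (\<lambda>v. frechet_derivative h (at (f x)) (frechet_derivative f (at x) v))"
      by (rule frechet_derivative_eq[OF has_derivative_compose[where f=f and g=h, OF smooth_on_deriv[OF s(1) x] smooth_on_deriv[OF s(2) fx]]])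
    then show ?thesis
      using assms(3,5) x fx bij_comp[of "frechet_derivative f (at x)" "frechet_derivative h (at (f x))"]
      by (simp add: local_diffeo_on_def o_def)
  qed
  then show ?thesis
    using smooth_on_compose[OF assms(1,2,4) s] by (simp add: local_diffeo_on_def)
qed

lemma local_diffeo_on_subset: "local_diffeo_on S f \<Longrightarrow> T \<subseteq> S \<Longrightarrow> local_diffeo_on T f"
  by (auto simp: local_diffeo_on_def intro: smooth_on_subset)

lemma smooth_structureI:
  assumes "(D, Z) \<in> A0" "open V" "local_diffeo_on V G" "G ` V \<subseteq> D" "\<And>w. w \<in> V \<Longrightarrow> X w = Z (G w)"
  shows "(V, X) \<in> smooth_structure A0"
  unfolding smooth_structure_def using assms by blast

section \<open>Metric, Reeb field and transverse 2-form in the foliated chart\<close>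

locale Y_geometry = Y_params +
  fixes g :: "E5 set metric" and \<xi> :: "E5 set vfield"
  assumes metric: "Y_metric p q g" and reeb_field: "Y_reeb p q \<xi>"
begin

lemma coords_in: "Y_coords p q \<in> Y_structure p q"
proof -
  obtain D Z where DZ: "Y_coords p q = (D, Z)" by (cases "Y_coords p q")
  then have "open D" using open_coords by simp
  then show ?thesis
    unfolding Y_structure_def DZ
    by (intro smooth_structureI[where D=D and Z=Z and G="\<lambda>x. x"])
      (auto intro!: local_diffeo_on_linear bounded_linear_ident simp: bij_id[unfolded id_def])
qed

lemma kappa0_in: "kappa0 \<in> Y_structure p q"
  unfolding Y_structure_def kappa0_def
proof (rule smooth_structureI[where G=iota])
  show "(fst (Y_coords p q), snd (Y_coords p q)) \<in> {Y_coords p q, Y_corner p q 1 y1 y2, Y_corner p q 1 y2 y1,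
      Y_corner p q (-1) y1 y2, Y_corner p q (-1) y2 y1}" by simp
  show "Y_point p q (iota w) = snd (Y_coords p q) (iota w)" for w by (simp add: snd_Y_coords)
qed (auto intro!: local_diffeo_on_linear bounded_linear_iota bij_iota open_D0_UNIV simp: iota_domain)

lemma transition_iota: "transition kappa0 (Y_coords p q) (D0 \<times> UNIV) iota"
  by (auto simp: transition_def kappa0_def open_D0_UNIV iota_domain snd_Y_coords
      intro!: local_diffeo_on_linear bounded_linear_iota bij_iota)

lemma D_iota: "frechet_derivative iota (at z) = iota"
  by (rule frechet_derivative_eq[OF bounded_linear_imp_has_derivative[OF bounded_linear_iota]])

lemma g_kappa0:
  assumes "z \<in> D0 \<times> UNIV"
  shows "g kappa0 z b c = eta0 (fst z) b * eta0 (fst z) c + (\<Sum>i\<in>UNIV. coframe (fst z) i (fst b) * coframe (fst z) i (fst c))"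
proof -
  have m: "riemannian_metric (Y_structure p q) g" using metric by (simp add: Y_metric_def)
  have z: "fst z \<in> D0" using assms by auto
  have "g kappa0 z b c = g (Y_coords p q) (iota z) (iota b) (iota c)"
    using riemannian_metricD(3)[OF m kappa0_in coords_in transition_iota assms] by (simp add: D_iota)
  also have "\<dots> = Y_form p q (iota z) (iota b) (iota c)"
    using metric iota_domain z unfolding Y_metric_def by blast
  finally show ?thesis using Y_form_iota[OF z] by simp
qed

lemma xi_kappa0:
  assumes "z \<in> D0 \<times> UNIV"
  shows "\<xi> kappa0 z = (0, 1)"
proof -
  have z: "fst z \<in> D0" using assms by auto
  have "iota (\<xi> kappa0 z) = \<xi> (Y_coords p q) (iota z)"
    using reeb_field kappa0_in coords_in transition_iota assms D_iota unfolding Y_reeb_def vector_field_def by metis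
  also have "\<dots> = mk 0 0 0 3 (- 1 / 2)"
    using reeb_field iota_domain z by (simp add: Y_reeb_def)
  also have "\<dots> = iota (0, 1)" by (simp add: iota_def)
  finally show ?thesis by (metis iota_inverse(2))
qed

lemma kappa0_chart: "foliated_chart g \<xi> kappa0 D0 UNIV"
proof
  have m: "riemannian_metric (Y_structure p q) g" using metric by (simp add: Y_metric_def)
  show d: "fst kappa0 = D0 \<times> UNIV" by (simp add: kappa0_def)
  show "inner_form (g kappa0 w)" if "w \<in> D0 \<times> UNIV" for w
    using riemannian_metricD(1)[OF m kappa0_in] that d by simp
  show s: "smooth_on (D0 \<times> UNIV) (\<lambda>w. g kappa0 w a b)" for a b
    using riemannian_metricD(2)[OF m kappa0_in, of a b] d by simp
  show "\<xi> kappa0 w = (0, 1)" if "w \<in> D0 \<times> UNIV" for w by (rule xi_kappa0[OF that])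
  show "frechet_derivative (\<lambda>z. g kappa0 z a b) (at w) (0, 1) = 0" if w: "w \<in> D0 \<times> UNIV" for w a b
  proof -
    note dg = smooth_on_deriv[OF s w, of a b]
    have "((\<lambda>t. g kappa0 (w + t *\<^sub>R (0, 1)) a b) has_derivative (\<lambda>t. frechet_derivative (\<lambda>z. g kappa0 z a b) (at w) (t *\<^sub>R (0, 1)))) (at 0)"
      by (rule has_derivative_compose[where f="\<lambda>t. w + t *\<^sub>R (0, 1)" and g="\<lambda>z. g kappa0 z a b"])
        (use dg in \<open>auto intro!: derivative_eq_intros simp flip: zero_prod_def\<close>)
    \<comment> \<open>No coefficient in \<open>g_kappa0\<close> involves the leaf
      coordinate.\<close>
    moreover have "g kappa0 (w + t *\<^sub>R (0, 1)) a b = g kappa0 w a b" for t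
      using w g_kappa0[of "w + t *\<^sub>R (0, 1)" a b] g_kappa0[OF w, of a b] by (cases w) auto
    ultimately have "((\<lambda>t. g kappa0 w a b) has_derivative (\<lambda>t. frechet_derivative (\<lambda>z. g kappa0 z a b) (at w) (t *\<^sub>R (0, 1)))) (at (0::real))"
      by simp
    then have "(\<lambda>t. frechet_derivative (\<lambda>z. g kappa0 z a b) (at w) (t *\<^sub>R (0, 1))) = (\<lambda>t::real. 0)"
      using has_derivative_unique[OF _ has_derivative_const] by blast
    from fun_cong[OF this, of 1] show ?thesis by simp
  qed
qed (auto simp: open_D0)

sublocale K: foliated_chart g \<xi> kappa0 D0 UNIV by (rule kappa0_chart)

lemma H_kappa0:
  assumes "z \<in> D0 \<times> UNIV"
  shows "K.H z b c = (\<Sum>i\<in>UNIV. coframe (fst z) i b * coframe (fst z) i c)"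
  unfolding K.H_def g_kappa0[OF assms] by (simp add: eta0_def linear_0[OF linear_coframe])

lemma H_frame:
  assumes "z \<in> D0 \<times> UNIV"
  shows "K.H z (frame (fst z) i) b = coframe (fst z) i b"
  using assms by (auto simp: H_kappa0 coframe_frame if_distrib[of "\<lambda>x. x * _"] cong: if_cong)

lemma orthonormal_frame0: "z \<in> D0 \<times> UNIV \<Longrightarrow> orthonormal (K.H z) (frame (fst z))"
  by (auto simp: orthonormal_def H_frame coframe_frame)

lemma om_kappa0:
  assumes "z \<in> D0 \<times> UNIV"
  shows "K.om z b c = wedge1 (coframe (fst z) 1) (coframe (fst z) 2) b c + wedge1 (coframe (fst z) 3) (coframe (fst z) 4) b c"
proof -
  have z: "fst z \<in> D0" using assms by auto
  \<comment> \<open>As the component of the metric against the leaf direction is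
    \<open>eta0\<close>, this is the derivative of \<eta>; \<open>omega_H_eq\<close> antisymmetrises
    it on horizontal lifts.\<close>
  have dhK: "K.m.dh z v (0, 1) b = (fst v $ 3 / 3 * cos (fst z $ 1) + (1 - fst z $ 3) / 3 * sin (fst z $ 1) * fst v $ 1) * fst b $ 2
      + fst v $ 3 / 3 * fst b $ 4" for v b
  proof (rule K.m.dh_eqI[OF assms])
    show "((\<lambda>z. eta0 (fst z) b) has_derivative
      (\<lambda>v. (fst v $ 3 / 3 * cos (fst z $ 1) + (1 - fst z $ 3) / 3 * sin (fst z $ 1) * fst v $ 1) * fst b $ 2
      + fst v $ 3 / 3 * fst b $ 4)) (at z)"
      unfolding eta0_def by (auto intro!: derivative_eq_intros has_derivative_fst_nth simp: field_simps)
    show "eta0 (fst z) b = g kappa0 z (0, 1) b" if "z \<in> D0 \<times> UNIV" for z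
      unfolding g_kappa0[OF that] by (simp add: eta0_def linear_0[OF linear_coframe])
  qed
  have "K.om z b c = P (fst z $ 3) * sin (fst z $ 1) * (b $ 1 * c $ 2 - c $ 1 * b $ 2)
     + 1 / 6 * (b $ 3 * (c $ 4 + cos (fst z $ 1) * c $ 2) - c $ 3 * (b $ 4 + cos (fst z $ 1) * b $ 2))"
    unfolding K.omega_H_eq[OF assms] dhK by (simp add: K.lift_def P_def field_simps)
  also have "\<dots> = wedge1 (coframe (fst z) 1) (coframe (fst z) 2) b c + wedge1 (coframe (fst z) 3) (coframe (fst z) 4) b c"
  proof -
    have sq: "sqrt (P (fst z $ 3)) * sqrt (P (fst z $ 3)) = P (fst z $ 3)" "sqrt (Q (fst z $ 3)) \<noteq> 0"
      using D0_pos[OF z] by auto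
    have "wedge1 (coframe (fst z) 1) (coframe (fst z) 2) b c =
      (sqrt (P (fst z $ 3)) * sqrt (P (fst z $ 3))) * sin (fst z $ 1) * (b $ 1 * c $ 2 - c $ 1 * b $ 2)"
      by (simp add: wedge1_def coframe_def algebra_simps)
    moreover have "wedge1 (coframe (fst z) 3) (coframe (fst z) 4) b c =
      1 / 6 * (b $ 3 * (c $ 4 + cos (fst z $ 1) * c $ 2) - c $ 3 * (b $ 4 + cos (fst z $ 1) * b $ 2))"
      using sq(2) by (simp add: wedge1_def coframe_def field_simps)
    ultimately show ?thesis unfolding sq(1) by simp
  qed
  finally show ?thesis .
qed

text \<open>The square of a form e12 + e34 is twice the volume form; this is the constant that the
  passage to the closure of the chart relies on.\<close>

lemma wedge_frame0: "z \<in> D0 \<times> UNIV \<Longrightarrow> wedge (K.om z) (K.om z) (frame (fst z)) = 2"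
  by (auto simp: wedge_def om_kappa0 wedge1_def coframe_frame)

lemma oriented_frame0: "z \<in> D0 \<times> UNIV \<Longrightarrow> oriented (K.H z) (K.om z) (frame (fst z))"
  using orthonormal_frame0 wedge_frame0 by (auto simp: oriented_def)

end

section \<open>Parallel gauge transformations in the foliated chart\<close>

context Y_params begin

definition dcoframe :: "real^4 \<Rightarrow> real^4 \<Rightarrow> 4 \<Rightarrow> real^4 \<Rightarrow> real" where
  "dcoframe x v i b = (let p = sqrt (P (x $ 3)); s = sqrt (Q (x $ 3)) in
     if i = 1 then - v $ 3 / (12 * p) * b $ 1
     else if i = 2 then - v $ 3 / (12 * p) * sin (x $ 1) * b $ 2 + p * cos (x $ 1) * v $ 1 * b $ 2
     else if i = 3 then - Q' (x $ 3) * v $ 3 / (2 * s * s * s) * b $ 3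
     else Q' (x $ 3) * v $ 3 / (12 * s) * (b $ 4 + cos (x $ 1) * b $ 2) - s / 6 * sin (x $ 1) * v $ 1 * b $ 2)"

text \<open>The solution of Cartan's first structure equation for \<open>coframe\<close>;
  \<open>c\<close> lists the entries above the diagonal. Writing \<omega> for it and e1, e2, e4 for
  the coframe forms, the combinations that act on anti-self-dual forms are \<omega>12 - \<omega>34 =
  (k + Q' / (2 s)) e4 - cos \<theta> d\<phi>, \<omega>13 + \<omega>24 = - 2 k e1 and \<omega>14 -
  \<omega>23 = 2 k e2.\<close>

definition connection :: "real^4 \<Rightarrow> real^4 \<Rightarrow> 4 \<Rightarrow> 4 \<Rightarrow> real" where
  "connection x v i j = (let p = sqrt (P (x $ 3)); s = sqrt (Q (x $ 3)); k = s / (12 * p * p);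
      c = (\<lambda>i j::4. if i = 1 \<and> j = 2 then k * coframe x 4 v - cos (x $ 1) * v $ 2
        else if i = 3 \<and> j = 4 then - Q' (x $ 3) / (2 * s) * coframe x 4 v
        else if i = 1 \<and> j = 3 \<or> i = 2 \<and> j = 4 then - k * coframe x 1 v
        else if i = 2 \<and> j = 3 then - k * coframe x 2 v
        else if i = 1 \<and> j = 4 then k * coframe x 2 v else 0)
    in c i j - c j i)"

lemma connection_skew: "connection x v i j = - connection x v j i"
  by (simp add: connection_def Let_def)

lemma has_derivative_nth_compose:
  assumes "(f has_real_derivative d) (at (x $ i))"
  shows "((\<lambda>x. f (x $ i)) has_derivative (\<lambda>v. d * v $ i)) (at (x :: real^'n))"
  using has_derivative_compose[where f="\<lambda>x. x $ i" and g=f, OF bounded_linear_imp_has_derivative[OF bounded_linear_vec_nth]]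
    assms by (simp add: has_field_derivative_def)

lemma coframe_has_derivative:
  assumes "x \<in> D0"
  shows "((\<lambda>x. coframe x i b) has_derivative (\<lambda>v. dcoframe x v i b)) (at x)"
proof -
  note pos = D0_pos[OF assms]
  define p s where "p = sqrt (P (x $ 3))" and "s = sqrt (Q (x $ 3))"
  have "((\<lambda>y. sqrt (P y)) has_real_derivative - 1 / (12 * p)) (at (x $ 3))"
    unfolding p_def using pos by (auto simp: P_def field_simps intro!: derivative_eq_intros)
  note dP = has_derivative_nth_compose[OF this]
  have "((\<lambda>y. sqrt (Q y)) has_real_derivative Q' (x $ 3) / (2 * s)) (at (x $ 3))"
    unfolding s_def using pos by (auto simp: field_simps intro!: derivative_eq_intros Q_deriv)
  note dQ = has_derivative_nth_compose[OF this]
  have "((\<lambda>y. 1 / sqrt (Q y)) has_real_derivative - Q' (x $ 3) / (2 * s * s * s)) (at (x $ 3))"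
    unfolding s_def using pos
    by (auto simp: field_simps intro!: derivative_eq_intros Q_deriv)
  note dR = has_derivative_nth_compose[OF this]
  have sin: "((\<lambda>x. sin (x $ 1)) has_derivative (\<lambda>v. cos (x $ 1) * v $ 1)) (at x)"
    and cos: "((\<lambda>x. cos (x $ 1)) has_derivative (\<lambda>v. - sin (x $ 1) * v $ 1)) (at x)"
    by (rule has_derivative_nth_compose, rule DERIV_sin, rule has_derivative_nth_compose, rule DERIV_cos)
  consider "i = 1" | "i = 2" | "i = 3" | "i = 4" using exhaust_4 by blast
  then show ?thesis
  proof cases
    case 1
    have c: "(\<lambda>x. coframe x i b) = (\<lambda>x. sqrt (P (x $ 3)) * b $ 1)" by (simp add: coframe_def 1)
    \<comment> \<open>Put in exactly the shape produced by the product rule, including the vanishing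
      derivative of the constant factor, so that the rules for derivatives match syntactically. The
      other cases are treated alike.\<close>
    have d: "(\<lambda>v. dcoframe x v i b) = (\<lambda>v. sqrt (P (x $ 3)) * 0 + - 1 / (12 * p) * v $ 3 * b $ 1)"
      by (simp add: dcoframe_def 1 Let_def p_def)
    show ?thesis unfolding c d by (intro has_derivative_mult dP has_derivative_const)
  next
    case 2
    have c: "(\<lambda>x. coframe x i b) = (\<lambda>x. (sqrt (P (x $ 3)) * sin (x $ 1)) * b $ 2)" by (simp add: coframe_def 2)
    have d: "(\<lambda>v. dcoframe x v i b) = (\<lambda>v. (sqrt (P (x $ 3)) * sin (x $ 1)) * 0 +
       (sqrt (P (x $ 3)) * (cos (x $ 1) * v $ 1) + - 1 / (12 * p) * v $ 3 * sin (x $ 1)) * b $ 2)"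
      by (simp add: dcoframe_def 2 Let_def p_def algebra_simps)
    show ?thesis unfolding c d by (intro has_derivative_mult dP sin has_derivative_const)
  next
    case 3
    have c: "(\<lambda>x. coframe x i b) = (\<lambda>x. 1 / sqrt (Q (x $ 3)) * b $ 3)" by (simp add: coframe_def 3)
    have d: "(\<lambda>v. dcoframe x v i b) = (\<lambda>v. 1 / sqrt (Q (x $ 3)) * 0 + - Q' (x $ 3) / (2 * s * s * s) * v $ 3 * b $ 3)"
      by (simp add: dcoframe_def 3 Let_def s_def)
    show ?thesis unfolding c d by (intro has_derivative_mult dR has_derivative_const)
  next
    case 4
    have c: "(\<lambda>x. coframe x i b) = (\<lambda>x. sqrt (Q (x $ 3)) * (1 / 6 * (b $ 4 + cos (x $ 1) * b $ 2)))" by (simp add: coframe_def 4)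
    have d: "(\<lambda>v. dcoframe x v i b) = (\<lambda>v. sqrt (Q (x $ 3)) * (1 / 6 * (0 + (cos (x $ 1) * 0 + - sin (x $ 1) * v $ 1 * b $ 2)) + 0 * (b $ 4 + cos (x $ 1) * b $ 2))
       + Q' (x $ 3) / (2 * s) * v $ 3 * (1 / 6 * (b $ 4 + cos (x $ 1) * b $ 2)))"
      by (simp add: dcoframe_def 4 Let_def s_def algebra_simps add_divide_distrib diff_divide_distrib)
    show ?thesis unfolding c d by (intro has_derivative_mult has_derivative_add dQ cos has_derivative_const)
  qed
qed

lemma structure_equation:
  assumes "x \<in> D0"
  shows "dcoframe x v i b + (\<Sum>j\<in>UNIV. connection x v i j * coframe x j b) = dcoframe x b i v + (\<Sum>j\<in>UNIV. connection x b i j * coframe x j v)"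
proof -
  note pos = D0_pos[OF assms]
  define p s where "p = sqrt (P (x $ 3))" and "s = sqrt (Q (x $ 3))"
  have ps: "p \<noteq> 0" "s \<noteq> 0" using pos by (simp_all add: p_def s_def)
  consider "i = 1" | "i = 2" | "i = 3" | "i = 4" using exhaust_4 by blast
  then show ?thesis
    by cases (simp_all add: sum_4 dcoframe_def connection_def coframe_def Let_def p_def[symmetric] s_def[symmetric],
        (use ps in \<open>simp add: field_simps\<close>)+)
qed

section \<open>The connection coefficients as functions of y\<close>

lemma Q_over_P: "y1 < y \<Longrightarrow> y < y2 \<Longrightarrow> Q y / P y = 12 * N y / (1 - y)^2"
  using y2 by (simp add: Q_def P_def field_simps power2_eq_square)

text \<open>The left-hand side is the d\<beta>-component of the first anti-self-dual connection
  form. In terms of u = 1 - y the polynomial parts of Q / P and Q' combine so that only (a - 1) /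
  u^2 + u remains, which is easy to compare at two points.\<close>

lemma connection_A1:
  assumes "y1 < y" "y < y2"
  shows "Q y / (72 * P y) + Q' y / 12 = ((a0 - 1) / (1 - y)^2 + (1 - y)) / 3"
proof -
  define d where "d = (1 - y)^2"
  have d: "d \<noteq> 0" using y2 assms by (simp add: d_def)
  have "Q y / (72 * P y) = (Q y / P y) / 72" by simp
  also have "\<dots> = N y / (6 * d)" unfolding Q_over_P[OF assms] d_def by simp
  finally have t: "Q y / (72 * P y) = N y / (6 * d)" .
  have "Q y / (72 * P y) + Q' y / 12 = (N y + (a0 - 1) + d * (4 * (1 - y) - 3)) / (6 * d)"
    unfolding t Q'_def d_def[symmetric] using d by (simp add: field_simps)
  also have "N y + (a0 - 1) + d * (4 * (1 - y) - 3) = 2 * ((a0 - 1) + d * (1 - y))"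
    unfolding N_def d_def by algebra
  also have "\<dots> / (6 * d) = ((a0 - 1) / d + (1 - y)) / 3" using d by (simp add: field_simps)
  finally show ?thesis unfolding d_def .
qed

text \<open>Going from 0 to a negative y, the quotient Q / P = 12 N / (1 - y)^2 decreases because N
  does and the denominator grows, while the other coefficient increases because (1 - a) / (1 - y)^2
  shrinks and 1 - y grows.\<close>

lemma separating_point:
  "\<exists>y. y1 < y \<and> y < 0 \<and> Q y / P y \<noteq> Q 0 / P 0 \<and> Q y / (72 * P y) + Q' y / 12 \<noteq> Q 0 / (72 * P 0) + Q' 0 / 12"
proof -
  \<comment> \<open>The level a / 2 lies strictly between the values 0 at \<open>y1\<close> and a at
    0, which keeps the point away from both ends.\<close>
  have "\<exists>y\<ge>y1. y \<le> 0 \<and> N y = a0 / 2"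
    by (rule IVT'[OF _ _ _ continuous_N]) (use y1 a_bounds in \<open>auto simp: N_def\<close>)
  then obtain y where y: "y1 \<le> y" "y \<le> 0" "N y = a0 / 2" by blast
  have "y \<noteq> y1" "y \<noteq> 0" using y y1 a_bounds by (auto simp: N_def)
  then have y': "y1 < y" "y < 0" "y < y2" using y y2 by auto
  have s1: "1 < (1 - y)^2" using y' by (simp add: power2_eq_square) (smt (verit) mult_less_cancel_left2)
  have "12 * N y / (1 - y)^2 < 12 * N 0 / (1 - 0)^2"
  proof -
    have "12 * N y / (1 - y)^2 < 12 * N y / 1"
      using s1 y(3) a_bounds by (intro divide_strict_left_mono) auto
    also have "\<dots> \<le> 12 * N 0" using y(3) a_bounds by (simp add: N_def)
    finally show ?thesis by simp
  qed
  then have "Q y / P y \<noteq> Q 0 / P 0" using Q_over_P[OF y'(1,3)] Q_over_P[of 0] y1 y2 by simp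
  moreover have "((a0 - 1) / (1 - 0)^2 + (1 - 0)) / 3 < ((a0 - 1) / (1 - y)^2 + (1 - y)) / 3"
  proof -
    have "(1 - a0) / (1 - y)^2 \<le> (1 - a0) / 1"
      using s1 a_bounds by (intro divide_left_mono) auto
    moreover have "(a0 - 1) / (1 - y)^2 = - ((1 - a0) / (1 - y)^2)" by (simp add: minus_divide_left)
    ultimately show ?thesis using y' by simp
  qed
  then have "Q y / (72 * P y) + Q' y / 12 \<noteq> Q 0 / (72 * P 0) + Q' 0 / 12"
    using connection_A1[OF y'(1,3)] connection_A1[of 0] y1 y2 by simp
  ultimately show ?thesis using y' by blast
qed

lemma smooth_frame0: "smooth_on (D0 \<times> (UNIV :: real set)) (\<lambda>z. frame (fst z) i)"
proof (rule smooth_on_vec[OF open_D0_UNIV])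
  fix k :: 4
  let ?V = "D0 \<times> (UNIV :: real set)"
  have c: "smooth_on ?V (\<lambda>z. fst z $ j)" for j by (rule smooth_on_fst_nth[OF open_D0_UNIV])
  have pos: "0 < P (fst z $ 3)" "0 < Q (fst z $ 3)" "sin (fst z $ 1) \<noteq> 0" "1 - fst z $ 3 \<noteq> 0" if "z \<in> ?V" for z
    using that D0_pos[of "fst z"] by auto
  have sP: "smooth_on ?V (\<lambda>z. P (fst z $ 3))"
    unfolding P_def by (intro smooth_on_divide smooth_on_diff smooth_on_const c open_D0_UNIV) auto
  have sQ: "smooth_on ?V (\<lambda>z. Q (fst z $ 3))"
    unfolding Q_def N_def
    by (intro smooth_on_divide smooth_on_diff smooth_on_add smooth_on_mult smooth_on_power smooth_on_const c open_D0_UNIV)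
      (use pos in auto)
  have sp: "smooth_on ?V (\<lambda>z. sqrt (P (fst z $ 3)))" "smooth_on ?V (\<lambda>z. sqrt (Q (fst z $ 3)))"
    by (intro smooth_on_sqrt open_D0_UNIV sP sQ pos; assumption)+
  have sc: "smooth_on ?V (\<lambda>z. sin (fst z $ 1))" "smooth_on ?V (\<lambda>z. cos (fst z $ 1))"
    by (intro smooth_on_sin smooth_on_cos open_D0_UNIV c)+
  have nz: "sqrt (P (fst z $ 3)) \<noteq> 0" "sqrt (Q (fst z $ 3)) \<noteq> 0" "sqrt (P (fst z $ 3)) * sin (fst z $ 1) \<noteq> 0" if "z \<in> ?V" for z
    using pos[OF that] by auto
  have 1: "smooth_on ?V (\<lambda>z. 1 / sqrt (P (fst z $ 3)))"
    and 2: "smooth_on ?V (\<lambda>z. 1 / (sqrt (P (fst z $ 3)) * sin (fst z $ 1)))"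
    and 3: "smooth_on ?V (\<lambda>z. - cos (fst z $ 1) / (sqrt (P (fst z $ 3)) * sin (fst z $ 1)))"
    and 4: "smooth_on ?V (\<lambda>z. 6 / sqrt (Q (fst z $ 3)))"
    by (intro smooth_on_divide smooth_on_minus smooth_on_mult smooth_on_const open_D0_UNIV sp sc nz; assumption)+
  show "smooth_on ?V (\<lambda>z. frame (fst z) i $ k)"
    using exhaust_4[of i] exhaust_4[of k] 1 2 3 4 sp(2) smooth_on_const[OF open_D0_UNIV, of 0]
    by (elim disjE) (simp_all add: frame_def)
qed

end

section \<open>The parallel transport equation for the matrix of a gauge transformation\<close>

context Y_geometry begin

lemma christoffel_coframe0:
  assumes "x \<in> D0"
  shows "coframe x i (christoffel (quotient_metric g \<xi> kappa0) x v b) = dcoframe x v i b + (\<Sum>j\<in>UNIV. connection x v i j * coframe x j b)"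
proof (rule K.q.christoffel_coframe[where \<epsilon>=coframe and E="frame x"])
  show "quotient_metric g \<xi> kappa0 z b c = (\<Sum>i\<in>UNIV. coframe z i b * coframe z i c)" if "z \<in> (if (UNIV::real set) = {} then {} else D0)" for z b c
    using K.quotient_metric[of "(z, 0)"] H_kappa0[of "(z, 0)"] that by simp
qed (use assms in \<open>simp_all add: coframe_has_derivative linear_coframe coframe_frame structure_equation\<close>, rule connection_skew)

lemma nabla_coframe:
  assumes "w \<in> D0 \<times> UNIV"
  shows "frechet_derivative (\<lambda>z. K.H z (frame (fst z) i) b) (at w) v =
     K.H w (frame (fst w) i) (K.\<Gamma> w v b)
       - (\<Sum>j\<in>UNIV. connection (fst w) (fst v) i j * K.H w (frame (fst w) j) b)"
proof -
  have w: "fst w \<in> D0" using assms by auto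
  have "((\<lambda>z. coframe (fst z) i b) has_derivative (\<lambda>v. dcoframe (fst w) (fst v) i b)) (at w)"
    by (rule has_derivative_compose[where f=fst and g="\<lambda>x. coframe x i b", OF _ coframe_has_derivative[OF w]])
      (auto intro!: derivative_eq_intros)
  then have "((\<lambda>z. K.H z (frame (fst z) i) b) has_derivative (\<lambda>v. dcoframe (fst w) (fst v) i b)) (at w)"
    by (rule has_derivative_transform_within_open[OF _ open_D0_UNIV assms]) (simp add: H_frame)
  then show ?thesis
    by (simp add: frechet_derivative_eq H_frame[OF assms] christoffel_coframe0[OF w])
qed

abbreviation basis0 :: "E5 \<Rightarrow> 3 \<Rightarrow> form2" where
  "basis0 z \<equiv> asd_basis (\<lambda>i. K.H z (frame (fst z) i))"

lemma combine_basis0_inj: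
  assumes "z \<in> D0 \<times> UNIV" "combine (basis0 z) x = combine (basis0 z) y"
  shows "x = y"
  using combine_asd_basis_eval[OF orthonormal_frame0[OF assms(1)], of x] combine_asd_basis_eval[OF orthonormal_frame0[OF assms(1)], of y]
    assms(2) by (simp add: vec_eq_iff forall_3)

text \<open>The last property is dR = R M - M R, where column k of M is
  \<open>asd_connection\<close> at k. It comes from comparing, column by column, the derivative of
  the transformed basis section with the transform of its derivative; R is smooth because u
  preserves smooth sections and coefficients in the basis are unique.\<close>

lemma parallel_matrix:
  assumes u: "gauge_transformation (Y_structure p q) g \<xi> u" and cc: "covariantly_constant (Y_structure p q) g \<xi> u"
    and fol: "foliated (Y_structure p q) \<xi> kappa0"
  obtains R where "\<And>z. z \<in> D0 \<times> UNIV \<Longrightarrow> rotation_matrix (R z)"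
    "\<And>z x. z \<in> D0 \<times> UNIV \<Longrightarrow> u kappa0 z (combine (basis0 z) x) = combine (basis0 z) (R z *v x)"
    "\<And>i j. smooth_on (D0 \<times> UNIV) (\<lambda>z. R z $ i $ j)"
    "\<And>w v i j. w \<in> D0 \<times> UNIV \<Longrightarrow> frechet_derivative (\<lambda>z. R z $ i $ j) (at w) v =
        (\<Sum>k\<in>UNIV. R w $ i $ k * asd_connection (connection (fst w) (fst v)) j $ k)
        - (\<Sum>k\<in>UNIV. R w $ k $ j * asd_connection (connection (fst w) (fst v)) k $ i)"
proof -
  let ?V = "D0 \<times> (UNIV :: real set)"
  have dom: "fst kappa0 = ?V" by (simp add: kappa0_def)
  have "\<exists>Q. rotation_matrix Q \<and> (\<forall>x. u kappa0 z (combine (basis0 z) x) = combine (basis0 z) (Q *v x))" if "z \<in> ?V" for z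
    by (rule gauge_transformationD(1)[OF u fol _ K.asd_frame_basis[OF that oriented_frame0[OF that]]]) (use that dom in simp)
  then obtain R where R: "\<And>z. z \<in> ?V \<Longrightarrow> rotation_matrix (R z)"
    "\<And>z x. z \<in> ?V \<Longrightarrow> u kappa0 z (combine (basis0 z) x) = combine (basis0 z) (R z *v x)" by metis
  \<comment> \<open>The basis sections: u maps the j-th one to the j-th column of R, and its own
    covariant derivative is just the j-th column of the connection matrix.\<close>
  define \<beta> where "\<beta> j z = combine (basis0 z) (axis j 1)" for j z
  have sec: "asd_section g \<xi> kappa0 ?V (\<beta> j)" for j
    unfolding \<beta>_def
    by (rule K.asd_section_combine[OF open_D0_UNIV subset_refl smooth_frame0 oriented_frame0 smooth_on_const[OF open_D0_UNIV]])
  have usec: "asd_section g \<xi> kappa0 ?V (\<lambda>z. u kappa0 z (\<beta> j z))" for j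
    by (rule gauge_transformationD(2)[OF u fol open_D0_UNIV _ sec]) (simp add: dom)
  have ub: "u kappa0 z (\<beta> j z) = combine (basis0 z) (column j (R z))" if "z \<in> ?V" for j z
    unfolding \<beta>_def R(2)[OF that] by (simp add: matrix_vector_mult_basis)
  have sR: "smooth_on ?V (\<lambda>z. column j (R z) $ i)" for i j
  proof -
    obtain c where c: "\<And>k. smooth_on ?V (\<lambda>z. c z $ k)" "\<And>z. z \<in> ?V \<Longrightarrow> u kappa0 z (\<beta> j z) = combine (basis0 z) (c z)"
      using K.asd_section_coefficients[OF open_D0_UNIV subset_refl smooth_frame0 oriented_frame0 usec[of j]] by blast
    show ?thesis
    proof (rule smooth_on_cong[OF c(1)[of i] open_D0_UNIV])
      fix z assume z: "z \<in> ?V"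
      have "combine (basis0 z) (c z) = combine (basis0 z) (column j (R z))"
        using c(2)[OF z] ub[OF z, of j] by metis
      then have "c z = column j (R z)" by (rule combine_basis0_inj[OF z])
      then show "c z $ i = column j (R z) $ i" by simp
    qed
  qed
  have eq: "frechet_derivative (\<lambda>z. R z $ i $ j) (at w) v =
        (\<Sum>k\<in>UNIV. R w $ i $ k * asd_connection (connection (fst w) (fst v)) j $ k)
        - (\<Sum>k\<in>UNIV. R w $ k $ j * asd_connection (connection (fst w) (fst v)) k $ i)" if w: "w \<in> ?V" for w v i j
  proof -
    let ?M = "asd_connection (connection (fst w) (fst v))"
    note tn = K.transverse_nabla_section[OF open_D0_UNIV w subset_refl smooth_frame0 oriented_frame0]
    have "transverse_nabla g \<xi> kappa0 (\<lambda>z. u kappa0 z (\<beta> j z)) w v = combine (basis0 w)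
      ((\<chi> k. frechet_derivative (\<lambda>z. column j (R z) $ k) (at w) v) + (\<Sum>k\<in>UNIV. column j (R w) $ k *\<^sub>R ?M k))"
      by (rule tn[where c="\<lambda>z. column j (R z)", OF _ usec sR ub connection_skew nabla_coframe[OF w]])
    moreover have "transverse_nabla g \<xi> kappa0 (\<beta> j) w v = combine (basis0 w)
      ((\<chi> k. frechet_derivative (\<lambda>z. axis j 1 $ k) (at w) v) + (\<Sum>k\<in>UNIV. axis j 1 $ k *\<^sub>R ?M k))"
      by (rule tn[where c="\<lambda>z. axis j 1", OF _ sec smooth_on_const[OF open_D0_UNIV] _ connection_skew nabla_coframe[OF w]])
        (simp_all add: \<beta>_def)
    moreover have "(\<chi> k. frechet_derivative (\<lambda>z. axis j 1 $ k) (at w) v) + (\<Sum>k\<in>UNIV. axis j 1 $ k *\<^sub>R ?M k) = ?M j"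
      by (simp add: vec_eq_iff axis_def if_distrib[of "\<lambda>x. x *\<^sub>R _"] if_distrib[of "\<lambda>x. x * _"] cong: if_cong)
    moreover have "transverse_nabla g \<xi> kappa0 (\<lambda>z. u kappa0 z (\<beta> j z)) w v = u kappa0 w (transverse_nabla g \<xi> kappa0 (\<beta> j) w v)"
      using cc[unfolded covariantly_constant_def] fol open_D0_UNIV sec dom w by blast
    ultimately have "combine (basis0 w) ((\<chi> k. frechet_derivative (\<lambda>z. column j (R z) $ k) (at w) v) + (\<Sum>k\<in>UNIV. column j (R w) $ k *\<^sub>R ?M k))
      = combine (basis0 w) (R w *v ?M j)" by (simp add: R(2)[OF w])
    then have "(\<chi> k. frechet_derivative (\<lambda>z. column j (R z) $ k) (at w) v) + (\<Sum>k\<in>UNIV. column j (R w) $ k *\<^sub>R ?M k) = R w *v ?M j"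
      by (rule combine_basis0_inj[OF w])
    then have "((\<chi> k. frechet_derivative (\<lambda>z. column j (R z) $ k) (at w) v) + (\<Sum>k\<in>UNIV. column j (R w) $ k *\<^sub>R ?M k)) $ i = (R w *v ?M j) $ i" by simp
    then show ?thesis by (simp add: column_def matrix_vector_mult_def)
  qed
  have sR': "smooth_on ?V (\<lambda>z. R z $ i $ j)" for i j using sR[of j i] by (simp add: column_def)
  show ?thesis by (rule that[OF R sR' eq])
qed

lemma parallel_identity:
  assumes u: "gauge_transformation (Y_structure p q) g \<xi> u" and cc: "covariantly_constant (Y_structure p q) g \<xi> u"
    and fol: "foliated (Y_structure p q) \<xi> kappa0" and w: "w \<in> D0 \<times> UNIV" and \<beta>: "\<beta> \<in> asd g \<xi> kappa0 w"
  shows "u kappa0 w \<beta> = \<beta>"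
proof (rule parallel_matrix[OF u cc fol])
  let ?V = "D0 \<times> (UNIV :: real set)"
  fix R assume rot: "\<And>z. z \<in> ?V \<Longrightarrow> rotation_matrix (R z)"
    and uR: "\<And>z x. z \<in> ?V \<Longrightarrow> u kappa0 z (combine (basis0 z) x) = combine (basis0 z) (R z *v x)"
    and sR: "\<And>i j. smooth_on ?V (\<lambda>z. R z $ i $ j)"
    and eq: "\<And>w v i j. w \<in> ?V \<Longrightarrow> frechet_derivative (\<lambda>z. R z $ i $ j) (at w) v =
        (\<Sum>k\<in>UNIV. R w $ i $ k * asd_connection (connection (fst w) (fst v)) j $ k)
        - (\<Sum>k\<in>UNIV. R w $ k $ j * asd_connection (connection (fst w) (fst v)) k $ i)"
  define e :: "4 \<Rightarrow> E5" where "e i = (axis i 1, 0)" for i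
  have con3: "connection x (axis 3 1) i j = 0" for x i j
    using exhaust_4[of i] exhaust_4[of j] by (auto simp: connection_def coframe_def axis_def Let_def)
  have shift_V: "z + s *\<^sub>R e 3 \<in> ?V \<longleftrightarrow> y1 < fst z $ 3 + s \<and> fst z $ 3 + s < y2" if "z \<in> ?V" for z s
    using that by (cases z) (auto simp: D0_def e_def axis_def)
  text \<open>The connection has no \<open>dy\<close>-component, so \<open>R\<close> does not depend on \<open>y\<close>.\<close>
  have const: "R (z + s *\<^sub>R e 3) $ i $ j = R z $ i $ j" if z: "z \<in> ?V" "z + s *\<^sub>R e 3 \<in> ?V" for z s i j
  proof -
    let ?I = "{y1 - fst z $ 3<..<y2 - fst z $ 3}"
    have "(\<lambda>r. R (z + r *\<^sub>R e 3) $ i $ j) s = (\<lambda>r. R (z + r *\<^sub>R e 3) $ i $ j) 0"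
    proof (rule has_derivative_zero_unique_connected[where s="?I" and f="\<lambda>r. R (z + r *\<^sub>R e 3) $ i $ j"])
      fix r assume "r \<in> ?I"
      then have r: "z + r *\<^sub>R e 3 \<in> ?V" using shift_V[OF z(1)] by auto
      note d = smooth_on_deriv[OF sR r, of i j]
      have "((\<lambda>r. R (z + r *\<^sub>R e 3) $ i $ j) has_derivative (\<lambda>h. frechet_derivative (\<lambda>z. R z $ i $ j) (at (z + r *\<^sub>R e 3)) (h *\<^sub>R e 3))) (at r)"
        by (rule has_derivative_compose[where f="\<lambda>r. z + r *\<^sub>R e 3" and g="\<lambda>z. R z $ i $ j", OF _ d])
          (auto intro!: derivative_eq_intros)
      moreover have "frechet_derivative (\<lambda>z. R z $ i $ j) (at (z + r *\<^sub>R e 3)) (h *\<^sub>R e 3) = 0" for h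
      proof -
        have "asd_connection (connection x (axis 3 1)) k = 0" for x k
          by (simp add: asd_connection_def con3 Let_def vec_eq_iff forall_3)
        then have "frechet_derivative (\<lambda>z. R z $ i $ j) (at (z + r *\<^sub>R e 3)) (e 3) = 0"
          by (subst eq[OF r]) (simp add: e_def)
        then show ?thesis using linear_cmul[OF has_derivative_linear[OF d], of h "e 3"] by simp
      qed
      ultimately show "((\<lambda>r. R (z + r *\<^sub>R e 3) $ i $ j) has_derivative (\<lambda>h. 0)) (at r)" by simp
    qed (use shift_V[OF z(1)] z shift_V[OF z(1), of 0] in auto)
    then show ?thesis by simp
  qed
  \<comment> \<open>Independence of y near z and not just at z makes the derivatives in all
    directions independent of y.\<close>
  have shift_deriv: "frechet_derivative (\<lambda>z. R z $ i $ j) (at (z + s *\<^sub>R e 3)) v = frechet_derivative (\<lambda>z. R z $ i $ j) (at z) v"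
    if z: "z \<in> ?V" "z + s *\<^sub>R e 3 \<in> ?V" for z s i j v
  proof -
    define U where "U = ?V \<inter> (\<lambda>z. z + s *\<^sub>R e 3) -` ?V"
    have U: "open U" unfolding U_def
      by (intro continuous_open_preimage open_D0_UNIV continuous_intros)
    have zU: "z \<in> U" using z by (simp add: U_def)
    have "((\<lambda>z. R (z + s *\<^sub>R e 3) $ i $ j) has_derivative (\<lambda>v. frechet_derivative (\<lambda>z. R z $ i $ j) (at (z + s *\<^sub>R e 3)) v)) (at z)"
      by (rule has_derivative_compose[where f="\<lambda>z. z + s *\<^sub>R e 3" and g="\<lambda>z. R z $ i $ j", OF _ smooth_on_deriv[OF sR z(2)]])
        (auto intro!: derivative_eq_intros)
    then have "((\<lambda>z. R z $ i $ j) has_derivative (\<lambda>v. frechet_derivative (\<lambda>z. R z $ i $ j) (at (z + s *\<^sub>R e 3)) v)) (at z)"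
      by (rule has_derivative_transform_within_open[OF _ U zU]) (auto simp: U_def const)
    then show ?thesis by (simp add: frechet_derivative_eq)
  qed
  \<comment> \<open>The left-hand sides of the transport equation at two points of the same y-line
    agree, and so does R; hence the commutators of R with the two connection matrices agree.\<close>
  have compare: "(\<Sum>k\<in>UNIV. R w $ i $ k * asd_connection (connection (fst w1) v) j $ k)
        - (\<Sum>k\<in>UNIV. R w $ k $ j * asd_connection (connection (fst w1) v) k $ i) =
      (\<Sum>k\<in>UNIV. R w $ i $ k * asd_connection (connection (fst w2) v) j $ k)
        - (\<Sum>k\<in>UNIV. R w $ k $ j * asd_connection (connection (fst w2) v) k $ i)"
    if "w1 = w + s1 *\<^sub>R e 3" "w2 = w + s2 *\<^sub>R e 3" "w1 \<in> ?V" "w2 \<in> ?V" for w1 w2 s1 s2 v i j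
    using eq[of w1 i j "(v, 0)"] eq[of w2 i j "(v, 0)"] shift_deriv[OF w, of s1] shift_deriv[OF w, of s2]
      const[OF w, of s1] const[OF w, of s2] that by simp
  obtain y where y: "y1 < y" "y < 0" "Q y / P y \<noteq> Q 0 / P 0" "Q y / (72 * P y) + Q' y / 12 \<noteq> Q 0 / (72 * P 0) + Q' 0 / 12"
    using separating_point by blast
  \<comment> \<open>The point w is moved along its y-line to the heights 0 and y; the domain is a
    product in this direction, so both points lie in it.\<close>
  define w1 w2 where "w1 = w + (- fst w $ 3) *\<^sub>R e 3" and "w2 = w + (y - fst w $ 3) *\<^sub>R e 3"
  have V12: "w1 \<in> ?V" "w2 \<in> ?V" unfolding w1_def w2_def shift_V[OF w] using y y1 y2 by auto
  have c12: "fst w1 $ 3 = 0" "fst w2 $ 3 = y" by (simp_all add: w1_def w2_def e_def axis_def)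
  note cmp = compare[OF w1_def w2_def V12]
  define m where "m y = - sqrt (Q y) / (6 * sqrt (P y))" for y
  define n where "n y = Q y / (72 * P y) + Q' y / 12" for y
  have pos: "0 < P (fst x $ 3)" "0 < Q (fst x $ 3)" if "x \<in> ?V" for x :: E5 using that D0_pos[of "fst x"] by auto
  \<comment> \<open>Along \<theta> the connection matrix is m times the generator of rotations in
    the plane of the first and third basis form; along \<beta> it is n times the generator for the
    second and third.\<close>
  have A1: "asd_connection (connection (fst x) (axis 1 1)) k =
      (if k = 1 then vector [0, 0, - m (fst x $ 3)] else if k = 2 then 0 else vector [m (fst x $ 3), 0, 0])"
    if "x \<in> ?V" for x k
    using pos[OF that]
    by (auto simp: asd_connection_def connection_def coframe_def axis_def Let_def m_def vec_eq_iff forall_3 field_simps)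
  have A4: "asd_connection (connection (fst x) (axis 4 1)) k =
      (if k = 1 then 0 else if k = 2 then vector [0, 0, n (fst x $ 3)] else vector [0, - n (fst x $ 3), 0])"
    if "x \<in> ?V" for x k
    using pos[OF that]
    by (auto simp: asd_connection_def connection_def coframe_def axis_def Let_def n_def vec_eq_iff forall_3 field_simps)
  \<comment> \<open>The square of m is Q / (36 P), the quantity that \<open>separating_point\<close>
    distinguishes.\<close>
  have "(m 0)^2 \<noteq> (m y)^2"
    using pos[OF V12(1)] pos[OF V12(2)] y(3) c12 by (simp add: m_def power_divide power_mult_distrib)
  then have m: "m 0 \<noteq> m y" by auto
  have n: "n 0 \<noteq> n y" using y(4) by (simp add: n_def)
  note M = A1[OF V12(1)] A1[OF V12(2)] c12
  note N = A4[OF V12(1)] A4[OF V12(2)] c12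
  \<comment> \<open>Each instance reads: an entry, or a difference of two entries, times the nonzero
    \<open>m 0 - m y\<close> vanishes. The first generator decouples the second axis and equates the
    first and third diagonal entries; the second generator settles the rest.\<close>
  have "R w $ 3 $ 2 = 0" "R w $ 2 $ 3 = 0" "R w $ 2 $ 1 = 0" "R w $ 1 $ 2 = 0" "R w $ 1 $ 1 = R w $ 3 $ 3"
    using cmp[of 1 "axis 1 1" 2] cmp[of 2 "axis 1 1" 1] cmp[of 2 "axis 1 1" 3] cmp[of 3 "axis 1 1" 2] cmp[of 1 "axis 1 1" 3] m
    by (simp_all add: M sum_3 flip: left_diff_distrib right_diff_distrib)
  moreover have "R w $ 1 $ 3 = 0" "R w $ 3 $ 1 = 0" "R w $ 2 $ 2 = R w $ 3 $ 3"
    using cmp[of 1 "axis 4 1" 2] cmp[of 2 "axis 4 1" 1] cmp[of 2 "axis 4 1" 3] n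
    by (simp_all add: N sum_3 flip: left_diff_distrib right_diff_distrib)
  ultimately have diag: "R w $ i $ j = 0" if "i \<noteq> j" for i j
    using that exhaust_3[of i] exhaust_3[of j] by auto
  have "R w = mat 1"
    by (rule rotation_matrix_scalar[OF rot[OF w] diag])
      (use \<open>R w $ 1 $ 1 = R w $ 3 $ 3\<close> \<open>R w $ 2 $ 2 = R w $ 3 $ 3\<close> in auto)
  moreover obtain x where "\<beta> = combine (basis0 w) x"
    using asd_combine[OF K.inner_H[OF w] K.two_form_omega_H[OF w] oriented_frame0[OF w]] \<beta> K.asd_eq[OF w] by blast
  ultimately show "u kappa0 w \<beta> = \<beta>" using uR[OF w, of x] by simp
qed

end

section \<open>Density of the foliated chart\<close>

text \<open>A formula for the argument that is visibly smooth on the open upper (\<sigma> = 1) and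
  lower (\<sigma> = -1) half-plane, away from the branch cut of \<open>Arg\<close>.\<close>

lemma Arg_arctan:
  assumes "\<sigma> \<in> {1, -1}" "0 < \<sigma> * y"
  shows "Arg (Complex x y) = \<sigma> * pi / 2 - arctan (x / y)"
proof -
  define u where "u = arctan (x / y)"
  define r where "r = \<sigma> * y * sqrt (1 + (x / y)^2)"
  have sq: "sqrt (1 + (x / y)^2) \<noteq> 0" by (simp add: add_nonneg_eq_0_iff)
  have y: "y \<noteq> 0" using assms by auto
  have sc: "sin u = x / y / sqrt (1 + (x / y)^2)" "cos u = 1 / sqrt (1 + (x / y)^2)"
    by (simp_all add: u_def sin_arctan cos_arctan)
  have c: "cos (\<sigma> * pi / 2 - u) = \<sigma> * sin u" "sin (\<sigma> * pi / 2 - u) = \<sigma> * cos u"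
    using assms(1) by (auto simp: cos_diff sin_diff)
  have s2: "\<sigma> * \<sigma> = 1" using assms(1) by auto
  have "r * cos (\<sigma> * pi / 2 - u) = (\<sigma> * \<sigma>) * x" "r * sin (\<sigma> * pi / 2 - u) = (\<sigma> * \<sigma>) * y"
    unfolding c sc r_def using sq y by (simp_all add: field_simps)
  then have "Complex x y = rcis r (\<sigma> * pi / 2 - u)" by (simp add: complex_eq_iff s2)
  moreover have "0 < r" unfolding r_def by (rule mult_pos_pos[OF assms(2)]) (simp add: add_pos_nonneg)
  moreover have "\<sigma> * pi / 2 - u \<in> {-pi<..pi}"
    using assms(1) arctan_bounded[of "x / y"] by (auto simp: u_def)
  ultimately show ?thesis using Arg_rcis by (simp add: u_def)
qed

text \<open>The chain rule makes the derivative injective, and equal dimensions make it bijective,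
  so no Jacobian has to be computed.\<close>

lemma local_diffeo_on_left_inverse:
  fixes f h :: "'a::euclidean_space \<Rightarrow> 'a"
  assumes "open S" "open T" "smooth_on S f" "f ` S \<subseteq> T" "smooth_on T h" "\<And>x. x \<in> S \<Longrightarrow> h (f x) = x"
  shows "local_diffeo_on S f"
  unfolding local_diffeo_on_def
proof (intro conjI ballI assms(3))
  fix x assume x: "x \<in> S"
  note df = smooth_on_deriv[OF assms(3) x]
  have "f x \<in> T" using assms(4) x by auto
  note dh = smooth_on_deriv[OF assms(5) this]
  have "((\<lambda>x. h (f x)) has_derivative (\<lambda>v. frechet_derivative h (at (f x)) (frechet_derivative f (at x) v))) (at x)"
    by (rule has_derivative_compose[where f=f and g=h, OF df dh])
  then have "((\<lambda>x. x) has_derivative (\<lambda>v. frechet_derivative h (at (f x)) (frechet_derivative f (at x) v))) (at x)"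
    by (rule has_derivative_transform_within_open[OF _ assms(1) x]) (rule assms(6))
  then have "(\<lambda>v. frechet_derivative h (at (f x)) (frechet_derivative f (at x) v)) = (\<lambda>v. v)"
    using has_derivative_unique[OF _ has_derivative_ident] by blast
  then have "inj (frechet_derivative f (at x))" by (metis injI)
  then show "bij (frechet_derivative f (at x))"
    using linear_injective_imp_surjective[OF has_derivative_linear[OF df]] by (simp add: bij_def)
qed

text \<open>If a coordinate of G vanished on an open set, its derivative would vanish there, against
  surjectivity of the derivative of G. This is the reason why the loci missed by the angular
  coordinates have no interior.\<close>

lemma local_diffeo_on_nonvanishing:
  fixes G :: "E5 \<Rightarrow> E5"
  assumes "local_diffeo_on W G" "open U" "U \<noteq> {}" "U \<subseteq> W"
  shows "\<exists>z\<in>U. fst (G z) $ i \<noteq> 0"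
proof (rule ccontr)
  assume "\<not> ?thesis"
  then have z0: "fst (G z) $ i = 0" if "z \<in> U" for z using that by blast
  obtain x where x: "x \<in> U" using assms(3) by auto
  have xW: "x \<in> W" using x assms(4) by auto
  have "smooth_on W G" using assms(1) by (simp add: local_diffeo_on_def)
  note d = smooth_on_deriv[OF this xW]
  have "((\<lambda>z. fst (G z) $ i) has_derivative (\<lambda>v. fst (frechet_derivative G (at x) v) $ i)) (at x)"
    by (rule has_derivative_compose[where f=G and g="\<lambda>z. fst z $ i", OF d has_derivative_fst_nth])
  moreover have "((\<lambda>z. fst (G z) $ i) has_derivative (\<lambda>v. 0)) (at x)"
    by (rule has_derivative_transform_within_open[OF has_derivative_const[of 0] assms(2) x]) (simp add: z0)
  ultimately have z: "fst (frechet_derivative G (at x) v) $ i = 0" for v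
    using has_derivative_unique by metis
  have "surj (frechet_derivative G (at x))"
    using assms(1) xW by (simp add: local_diffeo_on_def bij_def)
  then obtain v where "frechet_derivative G (at x) v = (axis i 1, 0)" by (metis surjD)
  then show False using z[of v] by (simp add: axis_def)
qed

text \<open>The radial substitution of the corner parametrisations and its inverse. Either end of
  the range of y can be the centre of a corner, so the order of the two ends is left open.\<close>

lemma moebius_strict_between:
  fixes y z r :: real
  assumes "y \<noteq> z" "0 < r"
  shows "min y z < (y + r * z) / (1 + r)" "(y + r * z) / (1 + r) < max y z"
    "((y + r * z) / (1 + r) - y) / (z - (y + r * z) / (1 + r)) = r"
proof -
  define t where "t = (y + r * z) / (1 + r)"
  have t: "t - y = r * (z - y) / (1 + r)" "z - t = (z - y) / (1 + r)"
    using assms by (simp_all add: t_def field_simps)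
  have "(t - y) / (z - t) = r" unfolding t using assms by simp
  moreover have "min y z < t \<and> t < max y z"
  proof (cases "y < z")
    case True
    then have "0 < t - y" "0 < z - t" unfolding t using assms by simp_all
    then show ?thesis using True by auto
  next
    case False
    then have "z < y" using assms by auto
    then have "t - y < 0" "z - t < 0" unfolding t using assms
      by (simp_all add: divide_neg_pos mult_pos_neg)
    then show ?thesis using \<open>z < y\<close> by auto
  qed
  ultimately show "min y z < (y + r * z) / (1 + r)" "(y + r * z) / (1 + r) < max y z"
    "((y + r * z) / (1 + r) - y) / (z - (y + r * z) / (1 + r)) = r" unfolding t_def by blast+
qed

context Y_params begin

text \<open>The map inside \<open>Y_corner\<close> with each \<open>Arg\<close> replaced by its
  branch on a half-plane, selected by the signs \<open>\<sigma>A\<close> and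
  \<open>\<sigma>B\<close>.\<close>

definition corner_coords :: "real \<Rightarrow> real \<Rightarrow> real \<Rightarrow> real \<Rightarrow> real \<Rightarrow> E5 \<Rightarrow> E5" where
  "corner_coords s ya yb \<sigma>A \<sigma>B z =
    (let r2 = (fst z $ 1)^2 + (fst z $ 2)^2; \<rho>2 = (fst z $ 3)^2 + (fst z $ 4)^2;
         A = \<sigma>A * pi / 2 - arctan (fst z $ 1 / fst z $ 2); B = \<sigma>B * pi / 2 - arctan (fst z $ 3 / fst z $ 4)
     in mk (arccos (s * (1 - r2) / (1 + r2))) A ((ya + \<rho>2 * yb) / (1 + \<rho>2))
           (s * A + B) (- Y_f p q ya * B + Y_l p q * snd z))"

text \<open>The polar formulas solved for the Cartesian coordinates: the squared radii are (1 - s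
  cos \<theta>) / (1 + s cos \<theta>) and (y - ya) / (yb - y), the angles \<phi> and \<psi> - s
  \<phi>. It serves only as a smooth left inverse.\<close>

definition corner_inv :: "real \<Rightarrow> real \<Rightarrow> real \<Rightarrow> E5 \<Rightarrow> E5" where
  "corner_inv s ya yb c =
    (let r = sqrt ((1 - s * cos (fst c $ 1)) / (1 + s * cos (fst c $ 1))); \<rho> = sqrt ((fst c $ 3 - ya) / (yb - fst c $ 3));
         A = fst c $ 2; B = fst c $ 4 - s * A
     in (vector [r * cos A, r * sin A, \<rho> * cos B, \<rho> * sin B], (snd c + Y_f p q ya * B) / Y_l p q))"

text \<open>One of four regions on which both arguments have a smooth branch and both radii are
  positive, so that the point lies over the interior of the coordinate box.\<close>

definition sector :: "real \<Rightarrow> real \<Rightarrow> E5 set" where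
  "sector \<sigma>A \<sigma>B = {z. 0 < \<sigma>A * fst z $ 2 \<and> 0 < \<sigma>B * fst z $ 4}"

lemma open_sector: "open (sector \<sigma>A \<sigma>B)"
  unfolding sector_def by (intro open_Collect_conj open_Collect_less continuous_intros)

lemma smooth_on_mk:
  assumes "open S" "smooth_on S f1" "smooth_on S f2" "smooth_on S f3" "smooth_on S f4" "smooth_on S f5"
  shows "smooth_on S (\<lambda>z. mk (f1 z) (f2 z) (f3 z) (f4 z) (f5 z))"
  unfolding mk_def
proof (intro smooth_on_Pair smooth_on_vec assms(1,6))
  show "smooth_on S (\<lambda>x. vector [f1 x, f2 x, f3 x, f4 x] $ i :: real)" for i :: 4
    using exhaust_4[of i] assms(2-5) by (elim disjE) simp_all
qed

lemma corner_coords: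
  assumes "s \<in> {1, -1}" "(ya, yb) \<in> {(y1, y2), (y2, y1)}" "\<sigma>A \<in> {1, -1}" "\<sigma>B \<in> {1, -1}"
  shows "local_diffeo_on (sector \<sigma>A \<sigma>B) (corner_coords s ya yb \<sigma>A \<sigma>B)"
    "corner_coords s ya yb \<sigma>A \<sigma>B ` sector \<sigma>A \<sigma>B \<subseteq> fst (Y_coords p q)"
    "z \<in> sector \<sigma>A \<sigma>B \<Longrightarrow> snd (Y_corner p q s ya yb) z = Y_point p q (corner_coords s ya yb \<sigma>A \<sigma>B z)"
proof -
  let ?C = "sector \<sigma>A \<sigma>B"
  have yab: "ya \<noteq> yb" "min ya yb = y1" "max ya yb = y2" using assms(2) y1 y2 by auto
  have s2: "s * s = 1" using assms(1) by auto
  have nz: "fst z $ 2 \<noteq> 0" "fst z $ 4 \<noteq> 0" if "z \<in> ?C" for z using that by (auto simp: sector_def)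
  define r2 where "r2 z = (fst z $ 1)^2 + (fst z $ 2)^2" for z :: E5
  define \<rho>2 where "\<rho>2 z = (fst z $ 3)^2 + (fst z $ 4)^2" for z :: E5
  define X where "X z = s * (1 - r2 z) / (1 + r2 z)" for z
  have pos: "0 < r2 z" "0 < \<rho>2 z" if "z \<in> ?C" for z
    using nz[OF that] by (auto simp: r2_def \<rho>2_def add_nonneg_pos)
  have n1: "1 + r2 z \<noteq> 0" "1 + \<rho>2 z \<noteq> 0" for z
    by (auto simp: r2_def \<rho>2_def) (smt (verit) zero_le_power2)+
  have Xs: "s * X z = (1 - r2 z) / (1 + r2 z)" for z
    using s2 unfolding X_def by (simp flip: mult.assoc)
  have Xb: "-1 < X z \<and> X z < 1" if "z \<in> ?C" for z
  proof -
    have "\<bar>s * X z\<bar> < 1" unfolding Xs using pos[OF that] by (auto simp: abs_less_iff field_simps)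
    then show ?thesis using assms(1) by (auto simp: abs_less_iff)
  qed
  define A B where "A z = \<sigma>A * pi / 2 - arctan (fst z $ 1 / fst z $ 2)"
    and "B z = \<sigma>B * pi / 2 - arctan (fst z $ 3 / fst z $ 4)" for z :: E5
  have cc: "corner_coords s ya yb \<sigma>A \<sigma>B z = mk (arccos (X z)) (A z) ((ya + \<rho>2 z * yb) / (1 + \<rho>2 z)) (s * A z + B z)
     (- Y_f p q ya * B z + Y_l p q * snd z)" for z
    by (simp add: corner_coords_def Let_def X_def r2_def \<rho>2_def A_def B_def)
  have Arg: "Arg (Complex (fst z $ 1) (fst z $ 2)) = A z" "Arg (Complex (fst z $ 3) (fst z $ 4)) = B z" if "z \<in> ?C" for z
    using that Arg_arctan[OF assms(3)] Arg_arctan[OF assms(4)] by (auto simp: sector_def A_def B_def)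
  show "snd (Y_corner p q s ya yb) z = Y_point p q (corner_coords s ya yb \<sigma>A \<sigma>B z)" if "z \<in> ?C" for z
    unfolding cc Y_corner_def snd_conv Let_def Arg[OF that] X_def r2_def \<rho>2_def ..
  show sub: "corner_coords s ya yb \<sigma>A \<sigma>B ` ?C \<subseteq> fst (Y_coords p q)"
  proof
    fix c assume "c \<in> corner_coords s ya yb \<sigma>A \<sigma>B ` ?C"
    then obtain z where z: "z \<in> ?C" "c = corner_coords s ya yb \<sigma>A \<sigma>B z" by auto
    show "c \<in> fst (Y_coords p q)"
      using arccos_lt_bounded[of "X z"] Xb[OF z(1)] moebius_strict_between[OF yab(1) pos(2)[OF z(1)]] yab(2,3)
      by (simp add: z(2) cc Y_coords_domain D0_def mk_def)
  qed
  note oD = open_coords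
  note c = smooth_on_fst_nth[OF open_sector]
  have sr: "smooth_on ?C r2" "smooth_on ?C \<rho>2"
    unfolding r2_def \<rho>2_def by (intro smooth_on_add smooth_on_power open_sector c)+
  have sX: "smooth_on ?C X"
    unfolding X_def
    by (intro smooth_on_divide smooth_on_mult smooth_on_add smooth_on_diff smooth_on_const open_sector sr n1)
  have sAB: "smooth_on ?C A" "smooth_on ?C B"
    unfolding A_def B_def
    by (intro smooth_on_diff smooth_on_const smooth_on_arctan smooth_on_divide open_sector c nz; assumption)+
  have smooth: "smooth_on ?C (corner_coords s ya yb \<sigma>A \<sigma>B)"
    unfolding cc[abs_def]
    by (intro smooth_on_mk smooth_on_arccos smooth_on_divide smooth_on_add smooth_on_mult smooth_on_const smooth_on_snd
        open_sector sX Xb sAB sr n1)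
  let ?T = "fst (Y_coords p q)"
  note d = smooth_on_fst_nth[OF oD]
  \<comment> \<open>Strictly inside the range of \<theta> the cosine is strictly between -1 and 1,
    which keeps the squared radius positive and finite.\<close>
  have cp: "0 < 1 - s * cos (fst c $ 1)" "0 < 1 + s * cos (fst c $ 1)" if "c \<in> ?T" for c
  proof -
    have t: "0 < fst c $ 1" "fst c $ 1 < pi" using that by (auto simp: Y_coords_domain D0_def)
    have "cos (fst c $ 1) < cos 0" "cos pi < cos (fst c $ 1)"
      using t by (intro cos_monotone_0_pi; simp)+
    then show "0 < 1 - s * cos (fst c $ 1)" "0 < 1 + s * cos (fst c $ 1)" using assms(1) by auto
  qed
  have yp: "yb - fst c $ 3 \<noteq> 0" "0 < (fst c $ 3 - ya) / (yb - fst c $ 3)" if "c \<in> ?T" for c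
    using that assms(2) by (auto simp: Y_coords_domain D0_def zero_less_divide_iff)
  have smooth_inv: "smooth_on ?T (corner_inv s ya yb)"
  proof -
    have cn: "1 + s * cos (fst c $ 1) \<noteq> 0" if "c \<in> ?T" for c using cp(2)[OF that] by simp
    have cq: "0 < (1 - s * cos (fst c $ 1)) / (1 + s * cos (fst c $ 1))" if "c \<in> ?T" for c
      using cp[OF that] by simp
    have scos: "smooth_on ?T (\<lambda>c. s * cos (fst c $ 1))"
      by (intro smooth_on_mult smooth_on_cos smooth_on_const oD d)
    have 1: "smooth_on ?T (\<lambda>c. sqrt ((1 - s * cos (fst c $ 1)) / (1 + s * cos (fst c $ 1))))"
      by (intro smooth_on_sqrt[OF oD] smooth_on_divide smooth_on_diff smooth_on_add smooth_on_const scos oD cn cq; assumption)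
    have 2: "smooth_on ?T (\<lambda>c. sqrt ((fst c $ 3 - ya) / (yb - fst c $ 3)))"
      by (intro smooth_on_sqrt[OF oD] smooth_on_divide smooth_on_diff smooth_on_const oD d yp; assumption)
    have 3: "smooth_on ?T (\<lambda>c. fst c $ 4 - s * fst c $ 2)"
      by (intro smooth_on_diff smooth_on_mult smooth_on_const oD d)
    have 4: "smooth_on ?T (\<lambda>c. (snd c + Y_f p q ya * (fst c $ 4 - s * fst c $ 2)) / Y_l p q)"
      by (intro smooth_on_divide smooth_on_add smooth_on_mult smooth_on_const smooth_on_snd oD 3 Y_l_nonzero)
    show ?thesis
      unfolding corner_inv_def[abs_def] Let_def mk_def[symmetric]
      by (intro smooth_on_mk smooth_on_mult smooth_on_cos smooth_on_sin oD d 1 2 3 4)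
  qed
  have inv: "corner_inv s ya yb (corner_coords s ya yb \<sigma>A \<sigma>B z) = z" if z: "z \<in> ?C" for z
  proof -
    have "cos (arccos (X z)) = X z" using Xb[OF z] by (intro cos_arccos) auto
    moreover have "(1 - s * X z) / (1 + s * X z) = r2 z"
      using n1(1)[of z] unfolding Xs by (simp add: field_simps)
    ultimately have r: "sqrt ((1 - s * cos (arccos (X z))) / (1 + s * cos (arccos (X z)))) = sqrt (r2 z)" by simp
    note m = moebius_strict_between(3)[OF yab(1) pos(2)[OF z]]
    have polar: "sqrt (x^2 + y^2) * cos (Arg (Complex x y)) = x" "sqrt (x^2 + y^2) * sin (Arg (Complex x y)) = y" for x y
      using arg_cong[OF rcis_cmod_Arg[of "Complex x y"], of Re] arg_cong[OF rcis_cmod_Arg[of "Complex x y"], of Im]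
      by (simp_all add: cmod_def)
    have "sqrt (r2 z) * cos (A z) = fst z $ 1" "sqrt (r2 z) * sin (A z) = fst z $ 2"
      "sqrt (\<rho>2 z) * cos (B z) = fst z $ 3" "sqrt (\<rho>2 z) * sin (B z) = fst z $ 4"
      unfolding Arg[OF z, symmetric] r2_def \<rho>2_def by (rule polar)+
    then show ?thesis
      unfolding cc corner_inv_def Let_def mk_def using Y_l_nonzero
      by (intro E5_eqI) (simp_all add: r m)
  qed
  show "local_diffeo_on ?C (corner_coords s ya yb \<sigma>A \<sigma>B)"
    by (rule local_diffeo_on_left_inverse[OF open_sector oD smooth sub smooth_inv inv])
qed

text \<open>Every parametrisation built on a generating one agrees, on some nonempty open part of
  any open set, with the coordinate chart: outside the hypersurfaces on which a branch of the angles
  fails, the corner maps factor through the coordinates.\<close>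

lemma factor_through_coords:
  fixes U :: "E5 set"
  assumes "(D, Z) \<in> {Y_coords p q, Y_corner p q 1 y1 y2, Y_corner p q 1 y2 y1,
      Y_corner p q (-1) y1 y2, Y_corner p q (-1) y2 y1}"
    and "open U" "U \<noteq> {}" "local_diffeo_on U G" "G ` U \<subseteq> D"
  shows "\<exists>W \<rho>. open W \<and> W \<noteq> {} \<and> W \<subseteq> U \<and> local_diffeo_on W \<rho> \<and> \<rho> ` W \<subseteq> fst (Y_coords p q) \<and>
    (\<forall>z\<in>W. Z (G z) = Y_point p q (\<rho> z))"
proof (cases "(D, Z) = Y_coords p q")
  case True
  then have "D = fst (Y_coords p q)" "Z = Y_point p q" using snd_Y_coords by (metis fst_conv, metis snd_conv)
  then show ?thesis using assms by (intro exI[of _ U] exI[of _ G]) auto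
next
  case False
  then obtain s ya yb where s: "s \<in> {1, -1}" "(ya, yb) \<in> {(y1, y2), (y2, y1)}" "(D, Z) = Y_corner p q s ya yb"
    using assms(1) by auto
  have sG: "smooth_on U G" using assms(4) by (simp add: local_diffeo_on_def)
  have cG: "continuous_on U (\<lambda>z. fst (G z) $ i)" for i
    by (rule smooth_on_continuous[OF smooth_on_linear_comp[OF bounded_linear_compose[OF bounded_linear_vec_nth bounded_linear_fst] assms(2) sG]])
  \<comment> \<open>Two coordinates of G must be nonzero at once: the first condition cuts out a
    nonempty open set, and the nonvanishing argument is repeated on it for the second. The signs at
    the point found select the sector.\<close>
  define U2 where "U2 = U \<inter> (\<lambda>z. fst (G z) $ 2) -` (- {0})"
  have U2: "open U2" unfolding U2_def by (rule continuous_open_preimage[OF cG assms(2)]) auto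
  have "U2 \<noteq> {}" using local_diffeo_on_nonvanishing[OF assms(4,2,3) subset_refl, of 2] by (auto simp: U2_def)
  then obtain w where w: "w \<in> U2" "fst (G w) $ 4 \<noteq> 0"
    using local_diffeo_on_nonvanishing[OF assms(4) U2, of 4] by (auto simp: U2_def)
  define \<sigma>A \<sigma>B where "\<sigma>A = sgn (fst (G w) $ 2)" and "\<sigma>B = sgn (fst (G w) $ 4)"
  have \<sigma>: "\<sigma>A \<in> {1, -1}" "\<sigma>B \<in> {1, -1}" using w by (auto simp: \<sigma>A_def \<sigma>B_def sgn_if U2_def)
  define W where "W = U \<inter> G -` sector \<sigma>A \<sigma>B"
  have oW: "open W" unfolding W_def
    by (rule continuous_open_preimage[OF smooth_on_continuous[OF sG] assms(2) open_sector])
  have "w \<in> W" using w by (auto simp: W_def U2_def sector_def \<sigma>A_def \<sigma>B_def sgn_if)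
  have GW: "G ` W \<subseteq> sector \<sigma>A \<sigma>B" and WU: "W \<subseteq> U" by (auto simp: W_def)
  note cc = corner_coords[OF s(1,2) \<sigma>]
  show ?thesis
  proof (intro exI[of _ W] exI[of _ "\<lambda>z. corner_coords s ya yb \<sigma>A \<sigma>B (G z)"] conjI ballI)
    show "local_diffeo_on W (\<lambda>z. corner_coords s ya yb \<sigma>A \<sigma>B (G z))"
      by (rule local_diffeo_on_compose[OF oW open_sector local_diffeo_on_subset[OF assms(4) WU] GW cc(1)])
    show "(\<lambda>z. corner_coords s ya yb \<sigma>A \<sigma>B (G z)) ` W \<subseteq> fst (Y_coords p q)" using cc(2) GW by blast
    have Z: "Z = snd (Y_corner p q s ya yb)" using s(3) by (metis snd_conv)
    show "Z (G z) = Y_point p q (corner_coords s ya yb \<sigma>A \<sigma>B (G z))" if "z \<in> W" for z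
      unfolding Z by (rule cc(3)) (use GW that in auto)
  qed (use oW \<open>w \<in> W\<close> WU in auto)
qed

end

lemma smooth_structureE:
  assumes "(V, X) \<in> smooth_structure A0" "w \<in> V"
  obtains W D Z G where "open W" "w \<in> W" "W \<subseteq> V" "(D, Z) \<in> A0" "local_diffeo_on W G" "G ` W \<subseteq> D"
    "\<And>z. z \<in> W \<Longrightarrow> X z = Z (G z)"
proof -
  have "\<forall>w\<in>V. \<exists>W D Z G. open W \<and> w \<in> W \<and> W \<subseteq> V \<and> (D, Z) \<in> A0 \<and> local_diffeo_on W G \<and>
      G ` W \<subseteq> D \<and> (\<forall>w'\<in>W. X w' = Z (G w'))"
    using assms(1) unfolding smooth_structure_def by simp
  from bspec[OF this assms(2)] show thesis using that by blast
qed

context Y_geometry begin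

lemma foliated_kappa0: "foliated (Y_structure p q) \<xi> kappa0"
  unfolding foliated_def
proof (intro conjI kappa0_in exI[of _ D0] exI[of _ UNIV])
  show "\<forall>w\<in>fst kappa0. \<xi> kappa0 w = (0, 1)" using xi_kappa0 by (simp add: kappa0_def)
qed (simp_all add: kappa0_def open_D0)

text \<open>Density in the form in which it is used: each nonempty open set in a parametrisation
  contains a point with a transition map to the foliated chart.\<close>

lemma transition_kappa0_dense:
  assumes "\<kappa> \<in> Y_structure p q" "open U" "U \<noteq> {}" "U \<subseteq> fst \<kappa>"
  shows "\<exists>w\<in>U. \<exists>W \<tau>. w \<in> W \<and> transition \<kappa> kappa0 W \<tau>"
proof -
  obtain V X where \<kappa>: "\<kappa> = (V, X)" by (cases \<kappa>)
  obtain w where w: "w \<in> U" using assms(3) by auto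
  then have "w \<in> V" using assms(4) \<kappa> by auto
  from assms(1)[unfolded \<kappa> Y_structure_def] this
  obtain W D Z G where W: "open W" "w \<in> W" "W \<subseteq> V" and DZ: "(D, Z) \<in> {Y_coords p q, Y_corner p q 1 y1 y2, Y_corner p q 1 y2 y1,
      Y_corner p q (-1) y1 y2, Y_corner p q (-1) y2 y1}" and G: "local_diffeo_on W G" "G ` W \<subseteq> D" "\<And>z. z \<in> W \<Longrightarrow> X z = Z (G z)"
    by (rule smooth_structureE) (rule that)
  have "open (W \<inter> U)" "W \<inter> U \<noteq> {}" "local_diffeo_on (W \<inter> U) G" "G ` (W \<inter> U) \<subseteq> D"
    using W w assms(2) G local_diffeo_on_subset[OF G(1)] by auto
  then obtain W' \<rho> where W': "open W'" "W' \<noteq> {}" "W' \<subseteq> W \<inter> U" "local_diffeo_on W' \<rho>" "\<rho> ` W' \<subseteq> fst (Y_coords p q)"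
    "\<And>z. z \<in> W' \<Longrightarrow> Z (G z) = Y_point p q (\<rho> z)"
    using factor_through_coords[OF DZ] by metis
  \<comment> \<open>The foliated chart differs from the coordinate chart by the linear bijection
    \<open>iota\<close> only, so its inverse turns a factorisation through the latter into a
    transition map.\<close>
  have "local_diffeo_on W' (\<lambda>z. iota_inv (\<rho> z))"
    by (rule local_diffeo_on_compose[OF W'(1) open_coords W'(4,5) local_diffeo_on_linear[OF bounded_linear_iota_inv bij_iota(2) open_coords]])
  moreover have "(\<lambda>z. iota_inv (\<rho> z)) ` W' \<subseteq> fst kappa0"
  proof
    fix c assume "c \<in> (\<lambda>z. iota_inv (\<rho> z)) ` W'"
    then obtain z where z: "z \<in> W'" "c = iota_inv (\<rho> z)" by auto
    have "iota c \<in> fst (Y_coords p q)" using W'(5) z by (auto simp: iota_inverse)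
    then show "c \<in> fst kappa0" by (simp add: iota_domain kappa0_def mem_Times_iff)
  qed
  moreover have "snd \<kappa> z = snd kappa0 (iota_inv (\<rho> z))" if "z \<in> W'" for z
  proof -
    have "z \<in> W" using that W'(3) by blast
    then show ?thesis using G(3)[of z] W'(6)[OF that] by (simp add: \<kappa> kappa0_def iota_inverse)
  qed
  ultimately have "transition \<kappa> kappa0 W' (\<lambda>z. iota_inv (\<rho> z))"
    using W'(1,3) W(3) unfolding transition_def \<kappa> by auto
  then show ?thesis using W'(2,3) by blast
qed

lemma irreducible: "transverse_LC_irreducible (Y_structure p q) g \<xi>"
proof (rule irreducible_from_dense_chart[OF _ _ foliated_kappa0 kappa0_chart])
  show "riemannian_metric (Y_structure p q) g" using metric by (simp add: Y_metric_def)
  show "vector_field (Y_structure p q) \<xi>" using reeb_field by (simp add: Y_reeb_def)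
  show "\<exists>e. orthonormal (K.H w) e \<and> wedge (K.om w) (K.om w) e = 2" if "w \<in> D0 \<times> UNIV" for w
    using orthonormal_frame0[OF that] wedge_frame0[OF that] by blast
  show "\<exists>w\<in>U. \<exists>W \<tau>. w \<in> W \<and> transition \<kappa> kappa0 W \<tau>"
    if "foliated (Y_structure p q) \<xi> \<kappa>" "open U" "U \<noteq> {}" "U \<subseteq> fst \<kappa>" for \<kappa> U
    by (rule transition_kappa0_dense[OF foliatedD(1)[OF that(1)] that(2-4)])
qed (rule parallel_identity[OF _ _ foliated_kappa0])

end

theorem proposition5p7:
  fixes p q :: nat and g :: "E5 set metric" and \<xi> :: "E5 set vfield"
  assumes "coprime p q" and "q < p" and "(p, q) \<noteq> (1, 0)"
    and "Y_metric p q g" and "Y_reeb p q \<xi>"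
  shows "transverse_LC_irreducible (Y_structure p q) g \<xi>"
proof -
  \<comment> \<open>For q = 0 coprimality forces p = 1, which is the excluded pair.\<close>
  have "0 < q"
  proof (rule ccontr)
    assume "\<not> 0 < q"
    then have "q = 0" by simp
    then show False using assms(1,3) by simp
  qed
  then interpret Y_geometry p q g \<xi> by unfold_locales (use assms in auto)
  show ?thesis by (rule irreducible)
qed

end
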